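(* For any $d \geq 2$, there is a bounded $\mathbb{C}$-convex open set $\Omega \subset \mathbb{C}^d$ such that $(\Omega, K_{\Omega})$ is Gromov hyperbolic, where $K_\Omega$ is the Kobayashi distance on $\Omega$, and $\partial \Omega$ contains a complex affine ball of dimension $d-1$.
   Context: An open set $\Omega \subset \mathbb{C}^d$ is called $\mathbb{C}$-convex if its intersection with any complex (affine) line is either empty or contractible. A complex affine ball of dimension $m$ in $\mathbb{C}^d$ is the image of the open unit ball of $\mathbb{C}^m$ under an injective complex affine map $\mathbb{C}^m\to\mathbb{C}^d$. Kobayashi metric and distance: let $\Delta=\{z\in\mathbb{C}:|z|<1\}$. For a domain $\Omega\subset\mathbb{C}^{d}$, $x \in \Omega$ and $v \in \mathbb{C}^d$ put $k_{\Omega}(x;v) = \inf \{ |\xi| : f:\Delta\to\Omega \text{ holomorphic},\ f(0) = x,\ d(f)_0(\xi) = v \}$. For an absolutely continuous curve $\sigma:[a,b]\to\Omega$ put $\ell_\Omega(\sigma)= \int_a^b k_\Omega(\sigma(t); \sigma'(t))\, dt$. The Kobayashi (pseudo-)distance $K_\Omega(x,y)$ is the infimum of $\ell_\Omega(\sigma)$ over all absolutely continuous curves $\sigma:[a,b]\to\Omega$ with $\sigma(a)=x$ and $\sigma(b)=y$. Gromov hyperbolicity: in a metric space $(X,d)$, a geodesic is a curve $\sigma : I \to X$ ($I\subset\mathbb{R}$ an interval) with $d(\sigma(t_1),\sigma(t_2))=|t_1-t_2|$ for all $t_1,t_2\in I$. A geodesic triangle is a choice of three points and geodesic segments connecting them;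 it is $\delta$-thin if any point on any side is within distance $\delta$ of the union of the other two sides. A proper geodesic metric space is $\delta$-hyperbolic if every geodesic triangle is $\delta$-thin, and Gromov hyperbolic if it is $\delta$-hyperbolic for some $\delta \ge 0$. *)

theory Defs
  imports "HOL-Analysis.Analysis"
begin

section \<open>Convexity and affine balls in complex space\<close>

definition complex_line :: "(complex ^ 'n) set \<Rightarrow> bool" where
  "complex_line L \<longleftrightarrow> (\<exists>p v. v \<noteq> 0 \<and> L = range (\<lambda>t. p + t *s v))"

definition C_convex :: "(complex ^ 'n) set \<Rightarrow> bool" where
  "C_convex \<Omega> \<longleftrightarrow> (\<forall>L. complex_line L \<longrightarrow> \<Omega> \<inter> L = {} \<or> contractible (\<Omega> \<inter> L))"

text \<open>The dimension \<open>m\<close> of an affine ball is a number rather than a type, so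
  \<open>\<complex>\<^sup>m\<close> is represented by the sequences that vanish from index \<open>m\<close> on. The complex affine maps
  from \<open>\<complex>\<^sup>m\<close> are exactly the maps \<open>w \<mapsto> p + w\<^sub>0 v\<^sub>0 + \<dots> + w\<^bsub>m-1\<^esub> v\<^bsub>m-1\<^esub>\<close>.\<close>

definition complex_space :: "nat \<Rightarrow> (nat \<Rightarrow> complex) set" where
  "complex_space m = {w. \<forall>i\<ge>m. w i = 0}"

definition complex_unit_ball :: "nat \<Rightarrow> (nat \<Rightarrow> complex) set" where
  "complex_unit_ball m = {w \<in> complex_space m. (\<Sum>i<m. (cmod (w i))\<^sup>2) < 1}"

definition complex_affine_ball :: "nat \<Rightarrow> (complex ^ 'n) set \<Rightarrow> bool" where
  "complex_affine_ball m B \<longleftrightarrow>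
     (\<exists>p v. inj_on (\<lambda>w. p + (\<Sum>i<m. w i *s v i)) (complex_space m) \<and>
            B = (\<lambda>w. p + (\<Sum>i<m. w i *s v i)) ` complex_unit_ball m)"


section \<open>The Kobayashi metric and distance\<close>

definition holomorphic_disc :: "(complex ^ 'n) set \<Rightarrow> (complex \<Rightarrow> complex ^ 'n) \<Rightarrow> bool" where
  "holomorphic_disc \<Omega> f \<longleftrightarrow>
     f \<in> ball 0 1 \<rightarrow> \<Omega> \<and> (\<forall>i. (\<lambda>z. f z $ i) holomorphic_on ball 0 1)"

definition kobayashi_metric :: "(complex ^ 'n) set \<Rightarrow> complex ^ 'n \<Rightarrow> complex ^ 'n \<Rightarrow> real" where
  "kobayashi_metric \<Omega> x v =
     Inf {cmod \<xi> | \<xi> f. holomorphic_disc \<Omega> f \<and> f 0 = x \<and> frechet_derivative f (at 0) \<xi> = v}"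

definition absolutely_continuous_curve ::
    "real \<Rightarrow> real \<Rightarrow> (real \<Rightarrow> 'a::real_normed_vector) \<Rightarrow> bool" where
  "absolutely_continuous_curve a b \<sigma> \<longleftrightarrow>
     (\<forall>\<epsilon>>0. \<exists>\<delta>>0. \<forall>D. D division_of \<Union>D \<and> \<Union>D \<subseteq> {a..b} \<and> (\<Sum>k\<in>D. Sup k - Inf k) < \<delta> \<longrightarrow>
        (\<Sum>k\<in>D. norm (\<sigma> (Sup k) - \<sigma> (Inf k))) < \<epsilon>)"

text \<open>An absolutely continuous curve is differentiable almost everywhere, so the arbitrary value
  of \<^const>\<open>vector_derivative\<close> at the remaining points does not affect the integral.\<close>

definition kobayashi_length ::
    "(complex ^ 'n) set \<Rightarrow> real \<Rightarrow> real \<Rightarrow> (real \<Rightarrow> complex ^ 'n) \<Rightarrow> ennreal" where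
  "kobayashi_length \<Omega> a b \<sigma> =
     (\<integral>\<^sup>+ t. ennreal (kobayashi_metric \<Omega> (\<sigma> t) (vector_derivative \<sigma> (at t within {a..b})))
        \<partial>lebesgue_on {a..b})"

text \<open>The infimum is infinite, and \<open>enn2real\<close> sends it to \<open>0\<close>, if no curve in \<open>\<Omega>\<close> joins
  \<open>x\<close> and \<open>y\<close>; this does not happen for two points of a connected open set.\<close>

definition kobayashi_distance :: "(complex ^ 'n) set \<Rightarrow> complex ^ 'n \<Rightarrow> complex ^ 'n \<Rightarrow> real" where
  "kobayashi_distance \<Omega> x y =
     enn2real (Inf {kobayashi_length \<Omega> a b \<sigma> | a b \<sigma>.
       a \<le> b \<and> absolutely_continuous_curve a b \<sigma> \<and> \<sigma> \<in> {a..b} \<rightarrow> \<Omega> \<and> \<sigma> a = x \<and> \<sigma> b = y})"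


section \<open>Gromov hyperbolicity\<close>

definition geodesic :: "'a set \<Rightarrow> ('a \<Rightarrow> 'a \<Rightarrow> real) \<Rightarrow> real set \<Rightarrow> (real \<Rightarrow> 'a) \<Rightarrow> bool" where
  "geodesic X d I \<sigma> \<longleftrightarrow>
     is_interval I \<and> \<sigma> \<in> I \<rightarrow> X \<and> (\<forall>s\<in>I. \<forall>t\<in>I. d (\<sigma> s) (\<sigma> t) = \<bar>s - t\<bar>)"

definition geodesic_segment :: "'a set \<Rightarrow> ('a \<Rightarrow> 'a \<Rightarrow> real) \<Rightarrow> 'a \<Rightarrow> 'a \<Rightarrow> 'a set \<Rightarrow> bool" where
  "geodesic_segment X d x y S \<longleftrightarrow>
     (\<exists>a b \<sigma>. a \<le> b \<and> geodesic X d {a..b} \<sigma> \<and> \<sigma> a = x \<and> \<sigma> b = y \<and> S = \<sigma> ` {a..b})"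

definition geodesic_metric_space :: "'a set \<Rightarrow> ('a \<Rightarrow> 'a \<Rightarrow> real) \<Rightarrow> bool" where
  "geodesic_metric_space X d \<longleftrightarrow>
     Metric_space X d \<and> (\<forall>x\<in>X. \<forall>y\<in>X. \<exists>S. geodesic_segment X d x y S)"

definition proper_metric_space :: "'a set \<Rightarrow> ('a \<Rightarrow> 'a \<Rightarrow> real) \<Rightarrow> bool" where
  "proper_metric_space X d \<longleftrightarrow>
     Metric_space X d \<and>
     (\<forall>x\<in>X. \<forall>r. compactin (Metric_space.mtopology X d) (Metric_space.mcball X d x r))"

definition geodesic_triangle ::
    "'a set \<Rightarrow> ('a \<Rightarrow> 'a \<Rightarrow> real) \<Rightarrow> 'a set \<Rightarrow> 'a set \<Rightarrow> 'a set \<Rightarrow> bool" where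
  "geodesic_triangle X d A B C \<longleftrightarrow>
     (\<exists>x\<in>X. \<exists>y\<in>X. \<exists>z\<in>X.
        geodesic_segment X d x y A \<and> geodesic_segment X d y z B \<and> geodesic_segment X d z x C)"

definition thin_triangle ::
    "('a \<Rightarrow> 'a \<Rightarrow> real) \<Rightarrow> real \<Rightarrow> 'a set \<Rightarrow> 'a set \<Rightarrow> 'a set \<Rightarrow> bool" where
  "thin_triangle d \<delta> A B C \<longleftrightarrow>
     (\<forall>p\<in>A. \<exists>q\<in>B \<union> C. d p q \<le> \<delta>) \<and>
     (\<forall>p\<in>B. \<exists>q\<in>C \<union> A. d p q \<le> \<delta>) \<and>
     (\<forall>p\<in>C. \<exists>q\<in>A \<union> B. d p q \<le> \<delta>)"

definition delta_hyperbolic :: "'a set \<Rightarrow> ('a \<Rightarrow> 'a \<Rightarrow> real) \<Rightarrow> real \<Rightarrow> bool" where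
  "delta_hyperbolic X d \<delta> \<longleftrightarrow>
     proper_metric_space X d \<and> geodesic_metric_space X d \<and>
     (\<forall>A B C. geodesic_triangle X d A B C \<longrightarrow> thin_triangle d \<delta> A B C)"

definition Gromov_hyperbolic :: "'a set \<Rightarrow> ('a \<Rightarrow> 'a \<Rightarrow> real) \<Rightarrow> bool" where
  "Gromov_hyperbolic X d \<longleftrightarrow> (\<exists>\<delta>\<ge>0. delta_hyperbolic X d \<delta>)"

end

theory Submission
  imports Defs "HOL-Complex_Analysis.Riemann_Mapping"
begin

text \<open>
  The domain is a projective image of a light cone. Fix a coordinate \<open>k\<close> and write \<open>y'\<close> for the
  remaining coordinates of \<open>y \<in> \<complex>\<^sup>d\<close>. The real cone \<open>C = {y. Re y\<^sub>k > |(Im y\<^sub>k, y')|}\<close> plays two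
  roles.

  Analytically it is a ball: since \<open>Re (y\<^sub>k)\<^sup>2 = (Re y\<^sub>k)\<^sup>2 - (Im y\<^sub>k)\<^sup>2\<close>, the map
  \<open>(y\<^sub>k, y') \<mapsto> (y\<^sub>k\<^sup>2, y')\<close> sends \<open>C\<close> biholomorphically onto \<open>{(z, w). Re z > |w|\<^sup>2}\<close>, the unbounded
  model of the unit ball. Hence the Kobayashi distance of \<open>C\<close> is that of complex hyperbolic space,
  which is Gromov hyperbolic.

  Projectively it is wide at infinity: the rays of \<open>C\<close> end in an open part of the hyperplane at
  infinity of projective space. The projective map \<open>T y = y / (1 + y\<^sub>k)\<close> carries that hyperplane to
  \<open>{x. x\<^sub>k = 1}\<close>. The image \<open>\<Omega> = T C\<close> is bounded, and its boundary contains the complex affine ball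
  \<open>{x. x\<^sub>k = 1, |x'| < 1}\<close>. Because \<open>T\<close> maps complex lines to complex lines, every complex line
  section of \<open>\<Omega>\<close> is homeomorphic to a convex section of \<open>C\<close>, so \<open>\<Omega>\<close> is \<open>\<complex>\<close>-convex.

  The Kobayashi distance is found without computing the metric. Any two points \<open>x\<close>, \<open>y\<close> of \<open>\<Omega>\<close> lie on
  a holomorphic disc \<open>f\<close> with \<open>f 0 = x\<close>, \<open>f (tanh l) = y\<close>, and there is a holomorphic \<open>g\<close> from \<open>\<Omega>\<close> to
  the unit disc with \<open>g x = 0\<close>, \<open>g y = tanh l\<close> (\<open>projective_cone_extremal_disc\<close>). The disc gives a
  curve of length at most \<open>l\<close>, and by the Schwarz-Pick lemma the function \<open>artanh (Re g)\<close> shows that no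
  curve is shorter (\<open>kobayashi_length_ge\<close>). The same two maps yield the triangle inequality and
  geodesics (\<open>kobayashi_distance_geodesic_metric_space\<close>). Since all absolutely continuous curves
  compete in the definition of the distance, the lower bound rests on two classical facts: such curves
  are differentiable almost everywhere, and a real one changes by at most the integral of the absolute
  value of its derivative (\<open>absolutely_continuous_curve_differentiable_ae\<close>,
  \<open>absolutely_continuous_diff_le_nn_integral\<close>).

  In homogeneous coordinates with the Hermitian form of signature \<open>(1, d)\<close> the result reads
  \<open>cosh (K x y) = |\<langle>X, Y\<rangle>| / sqrt (\<langle>X, X\<rangle> \<langle>Y, Y\<rangle>)\<close>. On timelike vectors with time coordinate \<open>1\<close> the
  quantity
  \<open>|\<langle>X, Y\<rangle>|\<close> satisfies the triangle inequality up to a constant factor, which gives a multiplicative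
  Ptolemy inequality (\<open>lorentz_quasi_Ptolemy\<close>) and, after taking logarithms, the four-point condition
  of Gromov. That condition makes triangles thin (\<open>four_point_Gromov_hyperbolic\<close>). Properness follows
  from the formula by compactness (\<open>complex_hyperbolic_model_proper\<close>).\<close>

section \<open>Increments of absolutely continuous functions over disjoint intervals\<close>

lemma additive_division_real:
  fixes f :: "real \<Rightarrow> 'a::real_normed_vector"
  assumes "a \<le> b" "D division_of {a..b}"
  shows "(\<Sum>K\<in>D. f (Sup K) - f (Inf K)) = f b - f a"
proof -
  have tag: "(\<lambda>K. (Inf K, K)) ` D tagged_division_of {a..b}"
  proof (rule tagged_division_ofI)
    show "finite ((\<lambda>K. (Inf K, K)) ` D)"
      using assms(2) by blast
    show "\<And>x K. (x, K) \<in> (\<lambda>K. (Inf K, K)) ` D \<Longrightarrow> x \<in> K"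
      using division_ofD(3,4)[OF assms(2)] by fastforce
    show "\<And>x K. (x, K) \<in> (\<lambda>K. (Inf K, K)) ` D \<Longrightarrow> K \<subseteq> {a..b}"
      using division_ofD(2)[OF assms(2)] by blast
    show "\<And>x K. (x, K) \<in> (\<lambda>K. (Inf K, K)) ` D \<Longrightarrow> \<exists>a b. K = cbox a b"
      using division_ofD(4)[OF assms(2)] by blast
    show "\<And>x1 K1 x2 K2. (x1, K1) \<in> (\<lambda>K. (Inf K, K)) ` D \<Longrightarrow> (x2, K2) \<in> (\<lambda>K. (Inf K, K)) ` D
        \<Longrightarrow> (x1, K1) \<noteq> (x2, K2) \<Longrightarrow> interior K1 \<inter> interior K2 = {}"
      using division_ofD(5)[OF assms(2)] by blast
    show "\<Union>{K. \<exists>x. (x, K) \<in> (\<lambda>K. (Inf K, K)) ` D} = {a..b}"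
    proof -
      have "{K. \<exists>x. (x, K) \<in> (\<lambda>K. (Inf K, K)) ` D} = D" by auto
      then show ?thesis using division_ofD(6)[OF assms(2)] by simp
    qed
  qed
  have "(\<Sum>K\<in>D. f (Sup K) - f (Inf K)) = (\<Sum>(x, K)\<in>(\<lambda>K. (Inf K, K)) ` D. f (Sup K) - f (Inf K))"
    by (subst sum.reindex) (auto simp: inj_on_def)
  also have "\<dots> = f b - f a"
    by (rule additive_tagged_division_1[OF assms(1) tag])
  finally show ?thesis .
qed

definition disjoint_intervals :: "real set set \<Rightarrow> bool" where
  "disjoint_intervals D \<longleftrightarrow> finite D \<and> (\<forall>K\<in>D. \<exists>c d. K = {c..d} \<and> c < d) \<and> pairwise disjnt D"

lemma disjoint_intervalsD:
  assumes "disjoint_intervals D"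
  shows "finite D" "\<And>K. K \<in> D \<Longrightarrow> \<exists>c d. K = {c..d} \<and> c < d" "pairwise disjnt D"
  using assms unfolding disjoint_intervals_def by auto

text \<open>The points covered by arbitrarily short intervals of \<open>\<F>\<close>. A point counts only if it is interior to
  these intervals; this makes the set a countable intersection of open sets, hence measurable, for
  every family \<open>\<F>\<close>.\<close>

definition fine_points :: "real set set \<Rightarrow> real set" where
  "fine_points \<F> = {x. \<forall>\<eta>>0. \<exists>c d. {c..d} \<in> \<F> \<and> c < x \<and> x < d \<and> d - c < \<eta>}"

lemma fine_pointsD:
  assumes "x \<in> fine_points \<F>" "\<eta> > 0"
  obtains c d where "{c..d} \<in> \<F>" "c < x" "x < d" "d - c < \<eta>"
  using assms unfolding fine_points_def by blast

lemma borel_fine_points: "fine_points \<F> \<in> sets borel"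
proof -
  have "fine_points \<F> = (\<Inter>n::nat. \<Union>{{c<..<d} | c d. {c..d} \<in> \<F> \<and> d - c < 1 / Suc n})" (is "_ = ?R")
  proof
    show "fine_points \<F> \<subseteq> ?R"
    proof
      fix x assume x: "x \<in> fine_points \<F>"
      show "x \<in> ?R"
      proof
        fix n :: nat
        obtain c d where cd: "{c..d} \<in> \<F>" "c < x" "x < d" "d - c < 1 / Suc n"
          using fine_pointsD[OF x, of "1 / Suc n"] by auto
        then show "x \<in> \<Union>{{c<..<d} | c d. {c..d} \<in> \<F> \<and> d - c < 1 / Suc n}"
          by (intro UnionI[of "{c<..<d}"]) auto
      qed
    qed
    show "?R \<subseteq> fine_points \<F>"
    proof
      fix x assume x: "x \<in> ?R"
      show "x \<in> fine_points \<F>"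
        unfolding fine_points_def
      proof (intro CollectI allI impI)
        fix \<eta> :: real assume "\<eta> > 0"
        then obtain n where n: "1 / Suc n < \<eta>"
          using reals_Archimedean by (auto simp: inverse_eq_divide)
        from x have "x \<in> \<Union>{{c<..<d} | c d. {c..d} \<in> \<F> \<and> d - c < 1 / Suc n}" by blast
        then obtain c d where "x \<in> {c<..<d}" "{c..d} \<in> \<F>" "d - c < 1 / Suc n" by blast
        with n show "\<exists>c d. {c..d} \<in> \<F> \<and> c < x \<and> x < d \<and> d - c < \<eta>"
          by (intro exI[of _ c] exI[of _ d]) auto
      qed
    qed
  qed
  moreover have "?R \<in> sets borel"
  proof (intro sets.countable_INT')
    have "open (\<Union>{{c<..<d} | c d. {c..d} \<in> \<F> \<and> d - c < 1 / Suc n})" for n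
      by (intro open_Union) auto
    then show "range (\<lambda>n::nat. \<Union>{{c<..<d} | c d. {c..d} \<in> \<F> \<and> d - c < 1 / Suc n}) \<subseteq> sets borel"
      using borel_open by blast
  qed auto
  ultimately show ?thesis by simp
qed

lemma fine_points_within_open:
  assumes "x \<in> fine_points \<F>" "open V" "x \<in> V"
  shows "x \<in> fine_points {K \<in> \<F>. K \<subseteq> V}"
  unfolding fine_points_def
proof (intro CollectI allI impI)
  fix \<eta> :: real assume "\<eta> > 0"
  obtain e where e: "e > 0" "ball x e \<subseteq> V"
    using assms(2,3) open_contains_ball by blast
  obtain c d where cd: "{c..d} \<in> \<F>" "c < x" "x < d" "d - c < min \<eta> e"
    using fine_pointsD[OF assms(1), of "min \<eta> e"] \<open>\<eta> > 0\<close> e(1) by auto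
  have "{c..d} \<subseteq> ball x e"
    using cd by (auto simp: dist_real_def)
  then show "\<exists>c d. {c..d} \<in> {K \<in> \<F>. K \<subseteq> V} \<and> c < x \<and> x < d \<and> d - c < \<eta>"
    using cd e by (intro exI[of _ c] exI[of _ d]) auto
qed

text \<open>Vitali's theorem gives a countable disjoint family that covers almost all of \<open>E\<close>; the countably many
  endpoints are negligible, so the open interiors still do, and by continuity of the measure finitely
  many of them suffice up to \<open>\<epsilon>\<close>.\<close>

lemma Vitali_finite_intervals:
  assumes E: "E \<in> lmeasurable" "E \<subseteq> fine_points \<F>" and eps: "\<epsilon> > 0"
  obtains D where "disjoint_intervals D" "D \<subseteq> \<F>" "measure lebesgue (E - (\<Union>K\<in>D. interior K)) < \<epsilon>"
proof -
  define I where "I = {(c, d). c < d \<and> {c..d} \<in> \<F>}"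
  define m where "m i = (fst i + snd i) / 2" for i :: "real \<times> real"
  define r where "r i = (snd i - fst i) / 2" for i :: "real \<times> real"
  have cball: "cball (m i) (r i) = {fst i..snd i}" for i
    unfolding m_def r_def by (simp add: cball_eq_atLeastAtMost field_simps)
  have rpos: "0 < r i" if "i \<in> I" for i
    using that by (auto simp: I_def r_def)
  have cov: "\<exists>i. i \<in> I \<and> x \<in> cball (m i) (r i) \<and> r i < d" if xd: "x \<in> E" "0 < d" for x d
  proof -
    obtain u v where uv: "{u..v} \<in> \<F>" "u < x" "x < v" "v - u < d"
      using E(2) xd fine_pointsD[of x \<F> d] by blast
    then show ?thesis
      unfolding cball by (intro exI[of _ "(u, v)"]) (auto simp: I_def r_def)
  qed
  obtain C where C: "countable C" "C \<subseteq> I"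
     "pairwise (\<lambda>i j. disjnt (cball (m i) (r i)) (cball (m j) (r j))) C"
     "negligible (E - (\<Union>i\<in>C. cball (m i) (r i)))"
    using Vitali_covering_theorem_cballs[of I r E m, OF rpos cov] by blast
  define A where "A n = E - (\<Union>i\<in>{i \<in> C. to_nat_on C i < n}. {fst i<..<snd i})" for n
  have openC: "open (\<Union>i\<in>S. {fst i<..<snd i})" for S :: "(real \<times> real) set"
    by auto
  have neg: "negligible (E - (\<Union>i\<in>C. {fst i<..<snd i}))"
  proof (rule negligible_subset)
    show "negligible ((E - (\<Union>i\<in>C. cball (m i) (r i))) \<union> fst ` C \<union> snd ` C)"
      using C by (intro negligible_Un)
        (auto simp: negligible_iff_null_sets intro: null_sets_completionI countable_imp_null_set_lborel)
    show "E - (\<Union>i\<in>C. {fst i<..<snd i}) \<subseteq> (E - (\<Union>i\<in>C. cball (m i) (r i))) \<union> fst ` C \<union> snd ` C"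
      unfolding cball by (force simp: order_less_le)
  qed
  have "(\<lambda>n. measure lebesgue (A n)) \<longlonglongrightarrow> measure lebesgue (\<Inter>n. A n)"
  proof (rule Lim_measure_decseq)
    have Afm: "A n \<in> lmeasurable" for n
      unfolding A_def
    proof (rule fmeasurable_Diff[OF E(1)])
      show "(\<Union>i\<in>{i \<in> C. to_nat_on C i < n}. {fst i<..<snd i}) \<in> sets lebesgue"
        using borel_open[OF openC] by simp
    qed
    then show "range A \<subseteq> sets lebesgue" by auto
    show "decseq A"
      unfolding A_def decseq_def by force
    show "\<And>i. emeasure lebesgue (A i) \<noteq> \<infinity>"
      by (rule fmeasurableD2[OF Afm, unfolded infinity_ennreal_def[symmetric]])
  qed
  moreover have "(\<Inter>n. A n) = E - (\<Union>i\<in>C. {fst i<..<snd i})"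
    unfolding A_def by auto
  then have "measure lebesgue (\<Inter>n. A n) = 0"
    using neg by (simp add: negligible_imp_measure0)
  ultimately have "eventually (\<lambda>n. measure lebesgue (A n) < \<epsilon>) sequentially"
    using eps order_tendstoD(2) by fastforce
  then obtain n where n: "measure lebesgue (A n) < \<epsilon>"
    using eventually_happens by force
  define D where "D = (\<lambda>i. {fst i..snd i}) ` {i \<in> C. to_nat_on C i < n}"
  have "disjoint_intervals D"
    unfolding disjoint_intervals_def
  proof (intro conjI ballI)
    have "inj_on (to_nat_on C) {i \<in> C. to_nat_on C i < n}"
      using inj_on_to_nat_on[OF C(1)] by (rule inj_on_subset) auto
    moreover have "finite (to_nat_on C ` {i \<in> C. to_nat_on C i < n})"
      by (rule finite_subset[of _ "{..<n}"]) auto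
    ultimately show "finite D"
      unfolding D_def using finite_imageD by blast
    show "\<exists>c d. K = {c..d} \<and> c < d" if "K \<in> D" for K
      using that C(2) unfolding D_def by (fastforce simp: I_def)
    show "pairwise disjnt D"
      unfolding pairwise_def
    proof (intro ballI impI)
      fix K L assume "K \<in> D" "L \<in> D" "K \<noteq> L"
      then obtain i j where "i \<in> C" "j \<in> C" "K = {fst i..snd i}" "L = {fst j..snd j}" "i \<noteq> j"
        unfolding D_def by blast
      then show "disjnt K L"
        using pairwiseD[OF C(3), of i j] by (simp add: cball)
    qed
  qed
  moreover have "D \<subseteq> \<F>"
    unfolding D_def using C(2) by (auto simp: I_def)
  moreover
  have "(\<Union>K\<in>D. interior K) = (\<Union>i\<in>{i \<in> C. to_nat_on C i < n}. {fst i<..<snd i})"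
    unfolding D_def by auto
  then have "measure lebesgue (E - (\<Union>K\<in>D. interior K)) < \<epsilon>"
    using n by (simp add: A_def)
  ultimately show thesis by (rule that)
qed

lemma measure_disjoint_intervals:
  assumes "disjoint_intervals D"
  shows "measure lebesgue (\<Union>D) = (\<Sum>K\<in>D. Sup K - Inf K)" "\<Union>D \<in> lmeasurable"
    "D division_of (\<Union>D)"
proof -
  note fin = disjoint_intervalsD(1)[OF assms] and Icc = disjoint_intervalsD(2)[OF assms]
    and disj = disjoint_intervalsD(3)[OF assms]
  have K: "K \<in> lmeasurable" "measure lebesgue K = Sup K - Inf K" if "K \<in> D" for K
    using Icc[OF that] by auto
  show "measure lebesgue (\<Union>D) = (\<Sum>K\<in>D. Sup K - Inf K)"
    using measure_Union'[OF fin _ disj, of lebesgue] K by simp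
  show "\<Union>D \<in> lmeasurable"
    using K fin by (metis fmeasurable.finite_Union subsetI)
  show "D division_of (\<Union>D)"
  proof (rule division_ofI)
    show "\<And>K1 K2. K1 \<in> D \<Longrightarrow> K2 \<in> D \<Longrightarrow> K1 \<noteq> K2 \<Longrightarrow> interior K1 \<inter> interior K2 = {}"
      using pairwiseD[OF disj] interior_subset unfolding disjnt_def
      by (metis Int_mono subset_empty)
    show "\<And>K. K \<in> D \<Longrightarrow> \<exists>a b. K = cbox a b"
      using Icc by (metis box_real(2))
    show "\<And>K. K \<in> D \<Longrightarrow> K \<noteq> {}"
      using Icc by fastforce
  qed (use fin in auto)
qed

lemma absolutely_continuous_curveE:
  assumes "absolutely_continuous_curve a b \<sigma>" "\<epsilon> > 0"
  obtains \<delta> where "\<delta> > 0" "\<And>D. \<lbrakk>D division_of \<Union>D; \<Union>D \<subseteq> {a..b}; (\<Sum>k\<in>D. Sup k - Inf k) < \<delta>\<rbrakk>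
    \<Longrightarrow> (\<Sum>k\<in>D. norm (\<sigma> (Sup k) - \<sigma> (Inf k))) < \<epsilon>"
proof -
  have "\<exists>\<delta>>0. \<forall>D. D division_of \<Union>D \<and> \<Union>D \<subseteq> {a..b} \<and> (\<Sum>k\<in>D. Sup k - Inf k) < \<delta> \<longrightarrow>
        (\<Sum>k\<in>D. norm (\<sigma> (Sup k) - \<sigma> (Inf k))) < \<epsilon>"
    using assms(1)[unfolded absolutely_continuous_curve_def, rule_format, OF assms(2)] .
  then show thesis using that by (elim exE conjE) simp
qed

lemma absolutely_continuous_curve_dominated:
  assumes "absolutely_continuous_curve a b \<sigma>"
    and "\<And>s t. s \<in> {a..b} \<Longrightarrow> t \<in> {a..b} \<Longrightarrow> norm (h s - h t) \<le> C * norm (\<sigma> s - \<sigma> t)"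
  shows "absolutely_continuous_curve a b h"
  unfolding absolutely_continuous_curve_def
proof (intro allI impI)
  fix \<epsilon> :: real assume "\<epsilon> > 0"
  define C' where "C' = max C 1"
  have C': "C' > 0" "C \<le> C'" by (auto simp: C'_def)
  obtain \<delta> where \<delta>: "\<delta> > 0" "\<And>D. \<lbrakk>D division_of \<Union>D; \<Union>D \<subseteq> {a..b}; (\<Sum>k\<in>D. Sup k - Inf k) < \<delta>\<rbrakk> \<Longrightarrow>
        (\<Sum>k\<in>D. norm (\<sigma> (Sup k) - \<sigma> (Inf k))) < \<epsilon> / C'"
    using absolutely_continuous_curveE[OF assms(1) divide_pos_pos[OF \<open>\<epsilon> > 0\<close> C'(1)]] by blast
  have "(\<Sum>k\<in>D. norm (h (Sup k) - h (Inf k))) < \<epsilon>"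
    if D: "D division_of \<Union>D" "\<Union>D \<subseteq> {a..b}" "(\<Sum>k\<in>D. Sup k - Inf k) < \<delta>" for D
  proof -
    have "norm (h (Sup k) - h (Inf k)) \<le> C' * norm (\<sigma> (Sup k) - \<sigma> (Inf k))" if "k \<in> D" for k
    proof -
      obtain u v where k: "k = cbox u v" "k \<noteq> {}"
        using D \<open>k \<in> D\<close> by (metis division_ofD(3,4))
      then have "u \<le> v" "k = {u..v}" by auto
      moreover have "k \<subseteq> {a..b}" using D \<open>k \<in> D\<close> by auto
      ultimately have "Sup k \<in> {a..b}" "Inf k \<in> {a..b}" by auto
      then have "norm (h (Sup k) - h (Inf k)) \<le> C * norm (\<sigma> (Sup k) - \<sigma> (Inf k))"
        by (rule assms(2))
      also have "\<dots> \<le> C' * norm (\<sigma> (Sup k) - \<sigma> (Inf k))"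
        using C' by (intro mult_right_mono) auto
      finally show ?thesis .
    qed
    then have "(\<Sum>k\<in>D. norm (h (Sup k) - h (Inf k))) \<le> C' * (\<Sum>k\<in>D. norm (\<sigma> (Sup k) - \<sigma> (Inf k)))"
      unfolding sum_distrib_left by (rule sum_mono)
    also have "\<dots> < C' * (\<epsilon> / C')"
      using \<delta>(2)[OF D] C' by (intro mult_strict_left_mono) auto
    finally show ?thesis using C' by simp
  qed
  then show "\<exists>\<delta>>0. \<forall>D. D division_of \<Union>D \<and> \<Union>D \<subseteq> {a..b} \<and> (\<Sum>k\<in>D. Sup k - Inf k) < \<delta> \<longrightarrow>
        (\<Sum>k\<in>D. norm (h (Sup k) - h (Inf k))) < \<epsilon>"
    using \<delta>(1) by blast
qed

lemma absolutely_continuous_curve_diff_small: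
  assumes "absolutely_continuous_curve a b \<sigma>" "\<epsilon> > 0"
  obtains \<delta> where "\<delta> > 0" "\<And>c d. a \<le> c \<Longrightarrow> c \<le> d \<Longrightarrow> d \<le> b \<Longrightarrow> d - c < \<delta> \<Longrightarrow> norm (\<sigma> d - \<sigma> c) < \<epsilon>"
proof -
  obtain \<delta> where \<delta>: "\<delta> > 0" "\<And>D. \<lbrakk>D division_of \<Union>D; \<Union>D \<subseteq> {a..b}; (\<Sum>k\<in>D. Sup k - Inf k) < \<delta>\<rbrakk> \<Longrightarrow>
        (\<Sum>k\<in>D. norm (\<sigma> (Sup k) - \<sigma> (Inf k))) < \<epsilon>"
    using absolutely_continuous_curveE[OF assms] by blast
  have "norm (\<sigma> d - \<sigma> c) < \<epsilon>" if "a \<le> c" "c \<le> d" "d \<le> b" "d - c < \<delta>" for c d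
    using \<delta>(2)[of "{{c..d}}"] division_of_self[of c d] that by auto
  then show thesis using that \<delta>(1) by blast
qed

lemma absolutely_continuous_curve_continuous:
  assumes "absolutely_continuous_curve a b \<sigma>"
  shows "continuous_on {a..b} \<sigma>"
  unfolding continuous_on_iff
proof (intro ballI allI impI)
  fix x and e :: real assume x: "x \<in> {a..b}" and "e > 0"
  obtain \<delta> where \<delta>: "\<delta> > 0" "\<And>c d. a \<le> c \<Longrightarrow> c \<le> d \<Longrightarrow> d \<le> b \<Longrightarrow> d - c < \<delta> \<Longrightarrow> norm (\<sigma> d - \<sigma> c) < e"
    using absolutely_continuous_curve_diff_small[OF assms \<open>e > 0\<close>] by blast
  show "\<exists>d>0. \<forall>x'\<in>{a..b}. dist x' x < d \<longrightarrow> dist (\<sigma> x') (\<sigma> x) < e"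
  proof (intro exI[of _ \<delta>] conjI ballI impI \<delta>(1))
    fix y assume y: "y \<in> {a..b}" "dist y x < \<delta>"
    show "dist (\<sigma> y) (\<sigma> x) < e"
    proof (cases "x \<le> y")
      case True
      then show ?thesis using \<delta>(2)[of x y] x y by (auto simp: dist_norm)
    next
      case False
      then show ?thesis using \<delta>(2)[of y x] x y by (auto simp: dist_norm norm_minus_commute)
    qed
  qed
qed

text \<open>The total increments over \<open>I\<close> and over a subordinate family \<open>J\<close> of almost the same total length are
  close: inside each member of \<open>I\<close> the members of \<open>J\<close> extend to a division, and the added pieces have
  small total length.\<close>

lemma absolutely_continuous_curve_additive_approx:
  fixes f :: "real \<Rightarrow> real"
  assumes ac: "absolutely_continuous_curve a b f" and "\<epsilon> > 0"
  obtains \<delta> where "\<delta> > 0" 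
    "\<And>I J. \<lbrakk>disjoint_intervals I; \<Union>I \<subseteq> {a..b}; disjoint_intervals J;
       \<forall>K\<in>J. \<exists>L\<in>I. K \<subseteq> L; (\<Sum>K\<in>I. Sup K - Inf K) - (\<Sum>K\<in>J. Sup K - Inf K) < \<delta>\<rbrakk>
     \<Longrightarrow> \<bar>(\<Sum>K\<in>I. f (Sup K) - f (Inf K)) - (\<Sum>K\<in>J. f (Sup K) - f (Inf K))\<bar> < \<epsilon>"
proof -
  obtain \<delta> where \<delta>: "\<delta> > 0" "\<And>D. \<lbrakk>D division_of \<Union>D; \<Union>D \<subseteq> {a..b}; (\<Sum>k\<in>D. Sup k - Inf k) < \<delta>\<rbrakk> \<Longrightarrow>
        (\<Sum>k\<in>D. norm (f (Sup k) - f (Inf k))) < \<epsilon>"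
    using absolutely_continuous_curveE[OF assms] by blast
  show thesis
  proof (rule that[OF \<delta>(1)])
    fix I J :: "real set set"
    assume I': "disjoint_intervals I" "\<Union>I \<subseteq> {a..b}" and J: "disjoint_intervals J"
      and JI: "\<forall>K\<in>J. \<exists>L\<in>I. K \<subseteq> L"
      and less: "(\<Sum>K\<in>I. Sup K - Inf K) - (\<Sum>K\<in>J. Sup K - Inf K) < \<delta>"
    note I = disjoint_intervalsD[OF I'(1)] I'(2)
    have divJ: "J division_of (\<Union>J)"
      using measure_disjoint_intervals(3)[OF J] by blast
    have "\<exists>q. {K \<in> J. K \<subseteq> L} \<subseteq> q \<and> q division_of L" if "L \<in> I" for L
    proof -
      obtain c d where L: "L = cbox c d" using I(2)[OF \<open>L \<in> I\<close>] by auto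
      have "{K \<in> J. K \<subseteq> L} division_of (\<Union>{K \<in> J. K \<subseteq> L})"
        by (rule division_of_subset[OF divJ]) auto
      then show ?thesis
        using partial_division_extend_interval[of "{K \<in> J. K \<subseteq> L}" c d] unfolding L by (metis (no_types, lifting) CollectD Union_least)
    qed
    then obtain q where q: "\<And>L. L \<in> I \<Longrightarrow> {K \<in> J. K \<subseteq> L} \<subseteq> q L" "\<And>L. L \<in> I \<Longrightarrow> q L division_of L"
      by metis
    \<comment> \<open>The members of \<open>J\<close> and the pieces that complete them to divisions of the members of \<open>I\<close>.\<close>
    define Q where "Q = (\<Union>L\<in>I. q L)"
    have Qdiv: "Q division_of (\<Union>I)"
    proof (rule division_ofI)
      show "finite Q" unfolding Q_def using I(1) q(2) by blast
      show "K \<subseteq> \<Union>I" "K \<noteq> {}" "\<exists>a b. K = cbox a b" if "K \<in> Q" for K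
        using that division_ofD(2,3,4)[OF q(2)] unfolding Q_def by blast+
      show "interior K1 \<inter> interior K2 = {}" if K: "K1 \<in> Q" "K2 \<in> Q" "K1 \<noteq> K2" for K1 K2
      proof -
        obtain L1 L2 where L: "L1 \<in> I" "L2 \<in> I" "K1 \<in> q L1" "K2 \<in> q L2"
          using K unfolding Q_def by blast
        show ?thesis
        proof (cases "L1 = L2")
          case True
          then show ?thesis using division_ofD(5)[OF q(2)] L K(3) by blast
        next
          case False
          then have "L1 \<inter> L2 = {}" using I(3) L by (auto simp: pairwise_def disjnt_def)
          moreover have "K1 \<subseteq> L1" "K2 \<subseteq> L2" using division_ofD(2)[OF q(2)] L by blast+
          ultimately show ?thesis using interior_subset[of K1] interior_subset[of K2] by blast
        qed
      qed
      show "\<Union>Q = \<Union>I"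
      proof -
        have "\<Union>Q = (\<Union>L\<in>I. \<Union>(q L))" unfolding Q_def by blast
        also have "\<dots> = (\<Union>L\<in>I. L)" using division_ofD(6)[OF q(2)] by (intro SUP_cong) auto
        finally show ?thesis by simp
      qed
    qed
    have sumQ: "(\<Sum>K\<in>Q. g (Sup K) - g (Inf K)) = (\<Sum>L\<in>I. g (Sup L) - g (Inf L))" for g :: "real \<Rightarrow> real"
    proof -
      have "(\<Sum>K\<in>Q. g (Sup K) - g (Inf K)) = (\<Sum>L\<in>I. \<Sum>K\<in>q L. g (Sup K) - g (Inf K))"
        unfolding Q_def
      proof (rule sum.UNION_disjoint)
        show "\<forall>L1\<in>I. \<forall>L2\<in>I. L1 \<noteq> L2 \<longrightarrow> q L1 \<inter> q L2 = {}"
        proof (intro ballI impI)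
          fix L1 L2 assume L: "L1 \<in> I" "L2 \<in> I" "L1 \<noteq> L2"
          have "L1 \<inter> L2 = {}" using I(3) L by (auto simp: pairwise_def disjnt_def)
          then show "q L1 \<inter> q L2 = {}"
            using division_ofD(2,3)[OF q(2)] L by blast
        qed
      qed (use I q in blast)+
      also have "\<dots> = (\<Sum>L\<in>I. g (Sup L) - g (Inf L))"
      proof (rule sum.cong[OF refl])
        fix L assume "L \<in> I"
        then obtain c d where L: "L = {c..d}" "c < d" using I(2) by blast
        then show "(\<Sum>K\<in>q L. g (Sup K) - g (Inf K)) = g (Sup L) - g (Inf L)"
          using additive_division_real[of c d "q L" g] q(2)[OF \<open>L \<in> I\<close>] by auto
      qed
      finally show ?thesis .
    qed
    have JQ: "J \<subseteq> Q"
      using JI q(1) unfolding Q_def by blast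
    have sumQJ: "(\<Sum>K\<in>Q - J. g (Sup K) - g (Inf K)) = (\<Sum>L\<in>I. g (Sup L) - g (Inf L)) - (\<Sum>K\<in>J. g (Sup K) - g (Inf K))" 
      for g :: "real \<Rightarrow> real"
      using sum_diff[of Q J "\<lambda>K. g (Sup K) - g (Inf K)"] JQ sumQ[of g] Qdiv by auto
    have "(Q - J) division_of (\<Union>(Q - J))"
      using division_of_subset[of Q "Q - J"] Qdiv division_ofD(6)[OF Qdiv] by auto
    moreover have "\<Union>(Q - J) \<subseteq> {a..b}"
      using division_ofD(6)[OF Qdiv] I(4) by blast
    ultimately have "(\<Sum>k\<in>Q - J. norm (f (Sup k) - f (Inf k))) < \<epsilon>"
      using \<delta>(2)[of "Q - J"] less sumQJ[of "\<lambda>x. x"] by auto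
    moreover have "\<bar>\<Sum>k\<in>Q - J. f (Sup k) - f (Inf k)\<bar> \<le> (\<Sum>k\<in>Q - J. norm (f (Sup k) - f (Inf k)))"
      unfolding real_norm_def by (rule sum_abs)
    ultimately show "\<bar>(\<Sum>K\<in>I. f (Sup K) - f (Inf K)) - (\<Sum>K\<in>J. f (Sup K) - f (Inf K))\<bar> < \<epsilon>"
      unfolding sumQJ by linarith
  qed
qed

section \<open>Differentiability almost everywhere\<close>

text \<open>Suppose that the set \<open>E\<close> of points with slopes \<open>\<le> p\<close> and slopes \<open>\<ge> q > p\<close> at all small scales has
  measure \<open>s > 0\<close>. Cover most of \<open>E\<close> by disjoint intervals of slope \<open>\<le> p\<close> inside an open set of measure
  about \<open>s\<close>, and then, within them, by intervals of slope \<open>\<ge> q\<close>. Both families have total length about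
  \<open>s\<close>, hence nearly equal total increments, and so \<open>q s\<close> is at most about \<open>p s\<close>.\<close>

lemma negligible_fine_points_two_slopes:
  fixes f :: "real \<Rightarrow> real"
  assumes ac: "absolutely_continuous_curve a b f" and "p < q"
    and F: "\<F> \<subseteq> {{c..d} | c d. a \<le> c \<and> d \<le> b \<and> f d - f c \<le> p * (d - c)}"
    and G: "\<G> \<subseteq> {{c..d} | c d. a \<le> c \<and> d \<le> b \<and> q * (d - c) \<le> f d - f c}"
  shows "negligible (fine_points \<F> \<inter> fine_points \<G>)"
proof -
  define E where "E = fine_points \<F> \<inter> fine_points \<G>"
  have slopeF: "f (Sup K) - f (Inf K) \<le> p * (Sup K - Inf K)" "K \<subseteq> {a..b}"
    if "K \<in> \<F>" "\<exists>c d. K = {c..d} \<and> c < d" for K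
    using that F by (fastforce simp: Icc_eq_Icc)+
  have slopeG: "q * (Sup K - Inf K) \<le> f (Sup K) - f (Inf K)" "K \<subseteq> {a..b}"
    if "K \<in> \<G>" "\<exists>c d. K = {c..d} \<and> c < d" for K
    using that G by (fastforce simp: Icc_eq_Icc)+
  have "E \<subseteq> {a..b}"
  proof
    fix x assume "x \<in> E"
    then obtain c d where "{c..d} \<in> \<F>" "c < x" "x < d"
      unfolding E_def using fine_pointsD[of x \<F> 1] by (metis IntD1 zero_less_one)
    then show "x \<in> {a..b}"
      using slopeF(2)[of "{c..d}"] by force
  qed
  moreover have Eborel: "E \<in> sets lebesgue"
    unfolding E_def using borel_fine_points by auto
  ultimately have E: "E \<in> lmeasurable"
    by (metis bounded_closed_interval bounded_set_imp_lmeasurable bounded_subset)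
  define s where "s = measure lebesgue E"
  have "s = 0"
  proof (rule ccontr)
    assume "s \<noteq> 0"
    then have "s > 0"
      by (simp add: s_def zero_less_measure_iff)
    define e where "e = (q - p) * s / 4"
    have "e > 0" using \<open>p < q\<close> \<open>s > 0\<close> by (simp add: e_def)
    obtain \<delta> where \<delta>: "\<delta> > 0" 
      "\<And>I J. \<lbrakk>disjoint_intervals I; \<Union>I \<subseteq> {a..b}; disjoint_intervals J;
         \<forall>K\<in>J. \<exists>L\<in>I. K \<subseteq> L; (\<Sum>K\<in>I. Sup K - Inf K) - (\<Sum>K\<in>J. Sup K - Inf K) < \<delta>\<rbrakk>
       \<Longrightarrow> \<bar>(\<Sum>K\<in>I. f (Sup K) - f (Inf K)) - (\<Sum>K\<in>J. f (Sup K) - f (Inf K))\<bar> < e"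
      using absolutely_continuous_curve_additive_approx[OF ac \<open>e > 0\<close>] by blast
    \<comment> \<open>The two families will differ in length by at most \<open>3 \<epsilon>\<close>; the denominator collects the coefficients
      of \<open>\<epsilon>\<close> in the final inequality.\<close>
    define \<epsilon> where "\<epsilon> = min (\<delta> / 4) (e / (2 * (q - p) + 3 * \<bar>p\<bar>))"
    have den: "2 * (q - p) + 3 * \<bar>p\<bar> > 0" using \<open>p < q\<close> by (intro add_pos_nonneg) auto
    have eps: "\<epsilon> > 0" "3 * \<epsilon> < \<delta>" "\<epsilon> * (2 * (q - p) + 3 * \<bar>p\<bar>) \<le> e"
    proof -
      show "\<epsilon> > 0" using \<open>e > 0\<close> \<delta>(1) den by (simp add: \<epsilon>_def)
      show "3 * \<epsilon> < \<delta>" using \<delta>(1) by (auto simp: \<epsilon>_def min_def)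
      have "\<epsilon> \<le> e / (2 * (q - p) + 3 * \<bar>p\<bar>)" by (simp add: \<epsilon>_def)
      then show "\<epsilon> * (2 * (q - p) + 3 * \<bar>p\<bar>) \<le> e" using den by (simp add: field_simps)
    qed
    obtain V where V: "open V" "E \<subseteq> V" "V - E \<in> lmeasurable" "emeasure lebesgue (V - E) < ennreal \<epsilon>"
      using sets_lebesgue_outer_open[OF Eborel eps(1)] by blast
    have "V = E \<union> (V - E)" using V(2) by auto
    then have Vm: "V \<in> lmeasurable" using E V(3) by (metis fmeasurable.Un)
    have "measure lebesgue (V - E) < \<epsilon>"
      using V(3,4) eps(1) by (simp add: emeasure_eq_measure2 ennreal_less_iff)
    then have measV: "measure lebesgue V \<le> s + \<epsilon>"
      using measurable_measure_Diff[OF Vm _ V(2)] Eborel by (simp add: s_def)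
    have EV: "E \<subseteq> fine_points {K \<in> \<F>. K \<subseteq> V}"
      using fine_points_within_open[OF _ V(1)] V(2) unfolding E_def by blast
    obtain I where I: "disjoint_intervals I" "I \<subseteq> {K \<in> \<F>. K \<subseteq> V}" "measure lebesgue (E - (\<Union>K\<in>I. interior K)) < \<epsilon>"
      using Vitali_finite_intervals[OF E EV eps(1)] by blast
    define W where "W = (\<Union>K\<in>I. interior K)"
    have "open W" unfolding W_def by auto
    have EW: "E \<inter> W \<in> lmeasurable"
      using E \<open>open W\<close> by (simp add: fmeasurable_Int_fmeasurable)
    have "measure lebesgue E = measure lebesgue (E \<inter> W) + measure lebesgue (E - W)"
      using measurable_measure_Diff[OF E fmeasurableD[OF EW]] by (simp add: Diff_Int)
    then have measEW: "measure lebesgue (E \<inter> W) > s - \<epsilon>"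
      using I(3) by (simp add: s_def W_def)
    have EWG: "E \<inter> W \<subseteq> fine_points {K \<in> \<G>. \<exists>L\<in>I. K \<subseteq> interior L}"
    proof
      fix x assume x: "x \<in> E \<inter> W"
      then obtain L where L: "L \<in> I" "x \<in> interior L" unfolding W_def by blast
      then have "x \<in> fine_points {K \<in> \<G>. K \<subseteq> interior L}"
        using x fine_points_within_open[of x \<G> "interior L"] unfolding E_def by auto
      then show "x \<in> fine_points {K \<in> \<G>. \<exists>L\<in>I. K \<subseteq> interior L}"
        using L(1) unfolding fine_points_def by blast
    qed
    obtain J where J: "disjoint_intervals J" "J \<subseteq> {K \<in> \<G>. \<exists>L\<in>I. K \<subseteq> interior L}"
      "measure lebesgue (E \<inter> W - (\<Union>K\<in>J. interior K)) < \<epsilon>"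
      using Vitali_finite_intervals[OF EW EWG eps(1)] by blast
    define P where "P = (\<Sum>K\<in>I. Sup K - Inf K)"
    define Q where "Q = (\<Sum>K\<in>J. Sup K - Inf K)"
    have mI: "P = measure lebesgue (\<Union>I)" "\<Union>I \<in> lmeasurable"
      using measure_disjoint_intervals[OF I(1)] unfolding P_def by auto
    have mJ: "Q = measure lebesgue (\<Union>J)" "\<Union>J \<in> lmeasurable"
      using measure_disjoint_intervals[OF J(1)] unfolding Q_def by auto
    have "\<Union>I \<subseteq> V" using I(2) by blast
    then have "P \<le> s + \<epsilon>"
      using measV measure_mono_fmeasurable[of "\<Union>I" V lebesgue] mI Vm by (auto dest: fmeasurableD)
    have "measure lebesgue (E \<inter> W) \<le> measure lebesgue ((E \<inter> W - (\<Union>K\<in>J. interior K)) \<union> \<Union>J)"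
    proof (rule measure_mono_fmeasurable)
      show "E \<inter> W \<subseteq> (E \<inter> W - (\<Union>K\<in>J. interior K)) \<union> \<Union>J" using interior_subset by blast
      have "(\<Union>K\<in>J. interior K) \<in> sets lebesgue" by (simp add: borel_open open_UN)
      then show "(E \<inter> W - (\<Union>K\<in>J. interior K)) \<union> \<Union>J \<in> lmeasurable"
        using EW mJ(2) by (intro fmeasurable.Un fmeasurable_Diff)
    qed (use EW in auto)
    also have "\<dots> \<le> measure lebesgue (E \<inter> W - (\<Union>K\<in>J. interior K)) + Q"
      unfolding mJ(1)
    proof (rule measure_Un_le)
      have "(\<Union>K\<in>J. interior K) \<in> sets lebesgue" by (simp add: borel_open open_UN)
      then show "E \<inter> W - (\<Union>K\<in>J. interior K) \<in> sets lebesgue"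
        using fmeasurableD[OF EW] by (rule sets.Diff[rotated])
    qed (use mJ(2) in auto)
    finally have "Q \<ge> s - 2 * \<epsilon>" using measEW J(3) by linarith
    have "P - Q \<le> 3 * \<epsilon>" using \<open>P \<le> s + \<epsilon>\<close> \<open>Q \<ge> s - 2 * \<epsilon>\<close> by linarith
    have JI: "\<forall>K\<in>J. \<exists>L\<in>I. K \<subseteq> L"
    proof
      fix K assume "K \<in> J"
      then obtain L where "L \<in> I" "K \<subseteq> interior L" using J(2) by auto
      then show "\<exists>L\<in>I. K \<subseteq> L" using interior_subset[of L] by blast
    qed
    have "Q \<le> P"
      unfolding mI(1) mJ(1)
    proof (rule measure_mono_fmeasurable)
      show "\<Union>J \<subseteq> \<Union>I" using JI by blast
    qed (use mI(2) mJ(2) in \<open>auto dest: fmeasurableD\<close>)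
    have "\<bar>(\<Sum>K\<in>I. f (Sup K) - f (Inf K)) - (\<Sum>K\<in>J. f (Sup K) - f (Inf K))\<bar> < e"
    proof (rule \<delta>(2)[OF I(1) _ J(1) JI])
      show "\<Union>I \<subseteq> {a..b}" using I(2) disjoint_intervalsD(2)[OF I(1)] slopeF(2) by blast
      show "(\<Sum>K\<in>I. Sup K - Inf K) - (\<Sum>K\<in>J. Sup K - Inf K) < \<delta>"
        using \<open>P - Q \<le> 3 * \<epsilon>\<close> eps(2) by (simp add: P_def Q_def)
    qed
    moreover have "(\<Sum>K\<in>I. f (Sup K) - f (Inf K)) \<le> p * P"
      unfolding P_def sum_distrib_left by (rule sum_mono) (use I(2) disjoint_intervalsD(2)[OF I(1)] slopeF in blast)
    moreover have "q * Q \<le> (\<Sum>K\<in>J. f (Sup K) - f (Inf K))"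
      unfolding Q_def sum_distrib_left by (rule sum_mono) (use J(2) disjoint_intervalsD(2)[OF J(1)] slopeG in blast)
    ultimately have "q * Q < p * P + e" by linarith
    then have "(q - p) * Q < p * (P - Q) + e" by (simp add: algebra_simps)
    also have "p * (P - Q) \<le> \<bar>p\<bar> * (3 * \<epsilon>)"
      using \<open>P - Q \<le> 3 * \<epsilon>\<close> \<open>Q \<le> P\<close> by (intro mult_mono) auto
    finally have "(q - p) * Q < \<bar>p\<bar> * (3 * \<epsilon>) + e" by simp
    moreover have "(q - p) * (s - 2 * \<epsilon>) \<le> (q - p) * Q"
      using \<open>Q \<ge> s - 2 * \<epsilon>\<close> \<open>p < q\<close> by (intro mult_left_mono) auto
    ultimately have "(q - p) * s < \<epsilon> * (2 * (q - p) + 3 * \<bar>p\<bar>) + e" by (simp add: algebra_simps)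
    moreover have "(q - p) * s = 4 * e" by (simp add: e_def)
    ultimately have "4 * e < 2 * e" using eps(3) by linarith
    then show False using \<open>e > 0\<close> by simp
  qed
  then show ?thesis
    using E by (simp add: s_def E_def negligible_iff_measure)
qed

text \<open>Families of total length below \<open>\<delta>\<close> have total increment below \<open>1\<close>. Covering a set of measure \<open>s\<close> by
  disjoint intervals of slope at least \<open>M\<close> would give increments of about \<open>M s\<close>, and \<open>M\<close> is arbitrary.\<close>

lemma negligible_fine_points_steep:
  fixes f :: "real \<Rightarrow> real"
  assumes ac: "absolutely_continuous_curve a b f"
    and F: "\<And>M. \<F> M \<subseteq> {{c..d} | c d. a \<le> c \<and> d \<le> b \<and> M * (d - c) \<le> \<bar>f d - f c\<bar>}"
  shows "negligible (\<Inter>M\<in>{0<..}. fine_points (\<F> M))"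
proof -
  define E where "E = (\<Inter>M\<in>{0<..}. fine_points (\<F> M))"
  have slope: "M * (Sup K - Inf K) \<le> \<bar>f (Sup K) - f (Inf K)\<bar>" "K \<subseteq> {a..b}"
    if "K \<in> \<F> M" "\<exists>c d. K = {c..d} \<and> c < d" for K M
    using that F[of M] by (fastforce simp: Icc_eq_Icc)+
  obtain \<delta> where \<delta>: "\<delta> > 0" "\<And>D. \<lbrakk>D division_of \<Union>D; \<Union>D \<subseteq> {a..b}; (\<Sum>k\<in>D. Sup k - Inf k) < \<delta>\<rbrakk> \<Longrightarrow>
        (\<Sum>k\<in>D. norm (f (Sup k) - f (Inf k))) < 1"
    using absolutely_continuous_curveE[OF ac zero_less_one] by blast
  \<comment> \<open>Short enough that every disjoint family inside \<open>V x\<close> has total length below \<open>\<delta>\<close>.\<close>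
  define V where "V x = {x - \<delta> / 3<..<x + \<delta> / 3}" for x :: real
  have openV: "open (V x)" and Vm: "V x \<in> lmeasurable" "measure lebesgue (V x) = 2 * \<delta> / 3" for x
    using \<delta>(1) by (auto simp: V_def)
  define G where "G = (\<Inter>n::nat. fine_points (\<F> (Suc n)))"
  have "negligible (G \<inter> V x)" for x
  proof -
    define N where "N = G \<inter> V x"
    have "G \<in> sets borel"
      unfolding G_def by (intro sets.countable_INT') (auto simp: borel_fine_points)
    then have N: "N \<in> lmeasurable"
      unfolding N_def using Vm by (intro fmeasurable_Int_fmeasurable[OF Vm(1), of _, simplified Int_commute]) auto
    have bound: "real (Suc n) * (measure lebesgue N - \<epsilon>) \<le> 1" if "\<epsilon> > 0" for n \<epsilon>
    proof -
      have NV: "N \<subseteq> fine_points {K \<in> \<F> (Suc n). K \<subseteq> V x}"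
        using fine_points_within_open[OF _ openV] unfolding N_def G_def by blast
      obtain I where I: "disjoint_intervals I" "I \<subseteq> {K \<in> \<F> (Suc n). K \<subseteq> V x}" "measure lebesgue (N - (\<Union>K\<in>I. interior K)) < \<epsilon>"
        using Vitali_finite_intervals[OF N NV \<open>\<epsilon> > 0\<close>] by blast
      define P where "P = (\<Sum>K\<in>I. Sup K - Inf K)"
      have mI: "P = measure lebesgue (\<Union>I)" "\<Union>I \<in> lmeasurable" "I division_of (\<Union>I)"
        using measure_disjoint_intervals[OF I(1)] unfolding P_def by auto
      have "P \<le> 2 * \<delta> / 3"
        unfolding mI(1) Vm(2)[of x, symmetric] using I(2) mI Vm by (intro measure_mono_fmeasurable) auto
      then have "P < \<delta>" using \<delta>(1) by simp
      have "\<Union>I \<subseteq> {a..b}" using I(2) disjoint_intervalsD(2)[OF I(1)] slope(2) by blast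
      then have "(\<Sum>k\<in>I. norm (f (Sup k) - f (Inf k))) < 1"
        using \<delta>(2)[of I] mI(3) \<open>P < \<delta>\<close> unfolding P_def by blast
      moreover have "real (Suc n) * P \<le> (\<Sum>k\<in>I. norm (f (Sup k) - f (Inf k)))"
        unfolding P_def sum_distrib_left
        by (rule sum_mono) (use I(2) disjoint_intervalsD(2)[OF I(1)] slope(1) in \<open>auto simp del: of_nat_Suc\<close>)
      moreover have "measure lebesgue N \<le> \<epsilon> + P"
      proof -
        have sI: "(\<Union>K\<in>I. interior K) \<in> sets lebesgue" by (simp add: borel_open open_UN)
        have "measure lebesgue N \<le> measure lebesgue ((N - (\<Union>K\<in>I. interior K)) \<union> \<Union>I)"
        proof (rule measure_mono_fmeasurable)
          show "N \<subseteq> (N - (\<Union>K\<in>I. interior K)) \<union> \<Union>I" using interior_subset by blast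
          show "(N - (\<Union>K\<in>I. interior K)) \<union> \<Union>I \<in> lmeasurable"
            using N mI(2) sI by (intro fmeasurable.Un fmeasurable_Diff)
        qed (use N in auto)
        also have "\<dots> \<le> measure lebesgue (N - (\<Union>K\<in>I. interior K)) + P"
          unfolding mI(1) by (rule measure_Un_le) (use N mI(2) sI in auto)
        finally show ?thesis using I(3) by linarith
      qed
      then have "real (Suc n) * (measure lebesgue N - \<epsilon>) \<le> real (Suc n) * P"
        by (intro mult_left_mono) auto
      ultimately show ?thesis by linarith
    qed
    have "measure lebesgue N = 0"
    proof (rule ccontr)
      assume "measure lebesgue N \<noteq> 0"
      then have pos: "measure lebesgue N > 0" by (simp add: zero_less_measure_iff)
      obtain n :: nat where "2 / measure lebesgue N < n" using reals_Archimedean2 by blast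
      then have "2 < n * measure lebesgue N" using pos by (simp add: field_simps)
      moreover have "real (Suc n) * (measure lebesgue N - measure lebesgue N / 2) \<le> 1"
        using bound[of "measure lebesgue N / 2"] pos by simp
      ultimately show False using pos by (simp add: field_simps)
    qed
    then show ?thesis using N by (simp add: N_def negligible_iff_measure)
  qed
  then have "negligible (\<Union>x\<in>\<rat>. G \<inter> V x)"
    by (intro negligible_countable_Union countable_image countable_rat) auto
  moreover have "E \<subseteq> (\<Union>x\<in>\<rat>. G \<inter> V x)"
  proof
    fix y assume y: "y \<in> E"
    obtain x where "x \<in> \<rat>" "y - \<delta> / 3 < x" "x < y + \<delta> / 3"
      using Rats_dense_in_real[of "y - \<delta> / 3" "y + \<delta> / 3"] \<delta>(1) by auto
    then have "x \<in> \<rat>" "y \<in> V x" by (auto simp: V_def)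
    moreover have "y \<in> G"
      using y unfolding E_def G_def by (auto simp del: of_nat_Suc)
    ultimately show "y \<in> (\<Union>x\<in>\<rat>. G \<inter> V x)" by blast
  qed
  ultimately show ?thesis
    unfolding E_def using negligible_subset by blast
qed

text \<open>Slopes over intervals with \<open>x\<close> in their interior control the one-sided slopes at \<open>x\<close>: let one endpoint
  tend to \<open>x\<close> and use continuity.\<close>

lemma absolutely_continuous_curve_straddle_derivative:
  fixes f :: "real \<Rightarrow> real"
  assumes cont: "continuous_on {a..b} f" and x: "a < x" "x < b"
    and str: "\<And>e. e > 0 \<Longrightarrow> \<exists>\<eta>>0. \<forall>c d. a \<le> c \<and> c < x \<and> x < d \<and> d \<le> b \<and> d - c < \<eta>
                \<longrightarrow> \<bar>f d - f c - L * (d - c)\<bar> \<le> e * (d - c)"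
  shows "(f has_derivative (\<lambda>h. L * h)) (at x within {a..b})"
  unfolding has_derivative_within_alt
proof (intro conjI allI impI)
  show "bounded_linear ((*) L)" by (rule bounded_linear_mult_right)
  have isc: "isCont f x"
    using cont x by (simp add: continuous_on_interior)
  fix e :: real assume "e > 0"
  then obtain \<eta> where \<eta>: "\<eta> > 0" "\<And>c d. \<lbrakk>a \<le> c; c < x; x < d; d \<le> b; d - c < \<eta>\<rbrakk>
                \<Longrightarrow> \<bar>f d - f c - L * (d - c)\<bar> \<le> e * (d - c)"
    using str by meson
  have right: "\<bar>f d - f x - L * (d - x)\<bar> \<le> e * (d - x)" if d: "x < d" "d \<le> b" "d - x < \<eta>" for d
  proof (rule tendsto_le[of "at_left x"])
    show "((\<lambda>c. e * (d - c)) \<longlongrightarrow> e * (d - x)) (at_left x)"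
      by (intro tendsto_intros)
    show "((\<lambda>c. \<bar>f d - f c - L * (d - c)\<bar>) \<longlongrightarrow> \<bar>f d - f x - L * (d - x)\<bar>) (at_left x)"
      by (intro tendsto_intros filterlim_mono[OF isc[unfolded isCont_def]]) (auto simp: at_le)
    have "eventually (\<lambda>c. c \<in> {max a (d - \<eta>)<..<x}) (at_left x)"
      using d x by (intro eventually_at_left_real) auto
    then show "eventually (\<lambda>c. \<bar>f d - f c - L * (d - c)\<bar> \<le> e * (d - c)) (at_left x)"
      by eventually_elim (use \<eta>(2) d in auto)
  qed simp
  have left: "\<bar>f x - f c - L * (x - c)\<bar> \<le> e * (x - c)" if c: "c < x" "a \<le> c" "x - c < \<eta>" for c
  proof (rule tendsto_le[of "at_right x"])
    show "((\<lambda>d. e * (d - c)) \<longlongrightarrow> e * (x - c)) (at_right x)"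
      by (intro tendsto_intros)
    show "((\<lambda>d. \<bar>f d - f c - L * (d - c)\<bar>) \<longlongrightarrow> \<bar>f x - f c - L * (x - c)\<bar>) (at_right x)"
      by (intro tendsto_intros filterlim_mono[OF isc[unfolded isCont_def]]) (auto simp: at_le)
    have "eventually (\<lambda>d. d \<in> {x<..<min b (c + \<eta>)}) (at_right x)"
      using c x by (intro eventually_at_right_real) auto
    then show "eventually (\<lambda>d. \<bar>f d - f c - L * (d - c)\<bar> \<le> e * (d - c)) (at_right x)"
      by eventually_elim (use \<eta>(2) c in auto)
  qed simp
  show "\<exists>d>0. \<forall>y\<in>{a..b}. norm (y - x) < d \<longrightarrow> norm (f y - f x - L * (y - x)) \<le> e * norm (y - x)"
  proof (intro exI[of _ \<eta>] conjI ballI impI \<eta>(1))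
    fix y assume y: "y \<in> {a..b}" "norm (y - x) < \<eta>"
    consider "y = x" | "y < x" | "x < y" by linarith
    then show "norm (f y - f x - L * (y - x)) \<le> e * norm (y - x)"
    proof cases
      case 2
      have "norm (f y - f x - L * (y - x)) = \<bar>f x - f y - L * (x - y)\<bar>"
        by (simp add: algebra_simps abs_minus_commute)
      then show ?thesis using left[of y] 2 y by auto
    next
      case 3
      then show ?thesis using right[of y] y by auto
    qed auto
  qed
qed

text \<open>Away from the negligible sets of the two preceding lemmas, taken over rational slopes, the slopes near
  \<open>x\<close> stay bounded, and the infimum \<open>L\<close> of the eventual upper bounds of the slopes is also their eventual
  lower bound up to any \<open>e\<close>.\<close>

lemma absolutely_continuous_real_differentiable_ae:
  fixes f :: "real \<Rightarrow> real"
  assumes ac: "absolutely_continuous_curve a b f"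
  shows "\<exists>N. negligible N \<and> (\<forall>x\<in>{a..b} - N. f differentiable (at x within {a..b}))"
proof -
  define lo where "lo p = {{c..d} | c d. a \<le> c \<and> d \<le> b \<and> f d - f c \<le> p * (d - c)}" for p
  define up where "up q = {{c..d} | c d. a \<le> c \<and> d \<le> b \<and> q * (d - c) \<le> f d - f c}" for q
  define st where "st M = {{c..d} | c d. a \<le> c \<and> d \<le> b \<and> M * (d - c) \<le> \<bar>f d - f c\<bar>}" for M
  define N where "N = {a, b} \<union> (\<Union>(p, q)\<in>{(p, q) \<in> \<rat> \<times> \<rat>. p < q}. fine_points (lo p) \<inter> fine_points (up q))
      \<union> (\<Inter>M\<in>{0<..}. fine_points (st M))"
  have "negligible N"
    unfolding N_def
  proof (intro negligible_Un)
    have "countable {(p, q) \<in> \<rat> \<times> (\<rat>::real set). p < q}"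
      by (rule countable_subset[of _ "\<rat> \<times> \<rat>"]) (auto simp: countable_rat)
    then show "negligible (\<Union>(p, q)\<in>{(p, q) \<in> \<rat> \<times> \<rat>. p < q}. fine_points (lo p) \<inter> fine_points (up q))"
      by (intro negligible_countable_Union countable_image)
         (auto simp: lo_def up_def intro: negligible_fine_points_two_slopes[OF ac])
    show "negligible (\<Inter>M\<in>{0<..}. fine_points (st M))"
      by (rule negligible_fine_points_steep[OF ac]) (auto simp: st_def)
  qed auto
  moreover have "f differentiable (at x within {a..b})" if x: "x \<in> {a..b} - N" for x
  proof -
    have ax: "a < x" "x < b" using x unfolding N_def by (auto simp: less_le)
    have not_fine: "\<exists>\<eta>>0. \<forall>c d. c < x \<and> x < d \<and> d - c < \<eta> \<longrightarrow> {c..d} \<notin> \<F>"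
      if "x \<notin> fine_points \<F>" for \<F>
      using that unfolding fine_points_def by blast
    \<comment> \<open>The upper bounds for all slopes over short intervals around \<open>x\<close>.\<close>
    define S where "S = {q. \<exists>\<eta>>0. \<forall>c d. a \<le> c \<and> c < x \<and> x < d \<and> d \<le> b \<and> d - c < \<eta>
                \<longrightarrow> f d - f c \<le> q * (d - c)}"
    obtain M where M: "M > 0" "x \<notin> fine_points (st M)" using x unfolding N_def by auto
    obtain \<eta>M where \<eta>M: "\<eta>M > 0" "\<And>c d. \<lbrakk>c < x; x < d; d - c < \<eta>M\<rbrakk> \<Longrightarrow> {c..d} \<notin> st M"
      using not_fine[OF M(2)] by blast
    have steep: "\<bar>f d - f c\<bar> \<le> M * (d - c)" if "a \<le> c" "c < x" "x < d" "d \<le> b" "d - c < \<eta>M" for c d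
      using \<eta>M(2)[OF that(2,3,5)] that unfolding st_def by (auto simp: not_le)
    have "M \<in> S"
      unfolding S_def
    proof (intro CollectI exI[of _ \<eta>M] conjI allI impI \<eta>M(1))
      fix c d assume "a \<le> c \<and> c < x \<and> x < d \<and> d \<le> b \<and> d - c < \<eta>M"
      then have "\<bar>f d - f c\<bar> \<le> M * (d - c)" by (intro steep) auto
      then show "f d - f c \<le> M * (d - c)" by linarith
    qed
    have S_D: "\<exists>\<eta>>0. \<forall>c d. a \<le> c \<and> c < x \<and> x < d \<and> d \<le> b \<and> d - c < \<eta> \<longrightarrow> f d - f c \<le> q * (d - c)"
      if "q \<in> S" for q
      using that unfolding S_def by (rule CollectD)
    have low: "-M \<le> q" if qS: "q \<in> S" for q
    proof -
      obtain \<eta> where \<eta>: "\<eta> > 0" "\<And>c d. \<lbrakk>a \<le> c; c < x; x < d; d \<le> b; d - c < \<eta>\<rbrakk>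
                \<Longrightarrow> f d - f c \<le> q * (d - c)"
        using S_D[OF qS] by auto
      define h where "h = min (min \<eta> \<eta>M) (min (x - a) (b - x)) / 3"
      have h: "h > 0" "2 * h < \<eta>" "2 * h < \<eta>M" "a \<le> x - h" "x + h \<le> b"
      proof -
        have "3 * h \<le> \<eta>" "3 * h \<le> \<eta>M" "3 * h \<le> x - a" "3 * h \<le> b - x" "h > 0"
          using \<eta>(1) \<eta>M(1) ax by (auto simp: h_def)
        then show "h > 0" "2 * h < \<eta>" "2 * h < \<eta>M" "a \<le> x - h" "x + h \<le> b" by linarith+
      qed
      have "-(M * (2 * h)) \<le> q * (2 * h)"
      proof -
        have "(x + h) - (x - h) = 2 * h" by simp
        then have "f (x + h) - f (x - h) \<le> q * (2 * h)" "\<bar>f (x + h) - f (x - h)\<bar> \<le> M * (2 * h)"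
          using \<eta>(2)[of "x - h" "x + h"] steep[of "x - h" "x + h"] h by auto
        then show ?thesis by linarith
      qed
      then have "(- M) * (2 * h) \<le> q * (2 * h)" by simp
      then show ?thesis using h(1) by (simp only: mult_le_cancel_right_pos)
    qed
    have bdd: "bdd_below S" using low by (auto simp: bdd_below_def)
    define L where "L = Inf S"
    have "\<exists>\<eta>>0. \<forall>c d. a \<le> c \<and> c < x \<and> x < d \<and> d \<le> b \<and> d - c < \<eta>
                \<longrightarrow> \<bar>f d - f c - L * (d - c)\<bar> \<le> e * (d - c)" if e0: "e > 0" for e
    proof -
      obtain q' where "q' \<in> S" "q' < L + e"
        using cInf_lessD[of S "L + e"] \<open>M \<in> S\<close> e0 unfolding L_def by auto
      then obtain \<eta>1 where \<eta>1: "\<eta>1 > 0" "\<And>c d. \<lbrakk>a \<le> c; c < x; x < d; d \<le> b; d - c < \<eta>1\<rbrakk>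
                \<Longrightarrow> f d - f c \<le> q' * (d - c)"
        using S_D by metis
      obtain p q where pq: "p \<in> \<rat>" "q \<in> \<rat>" "L - e < p" "p < q" "q < L"
      proof -
        obtain p where p: "p \<in> \<rat>" "L - e < p" "p < L"
          using Rats_dense_in_real[of "L - e" L] e0 by auto
        obtain q where "q \<in> \<rat>" "p < q" "q < L"
          using Rats_dense_in_real[OF p(3)] by auto
        with p show thesis by (intro that)
      qed
      have "q \<notin> S" using cInf_lower[OF _ bdd, of q] pq(5) by (auto simp: L_def)
      have "x \<in> fine_points (up q)"
        unfolding fine_points_def
      proof (intro CollectI allI impI)
        fix \<eta> :: real assume "\<eta> > 0"
        then obtain c d where "a \<le> c" "c < x" "x < d" "d \<le> b" "d - c < \<eta>" "\<not> f d - f c \<le> q * (d - c)"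
          using \<open>q \<notin> S\<close> unfolding S_def by blast
        then show "\<exists>c d. {c..d} \<in> up q \<and> c < x \<and> x < d \<and> d - c < \<eta>"
          unfolding up_def by (intro exI[of _ c] exI[of _ d]) auto
      qed
      then have "x \<notin> fine_points (lo p)"
        using x pq unfolding N_def by auto
      then obtain \<eta>2 where \<eta>2: "\<eta>2 > 0" "\<And>c d. \<lbrakk>c < x; x < d; d - c < \<eta>2\<rbrakk> \<Longrightarrow> {c..d} \<notin> lo p"
        using not_fine by blast
      show ?thesis
      proof (intro exI[of _ "min \<eta>1 \<eta>2"] conjI allI impI)
        show "min \<eta>1 \<eta>2 > 0" using \<eta>1 \<eta>2 by simp
        fix c d assume cd: "a \<le> c \<and> c < x \<and> x < d \<and> d \<le> b \<and> d - c < min \<eta>1 \<eta>2"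
        have "{c..d} \<notin> lo p" using \<eta>2(2) cd by auto
        then have "p * (d - c) < f d - f c" using cd unfolding lo_def by (auto simp: not_le)
        moreover have "(L - e) * (d - c) \<le> p * (d - c)"
          using pq(3) cd by (intro mult_right_mono) auto
        moreover have "f d - f c \<le> q' * (d - c)" using \<eta>1(2) cd by auto
        moreover have "q' * (d - c) \<le> (L + e) * (d - c)"
          using \<open>q' < L + e\<close> cd by (intro mult_right_mono) auto
        ultimately show "\<bar>f d - f c - L * (d - c)\<bar> \<le> e * (d - c)"
          unfolding abs_le_iff by (simp add: algebra_simps)
      qed
    qed
    then have "(f has_derivative (\<lambda>h. L * h)) (at x within {a..b})"
      using absolutely_continuous_curve_straddle_derivative[OF absolutely_continuous_curve_continuous[OF ac] ax]
      by blast
    then show ?thesis unfolding differentiable_def by blast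
  qed
  ultimately show ?thesis by blast
qed

theorem absolutely_continuous_curve_differentiable_ae:
  fixes \<sigma> :: "real \<Rightarrow> 'a::euclidean_space"
  assumes ac: "absolutely_continuous_curve a b \<sigma>"
  obtains N where "negligible N" "\<And>x. x \<in> {a..b} - N \<Longrightarrow> \<sigma> differentiable (at x within {a..b})"
proof -
  have "\<exists>N. negligible N \<and> (\<forall>x\<in>{a..b} - N. (\<lambda>t. \<sigma> t \<bullet> i) differentiable (at x within {a..b}))" if "i \<in> Basis" for i
  proof (intro absolutely_continuous_real_differentiable_ae absolutely_continuous_curve_dominated[OF ac])
    show "norm (\<sigma> s \<bullet> i - \<sigma> t \<bullet> i) \<le> 1 * norm (\<sigma> s - \<sigma> t)" for s t
      using Basis_le_norm[OF that, of "\<sigma> s - \<sigma> t"] by (simp add: inner_diff_left)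
  qed
  then obtain N where N: "\<And>i. i \<in> Basis \<Longrightarrow> negligible (N i)"
    "\<And>i x. i \<in> Basis \<Longrightarrow> x \<in> {a..b} - N i \<Longrightarrow> (\<lambda>t. \<sigma> t \<bullet> i) differentiable (at x within {a..b})"
    by metis
  show thesis
  proof (rule that[of "\<Union>i\<in>Basis. N i"])
    show "negligible (\<Union>i\<in>Basis. N i)"
      using N(1) by (intro negligible_Union) auto
    show "\<And>x. x \<in> {a..b} - (\<Union>i\<in>Basis. N i) \<Longrightarrow> \<sigma> differentiable (at x within {a..b})"
      using N(2) by (subst differentiable_componentwise_within) auto
  qed
qed

section \<open>Change of an absolutely continuous function and the integral of its derivative\<close>

text \<open>The gauge integral suits this: at tags outside \<open>N\<close> the derivative controls the increments, and the
  intervals with tags in \<open>N\<close> are forced into an open set of small measure, where absolute continuity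
  makes the sum of the increments small.\<close>

lemma absolutely_continuous_has_integral:
  fixes u :: "real \<Rightarrow> real"
  assumes ac: "absolutely_continuous_curve a b u" and "a \<le> b" and N: "negligible N"
    and u': "\<And>x. x \<in> {a..b} - N \<Longrightarrow> (u has_vector_derivative u' x) (at x within {a..b})"
  shows "((\<lambda>x. if x \<in> N then 0 else u' x) has_integral (u b - u a)) {a..b}"
  unfolding has_integral_real
proof (intro allI impI)
  fix e :: real assume "e > 0"
  define w where "w = (\<lambda>x. if x \<in> N then 0 else u' x)"
  define e1 where "e1 = e / (2 * (b - a + 1))"
  have e1: "e1 > 0" "e1 * (b - a) < e / 2"
    using \<open>e > 0\<close> \<open>a \<le> b\<close> by (auto simp: e1_def field_simps)
  have "\<exists>d>0. x \<in> {a..b} - N \<longrightarrow> (\<forall>y\<in>{a..b}. norm (y - x) < d \<longrightarrow> norm (u y - u x - (y - x) *\<^sub>R u' x) \<le> e1 * norm (y - x))" for x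
    using u' e1(1) unfolding has_vector_derivative_def has_derivative_within_alt by (metis zero_less_one)
  then obtain d where d: "\<And>x. d x > 0" "\<And>x y. \<lbrakk>x \<in> {a..b} - N; y \<in> {a..b}; norm (y - x) < d x\<rbrakk>
      \<Longrightarrow> norm (u y - u x - (y - x) *\<^sub>R u' x) \<le> e1 * norm (y - x)"
    by metis
  obtain \<delta> where \<delta>: "\<delta> > 0" "\<And>D. \<lbrakk>D division_of \<Union>D; \<Union>D \<subseteq> {a..b}; (\<Sum>k\<in>D. Sup k - Inf k) < \<delta>\<rbrakk>
    \<Longrightarrow> (\<Sum>k\<in>D. norm (u (Sup k) - u (Inf k))) < e / 2"
    using absolutely_continuous_curveE[OF ac, of "e / 2"] \<open>e > 0\<close> half_gt_zero by blast
  obtain T where T: "open T" "N \<subseteq> T" "T - N \<in> lmeasurable" "emeasure lebesgue (T - N) < ennreal \<delta>"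
    using sets_lebesgue_outer_open[OF negligible_imp_sets[OF N] \<delta>(1)] by blast
  have Tm: "T \<in> lmeasurable"
    using T(3) N by (metis T(2) Diff_partition Un_commute fmeasurable.Un negligible_imp_measurable)
  have "measure lebesgue T = measure lebesgue (T - N)"
    using N Tm by (simp add: measure_Diff_null_set negligible_iff_null_sets fmeasurableD)
  then have mT: "measure lebesgue T < \<delta>"
    using T(3,4) \<delta>(1) by (simp add: emeasure_eq_measure2 ennreal_less_iff)
  define \<gamma> where "\<gamma> x = (if x \<in> N then T else ball x (d x))" for x
  show "\<exists>\<gamma>. gauge \<gamma> \<and> (\<forall>\<D>. \<D> tagged_division_of {a..b} \<and> \<gamma> fine \<D> \<longrightarrow>
          norm ((\<Sum>(x, k)\<in>\<D>. measure lborel k *\<^sub>R (if x \<in> N then 0 else u' x)) - (u b - u a)) < e)"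
  proof (intro exI[of _ \<gamma>] conjI allI impI)
    show "gauge \<gamma>" using T(1,2) d(1) by (auto simp: gauge_def \<gamma>_def)
    fix p assume p: "p tagged_division_of {a..b} \<and> \<gamma> fine p"
    note tp = tagged_division_ofD[OF p[THEN conjunct1]]
    have K: "\<exists>u v. u \<le> v \<and> K = {u..v} \<and> x \<in> {u..v} \<and> {u..v} \<subseteq> {a..b}" if xK: "(x, K) \<in> p" for x K
    proof -
      obtain u v where "K = cbox u v" using tp(4)[OF xK] by blast
      then show ?thesis using tp(2,3)[OF xK] by auto
    qed
    define g where "g = (\<lambda>(x::real, K::real set). measure lborel K *\<^sub>R w x - (u (Sup K) - u (Inf K)))"
    define p1 where "p1 = {(x, K) \<in> p. x \<notin> N}"
    define p2 where "p2 = {(x, K) \<in> p. x \<in> N}"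
    have pp: "p = p1 \<union> p2" "p1 \<inter> p2 = {}" "finite p1" "finite p2"
      using tp(1) by (auto simp: p1_def p2_def intro: finite_subset[of _ p])
    have "(\<Sum>(x, k)\<in>p. measure lborel k *\<^sub>R w x) - (u b - u a) = (\<Sum>z\<in>p. g z)"
      using additive_tagged_division_1[OF \<open>a \<le> b\<close> p[THEN conjunct1], of u]
      by (simp add: g_def sum_subtractf case_prod_unfold)
    also have "\<dots> = (\<Sum>z\<in>p1. g z) + (\<Sum>z\<in>p2. g z)"
      using pp by (simp add: sum.union_disjoint)
    finally have split: "(\<Sum>(x, k)\<in>p. measure lborel k *\<^sub>R w x) - (u b - u a) = (\<Sum>z\<in>p1. g z) + (\<Sum>z\<in>p2. g z)" .
    have "norm (\<Sum>z\<in>p1. g z) \<le> (\<Sum>(x, K)\<in>p1. e1 * (Sup K - Inf K))"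
    proof (rule sum_norm_le, clarify)
      fix x K assume xK: "(x, K) \<in> p1"
      then obtain c v where cv: "c \<le> v" "K = {c..v}" "x \<in> {c..v}" "{c..v} \<subseteq> {a..b}" "x \<notin> N"
        using K unfolding p1_def by blast
      have ball: "{c..v} \<subseteq> ball x (d x)"
        using p xK cv unfolding fine_def p1_def \<gamma>_def by fastforce
      have cb: "c \<in> ball x (d x)" "v \<in> ball x (d x)" "c \<in> {a..b}" "v \<in> {a..b}" "x \<in> {a..b} - N"
        using subsetD[OF ball, of c] subsetD[OF ball, of v] cv by auto
      have "norm (u v - u x - (v - x) *\<^sub>R u' x) \<le> e1 * norm (v - x)"
        using d(2)[OF cb(5,4)] cb(2) by (simp add: dist_norm norm_minus_commute)
      moreover have "norm (u c - u x - (c - x) *\<^sub>R u' x) \<le> e1 * norm (c - x)"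
        using d(2)[OF cb(5,3)] cb(1) by (simp add: dist_norm norm_minus_commute)
      moreover have "e1 * norm (v - x) + e1 * norm (c - x) = e1 * (v - c)"
        using cv(3) by (simp add: algebra_simps)
      moreover have "g (x, K) = (u c - u x - (c - x) *\<^sub>R u' x) - (u v - u x - (v - x) *\<^sub>R u' x)"
        using cv by (simp add: g_def w_def algebra_simps)
      ultimately show "norm (g (x, K)) \<le> e1 * (Sup K - Inf K)"
        using norm_triangle_ineq4[of "u c - u x - (c - x) *\<^sub>R u' x" "u v - u x - (v - x) *\<^sub>R u' x"] cv
        by simp
    qed
    also have "\<dots> \<le> (\<Sum>(x, K)\<in>p. e1 * (Sup K - Inf K))"
    proof (rule sum_mono2[OF tp(1)])
      show "p1 \<subseteq> p" by (auto simp: p1_def)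
      show "0 \<le> (case z of (x, K) \<Rightarrow> e1 * (Sup K - Inf K))" if "z \<in> p - p1" for z
        using that K[of "fst z" "snd z"] e1(1) by (auto simp: case_prod_unfold)
    qed
    also have "\<dots> = e1 * (b - a)"
      using additive_tagged_division_1[OF \<open>a \<le> b\<close> p[THEN conjunct1], of "\<lambda>x. x"]
      by (simp add: case_prod_unfold sum_distrib_left[symmetric])
    finally have n1: "norm (\<Sum>z\<in>p1. g z) < e / 2" using e1(2) by linarith
    define D where "D = snd ` p2"
    have "p2 tagged_partial_division_of {a..b}"
    proof (rule tagged_partial_division_subset[rotated])
      show "p2 \<subseteq> p" by (auto simp: p2_def)
      show "p tagged_partial_division_of {a..b}" using p by (auto simp: tagged_division_of_def)
    qed
    then have p2D: "p2 tagged_division_of (\<Union>D)"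
      unfolding D_def by (rule tagged_partial_division_of_Union_self)
    then have Ddiv: "D division_of (\<Union>D)"
      unfolding D_def by (rule division_of_tagged_division)
    have DK: "\<exists>u v. u \<le> v \<and> k = {u..v} \<and> {u..v} \<subseteq> {a..b} \<and> {u..v} \<subseteq> T" if kD: "k \<in> D" for k
    proof -
      obtain x where x: "(x, k) \<in> p" "x \<in> N" using kD unfolding D_def p2_def by auto
      then have "k \<subseteq> T" using p unfolding fine_def \<gamma>_def by fastforce
      then show ?thesis using K[OF x(1)] by blast
    qed
    have "(\<Sum>k\<in>D. Sup k - Inf k) = (\<Sum>k\<in>D. measure lebesgue k)"
      by (rule sum.cong[OF refl]) (use DK in fastforce)
    also have "\<dots> = measure lebesgue (\<Union>D)"
    proof (rule measure_negligible_finite_Union[symmetric])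
      show "finite D" using pp(4) by (simp add: D_def)
      show "\<And>S. S \<in> D \<Longrightarrow> S \<in> lmeasurable" using DK by fastforce
      show "pairwise (\<lambda>S T. negligible (S \<inter> T)) D"
      proof (rule pairwiseI)
        fix k l assume kl: "k \<in> D" "l \<in> D" "k \<noteq> l"
        obtain c v c' v' where "k = {c..v}" "l = {c'..v'}" using DK kl by metis
        moreover have "interior k \<inter> interior l = {}"
          using division_ofD(5)[OF Ddiv kl] .
        ultimately show "negligible (k \<inter> l)"
          by (metis Int_atLeastAtMost convex_Int convex_real_interval(5) interior_Int negligible_convex_interior)
      qed
    qed
    also have "\<dots> \<le> measure lebesgue T"
    proof (rule measure_mono_fmeasurable)
      show "\<Union>D \<subseteq> T" using DK by blast
      show "\<Union>D \<in> sets lebesgue" 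
        by (rule fmeasurableD[OF lmeasurable_division[OF Ddiv]])
    qed (rule Tm)
    finally have "(\<Sum>k\<in>D. Sup k - Inf k) < \<delta>" using mT by simp
    moreover have "\<Union>D \<subseteq> {a..b}" using DK by blast
    ultimately have sD: "(\<Sum>k\<in>D. norm (u (Sup k) - u (Inf k))) < e / 2"
      using \<delta>(2) Ddiv by blast
    define h where "h k = (if k = {} then 0 else norm (u (Sup k) - u (Inf k)))" for k
    have "norm (\<Sum>z\<in>p2. g z) \<le> (\<Sum>(x, k)\<in>p2. h k)"
    proof (rule sum_norm_le, clarify)
      fix x k assume "(x, k) \<in> p2"
      then show "norm (g (x, k)) \<le> h k"
        using K[of x k] by (auto simp: g_def w_def h_def p2_def)
    qed
    also have "\<dots> = (\<Sum>k\<in>D. h k)"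
      unfolding D_def
    proof (rule sum.over_tagged_division_lemma[OF p2D])
      show "h (cbox c v) = 0" if "box c v = {}" for c v :: real
        using that by (auto simp: h_def)
    qed
    also have "\<dots> = (\<Sum>k\<in>D. norm (u (Sup k) - u (Inf k)))"
      by (rule sum.cong[OF refl]) (use DK in \<open>force simp: h_def\<close>)
    finally have n2: "norm (\<Sum>z\<in>p2. g z) < e / 2" using sD by linarith
    have "norm ((\<Sum>z\<in>p1. g z) + (\<Sum>z\<in>p2. g z)) < e"
      using n1 n2 norm_triangle_ineq[of "\<Sum>z\<in>p1. g z" "\<Sum>z\<in>p2. g z"] by linarith
    then show "norm ((\<Sum>(x, k)\<in>p. measure lborel k *\<^sub>R (if x \<in> N then 0 else u' x)) - (u b - u a)) < e"
      by (simp only: split[unfolded w_def])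
  qed
qed

text \<open>When the integral of \<open>m\<close> is finite it dominates \<open>|u'|\<close>, which is measurable as a gauge integrable
  function. The bound \<open>m\<close> will be the speed of a curve in the Kobayashi metric.\<close>

theorem absolutely_continuous_diff_le_nn_integral:
  fixes u :: "real \<Rightarrow> real"
  assumes ac: "absolutely_continuous_curve a b u" and "a \<le> b" and N: "negligible N"
    and u': "\<And>x. x \<in> {a..b} - N \<Longrightarrow> (u has_vector_derivative u' x) (at x within {a..b})"
    and le: "\<And>x. x \<in> {a..b} - N \<Longrightarrow> \<bar>u' x\<bar> \<le> m x"
  shows "ennreal \<bar>u b - u a\<bar> \<le> (\<integral>\<^sup>+ t. ennreal (m t) \<partial>lebesgue_on {a..b})"
proof (cases "(\<integral>\<^sup>+ t. ennreal (m t) \<partial>lebesgue_on {a..b}) = \<infinity>")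
  case False
  define w where "w = (\<lambda>x. if x \<in> N then 0 else u' x)"
  have int: "(w has_integral (u b - u a)) {a..b}"
    unfolding w_def by (rule absolutely_continuous_has_integral[OF ac \<open>a \<le> b\<close> N u'])
  have meas: "w \<in> borel_measurable (lebesgue_on {a..b})"
    using int by (intro integrable_imp_measurable) (auto simp: integrable_on_def)
  have le_nn: "(\<integral>\<^sup>+ t. ennreal (norm (w t)) \<partial>lebesgue_on {a..b}) \<le> (\<integral>\<^sup>+ t. ennreal (m t) \<partial>lebesgue_on {a..b})"
  proof (rule nn_integral_mono)
    fix t assume "t \<in> space (lebesgue_on {a..b})"
    then show "ennreal (norm (w t)) \<le> ennreal (m t)"
      using le[of t] by (cases "t \<in> N") (auto simp: w_def intro: ennreal_leI)
  qed
  have "integrable (lebesgue_on {a..b}) w"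
    using meas le_nn False by (simp add: integrable_iff_bounded top.not_eq_extremum le_less_trans)
  then have "u b - u a = integral\<^sup>L (lebesgue_on {a..b}) w"
    using int lebesgue_integral_eq_integral[of "{a..b}" w] by (simp add: integral_unique)
  then have "ennreal \<bar>u b - u a\<bar> = ennreal (norm (integral\<^sup>L (lebesgue_on {a..b}) w))"
    by simp
  also have "\<dots> \<le> (\<integral>\<^sup>+ t. ennreal (norm (w t)) \<partial>lebesgue_on {a..b})"
    using \<open>integrable (lebesgue_on {a..b}) w\<close> by (rule integral_norm_bound_ennreal)
  finally show ?thesis using le_nn by order
qed simp

section \<open>Holomorphic functions and discs\<close>

lemma norm_vector_scalar_mult: "norm (c *s (v :: complex ^ 'n)) = cmod c * norm v"
proof -
  have "norm (c *s v) = L2_set (\<lambda>i. cmod c * norm (v $ i)) UNIV"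
    by (simp add: norm_vec_def norm_mult)
  also have "\<dots> = cmod c * norm v"
    by (simp add: norm_vec_def L2_set_right_distrib)
  finally show ?thesis .
qed

lemma has_derivative_vec_complex:
  fixes f :: "complex \<Rightarrow> complex ^ 'n"
  assumes "\<And>i. ((\<lambda>z. f z $ i) has_field_derivative (d $ i)) (at z)"
  shows "(f has_derivative (\<lambda>\<xi>. \<xi> *s d)) (at z)"
proof (subst has_derivative_componentwise_within, intro ballI)
  fix j :: "complex ^ 'n" assume "j \<in> Basis"
  then obtain i u where j: "j = axis i u" unfolding Basis_vec_def by blast
  have "((\<lambda>z. f z $ i \<bullet> u) has_derivative (\<lambda>\<xi>. (d $ i * \<xi>) \<bullet> u)) (at z)"
    using assms[of i] unfolding has_field_derivative_def by (rule has_derivative_inner_left)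
  then show "((\<lambda>z. f z \<bullet> j) has_derivative (\<lambda>\<xi>. (\<xi> *s d) \<bullet> j)) (at z)"
    by (simp add: j inner_axis mult.commute)
qed

definition disc_deriv :: "(complex \<Rightarrow> complex ^ 'n) \<Rightarrow> complex \<Rightarrow> complex ^ 'n" where
  "disc_deriv f z = (\<chi> i. deriv (\<lambda>z. f z $ i) z)"

lemma holomorphic_disc_has_derivative:
  assumes "holomorphic_disc \<Omega> f" "cmod z < 1"
  shows "(f has_derivative (\<lambda>\<xi>. \<xi> *s disc_deriv f z)) (at z)"
proof (rule has_derivative_vec_complex)
  fix i
  have "(\<lambda>z. f z $ i) holomorphic_on ball 0 1" using assms(1) by (simp add: holomorphic_disc_def)
  then show "((\<lambda>z. f z $ i) has_field_derivative disc_deriv f z $ i) (at z)"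
    using assms(2) by (simp add: disc_deriv_def holomorphic_derivI)
qed

lemma holomorphic_disc_mem: "holomorphic_disc \<Omega> f \<Longrightarrow> cmod z < 1 \<Longrightarrow> f z \<in> \<Omega>"
  unfolding holomorphic_disc_def by auto

lemma holomorphic_disc_compose:
  assumes f: "holomorphic_disc \<Omega> f" and m: "m holomorphic_on ball 0 1" "\<And>z. cmod z < 1 \<Longrightarrow> cmod (m z) < 1"
  shows "holomorphic_disc \<Omega> (\<lambda>z. f (m z))"
  unfolding holomorphic_disc_def
proof (intro conjI allI)
  show "(\<lambda>z. f (m z)) \<in> ball 0 1 \<rightarrow> \<Omega>"
    using f m(2) by (auto simp: holomorphic_disc_def)
  fix i
  have "((\<lambda>z. f z $ i) \<circ> m) holomorphic_on ball 0 1"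
    using f m by (intro holomorphic_on_compose_gen[of m _ _ "ball 0 1"]) (auto simp: holomorphic_disc_def)
  then show "(\<lambda>z. f (m z) $ i) holomorphic_on ball 0 1" by (simp add: o_def)
qed

text \<open>Holomorphy in several variables: the real derivative is complex linear. In this form the chain rule
  applies both to holomorphic discs and to real curves.\<close>

definition holomorphic_fun_on :: "(complex ^ 'n) set \<Rightarrow> (complex ^ 'n \<Rightarrow> complex) \<Rightarrow> bool" where
  "holomorphic_fun_on \<Omega> g \<longleftrightarrow>
     (\<forall>x\<in>\<Omega>. \<exists>D. (g has_derivative D) (at x) \<and> (\<forall>c v. D (c *s v) = c * D v))"

lemma holomorphic_fun_onE:
  assumes "holomorphic_fun_on \<Omega> g" "x \<in> \<Omega>"
  obtains D where "(g has_derivative D) (at x)" "\<And>c v. D (c *s v) = c * D v"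
  using assms unfolding holomorphic_fun_on_def by blast

lemma holomorphic_fun_on_const: "holomorphic_fun_on \<Omega> (\<lambda>x. c)"
  unfolding holomorphic_fun_on_def by (intro ballI exI[of _ "\<lambda>v. 0"]) auto

lemma holomorphic_fun_on_component: "holomorphic_fun_on \<Omega> (\<lambda>x. x $ i)"
  unfolding holomorphic_fun_on_def
  by (intro ballI exI[of _ "\<lambda>v. v $ i"]) (auto intro: bounded_linear_imp_has_derivative)

lemma holomorphic_fun_on_add:
  assumes "holomorphic_fun_on \<Omega> g" "holomorphic_fun_on \<Omega> h"
  shows "holomorphic_fun_on \<Omega> (\<lambda>x. g x + h x)"
  unfolding holomorphic_fun_on_def
proof
  fix x assume "x \<in> \<Omega>"
  obtain D where D: "(g has_derivative D) (at x)" "\<And>c v. D (c *s v) = c * D v"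
    using holomorphic_fun_onE[OF assms(1) \<open>x \<in> \<Omega>\<close>] by blast
  obtain E where E: "(h has_derivative E) (at x)" "\<And>c v. E (c *s v) = c * E v"
    using holomorphic_fun_onE[OF assms(2) \<open>x \<in> \<Omega>\<close>] by blast
  show "\<exists>D. ((\<lambda>x. g x + h x) has_derivative D) (at x) \<and> (\<forall>c v. D (c *s v) = c * D v)"
    using D E by (intro exI[of _ "\<lambda>v. D v + E v"]) (auto intro!: derivative_intros simp: algebra_simps)
qed

lemma holomorphic_fun_on_mult:
  assumes "holomorphic_fun_on \<Omega> g" "holomorphic_fun_on \<Omega> h"
  shows "holomorphic_fun_on \<Omega> (\<lambda>x. g x * h x)"
  unfolding holomorphic_fun_on_def
proof
  fix x assume "x \<in> \<Omega>"
  obtain D where D: "(g has_derivative D) (at x)" "\<And>c v. D (c *s v) = c * D v"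
    using holomorphic_fun_onE[OF assms(1) \<open>x \<in> \<Omega>\<close>] by blast
  obtain E where E: "(h has_derivative E) (at x)" "\<And>c v. E (c *s v) = c * E v"
    using holomorphic_fun_onE[OF assms(2) \<open>x \<in> \<Omega>\<close>] by blast
  have "((\<lambda>x. g x * h x) has_derivative (\<lambda>v. g x * E v + D v * h x)) (at x)"
    by (rule has_derivative_mult[OF D(1) E(1)])
  then show "\<exists>D. ((\<lambda>x. g x * h x) has_derivative D) (at x) \<and> (\<forall>c v. D (c *s v) = c * D v)"
    using D E by (intro exI[of _ "\<lambda>v. g x * E v + D v * h x"]) (auto simp: algebra_simps)
qed

lemma holomorphic_fun_on_inverse:
  assumes "holomorphic_fun_on \<Omega> g" "\<And>x. x \<in> \<Omega> \<Longrightarrow> g x \<noteq> 0"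
  shows "holomorphic_fun_on \<Omega> (\<lambda>x. inverse (g x))"
  unfolding holomorphic_fun_on_def
proof
  fix x assume "x \<in> \<Omega>"
  obtain D where D: "(g has_derivative D) (at x)" "\<And>c v. D (c *s v) = c * D v"
    using holomorphic_fun_onE[OF assms(1) \<open>x \<in> \<Omega>\<close>] by blast
  have "((\<lambda>x. inverse (g x)) has_derivative (\<lambda>v. - (inverse (g x) * D v * inverse (g x)))) (at x)"
    by (rule Deriv.has_derivative_inverse[OF assms(2)[OF \<open>x \<in> \<Omega>\<close>] D(1)])
  then show "\<exists>D. ((\<lambda>x. inverse (g x)) has_derivative D) (at x) \<and> (\<forall>c v. D (c *s v) = c * D v)"
    using D by (intro exI[of _ "\<lambda>v. - (inverse (g x) * D v * inverse (g x))"]) auto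
qed

lemma holomorphic_fun_on_divide:
  assumes "holomorphic_fun_on \<Omega> g" "holomorphic_fun_on \<Omega> h" "\<And>x. x \<in> \<Omega> \<Longrightarrow> h x \<noteq> 0"
  shows "holomorphic_fun_on \<Omega> (\<lambda>x. g x / h x)"
  unfolding divide_inverse by (intro holomorphic_fun_on_mult holomorphic_fun_on_inverse assms)

lemma holomorphic_fun_on_sum:
  assumes "finite I" "\<And>i. i \<in> I \<Longrightarrow> holomorphic_fun_on \<Omega> (g i)"
  shows "holomorphic_fun_on \<Omega> (\<lambda>x. \<Sum>i\<in>I. g i x)"
  using assms
proof (induction I rule: finite_induct)
  case (insert i I)
  then show ?case using holomorphic_fun_on_add[of \<Omega> "g i" "\<lambda>x. \<Sum>i\<in>I. g i x"] by simp
qed (simp add: holomorphic_fun_on_const)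

lemma holomorphic_fun_on_compose_disc:
  assumes g: "holomorphic_fun_on \<Omega> g" and f: "holomorphic_disc \<Omega> f" and "cmod z < 1"
    and D: "(g has_derivative D) (at (f z))" "\<And>c v. D (c *s v) = c * D v"
  shows "((\<lambda>z. g (f z)) has_field_derivative D (disc_deriv f z)) (at z)"
proof -
  have "((\<lambda>z. g (f z)) has_derivative (\<lambda>\<xi>. D (\<xi> *s disc_deriv f z))) (at z)"
    by (rule has_derivative_compose[OF holomorphic_disc_has_derivative[OF f \<open>cmod z < 1\<close>] D(1)])
  moreover have "(\<lambda>\<xi>. D (\<xi> *s disc_deriv f z)) = (*) (D (disc_deriv f z))"
    by (simp add: fun_eq_iff D(2) mult.commute)
  ultimately show ?thesis
    unfolding has_field_derivative_def by simp
qed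

lemma holomorphic_fun_on_compose_disc_holomorphic:
  assumes g: "holomorphic_fun_on \<Omega> g" and f: "holomorphic_disc \<Omega> f"
  shows "(\<lambda>z. g (f z)) holomorphic_on ball 0 1"
proof -
  have "\<exists>d. ((\<lambda>z. g (f z)) has_field_derivative d) (at z)" if "z \<in> ball 0 1" for z
  proof -
    have "f z \<in> \<Omega>" using f that by (auto simp: holomorphic_disc_def)
    then obtain D where "(g has_derivative D) (at (f z))" "\<And>c v. D (c *s v) = c * D v"
      using holomorphic_fun_onE[OF g] by blast
    then show ?thesis using holomorphic_fun_on_compose_disc[OF g f] that by fastforce
  qed
  then show ?thesis
    by (simp add: holomorphic_on_open)
qed

lemma holomorphic_fun_on_imp_continuous_on:
  assumes "holomorphic_fun_on \<Omega> g"
  shows "continuous_on \<Omega> g"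
  using assms unfolding holomorphic_fun_on_def
  by (intro continuous_at_imp_continuous_on ballI) (meson has_derivative_continuous)

text \<open>Compose with the automorphism of the disc that moves \<open>h 0\<close> to \<open>0\<close> and apply the Schwarz lemma.\<close>

lemma Schwarz_Pick_at_0:
  assumes h: "h holomorphic_on ball 0 1" "\<And>z. cmod z < 1 \<Longrightarrow> cmod (h z) < 1"
    and h': "(h has_field_derivative h') (at 0)"
  shows "cmod h' \<le> 1 - (cmod (h 0))\<^sup>2"
proof -
  define w where "w = h 0"
  have w: "cmod w < 1" using h(2)[of 0] by (simp add: w_def)
  define M where "M = Moebius_function 0 w"
  have den: "1 - cnj w * w = of_real (1 - (cmod w)\<^sup>2)"
    using complex_norm_square[of w] by (simp add: mult.commute)
  have ne: "1 - (cmod w)\<^sup>2 > 0" "1 - cnj w * w \<noteq> 0"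
  proof -
    show "1 - (cmod w)\<^sup>2 > 0" using w by (simp add: abs_square_less_1)
    then show "1 - cnj w * w \<noteq> 0" unfolding den of_real_eq_0_iff by linarith
  qed
  have "((\<lambda>z. M (h z)) has_field_derivative (h' * (1 - cnj w * w) - (h 0 - w) * (- cnj w * h')) / (1 - cnj w * w)\<^sup>2) (at 0)"
    unfolding M_def Moebius_function_simple
    using h' ne(2) by (auto intro!: derivative_eq_intros simp: w_def power2_eq_square)
  then have der: "((\<lambda>z. M (h z)) has_field_derivative h' / (1 - cnj w * w)) (at 0)"
    using ne(2) by (simp add: w_def power2_eq_square)
  have "(M \<circ> h) holomorphic_on ball 0 1"
    using h Moebius_function_holomorphic[OF w] unfolding M_def
    by (intro holomorphic_on_compose_gen[of h _ _ "ball 0 1"]) auto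
  then have "norm (deriv (\<lambda>z. M (h z)) 0) \<le> 1"
    using Moebius_function_norm_lt_1[OF w] h(2) w
    by (intro Schwarz_Lemma(2)[of _ 0]) (auto simp: M_def o_def w_def Moebius_function_eq_zero)
  then have "cmod (h' / (1 - cnj w * w)) \<le> 1"
    using DERIV_imp_deriv[OF der] by simp
  then have "cmod h' / (1 - (cmod w)\<^sup>2) \<le> 1"
    using ne(1) unfolding den norm_divide norm_of_real by simp
  then show ?thesis using ne(1) by (simp add: w_def)
qed

section \<open>Lower bounds for the Kobayashi length\<close>

lemma kobayashi_metric_le:
  assumes "holomorphic_disc \<Omega> f"
  shows "kobayashi_metric \<Omega> (f 0) (\<xi> *s disc_deriv f 0) \<le> cmod \<xi>"
  unfolding kobayashi_metric_def
proof (rule cInf_lower)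
  have "frechet_derivative f (at 0) = (\<lambda>\<xi>. \<xi> *s disc_deriv f 0)"
    using frechet_derivative_at[OF holomorphic_disc_has_derivative[OF assms, of 0]] by simp
  then show "cmod \<xi> \<in> {cmod \<zeta> | \<zeta> h. holomorphic_disc \<Omega> h \<and> h 0 = f 0 \<and> frechet_derivative h (at 0) \<zeta> = \<xi> *s disc_deriv f 0}"
    using assms by (intro CollectI exI[of _ \<xi>] exI[of _ f]) simp
  show "bdd_below {cmod \<zeta> | \<zeta> h. holomorphic_disc \<Omega> h \<and> h 0 = f 0 \<and> frechet_derivative h (at 0) \<zeta> = \<xi> *s disc_deriv f 0}"
    by (rule bdd_belowI[of _ 0]) auto
qed

lemma affine_disc:
  fixes x v :: "complex ^ 'n"
  assumes "ball x e \<subseteq> \<Omega>" "norm v \<le> e" "e > 0"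
  shows "holomorphic_disc \<Omega> (\<lambda>z. x + z *s v)" "disc_deriv (\<lambda>z. x + z *s v) z = v"
proof -
  have "x + z *s v \<in> \<Omega>" if "cmod z < 1" for z
  proof (cases "v = 0")
    case True
    then show ?thesis using assms(1,3) by auto
  next
    case False
    then have "norm (z *s v) < norm v" using that by (simp add: norm_vector_scalar_mult)
    then show ?thesis using assms by (auto simp: subset_iff dist_norm)
  qed
  then show "holomorphic_disc \<Omega> (\<lambda>z. x + z *s v)"
    unfolding holomorphic_disc_def by (auto intro!: holomorphic_intros)
  show "disc_deriv (\<lambda>z. x + z *s v) z = v"
  proof -
    have "((\<lambda>z. x $ i + z * v $ i) has_field_derivative v $ i) (at z)" for i
      by (auto intro!: derivative_eq_intros)
    then show ?thesis by (simp add: disc_deriv_def vec_eq_iff DERIV_imp_deriv)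
  qed
qed

text \<open>The Schwarz-Pick lemma, applied to \<open>g \<circ> f\<close> for each competing disc \<open>f\<close>. Small affine discs show that
  there are competitors in every direction, so that the infimum is not a default value.\<close>

lemma kobayashi_metric_ge:
  assumes "open \<Omega>" "x \<in> \<Omega>" and g: "holomorphic_fun_on \<Omega> g" "\<And>y. y \<in> \<Omega> \<Longrightarrow> cmod (g y) < 1"
    and D: "(g has_derivative D) (at x)"
  shows "cmod (D v) \<le> kobayashi_metric \<Omega> x v * (1 - (cmod (g x))\<^sup>2)"
proof -
  have pos: "1 - (cmod (g x))\<^sup>2 > 0"
    using g(2)[OF \<open>x \<in> \<Omega>\<close>] by (simp add: abs_square_less_1)
  have Dlin: "D (c *s w) = c * D w" for c w
    using holomorphic_fun_onE[OF g(1) \<open>x \<in> \<Omega>\<close>] has_derivative_unique[OF D] by metis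
  obtain e where e: "e > 0" "ball x e \<subseteq> \<Omega>"
    using \<open>open \<Omega>\<close> \<open>x \<in> \<Omega>\<close> open_contains_ball by blast
  define s where "s = e / (norm v + 1)"
  have s: "s > 0" "s * norm v \<le> e"
  proof -
    have n: "norm v + 1 > 0" using norm_ge_zero[of v] by linarith
    then show "s > 0" using e(1) by (simp add: s_def)
    have "e * norm v \<le> e * (norm v + 1)" using e(1) by simp
    then show "s * norm v \<le> e" using n by (simp add: s_def divide_le_eq)
  qed
  define w where "w = of_real s *s v"
  have w: "norm w \<le> e" using s by (simp add: w_def norm_vector_scalar_mult)
  have "cmod (D v) / (1 - (cmod (g x))\<^sup>2) \<le> kobayashi_metric \<Omega> x v"
    unfolding kobayashi_metric_def
  proof (rule cInf_greatest)
    have "frechet_derivative (\<lambda>z. x + z *s w) (at 0) = (\<lambda>\<xi>. \<xi> *s w)"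
      using frechet_derivative_at[OF holomorphic_disc_has_derivative[OF affine_disc(1)[OF e(2) w e(1)], of 0]]
      by (simp add: affine_disc(2)[OF e(2) w e(1)])
    then have "frechet_derivative (\<lambda>z. x + z *s w) (at 0) (of_real (1 / s)) = v"
      using s(1) by (simp add: w_def vec_eq_iff)
    then show "{cmod \<xi> | \<xi> f. holomorphic_disc \<Omega> f \<and> f 0 = x \<and> frechet_derivative f (at 0) \<xi> = v} \<noteq> {}"
      using affine_disc(1)[OF e(2) w e(1)] by fastforce
  next
    fix r assume "r \<in> {cmod \<xi> | \<xi> f. holomorphic_disc \<Omega> f \<and> f 0 = x \<and> frechet_derivative f (at 0) \<xi> = v}"
    then obtain \<xi> f where f: "r = cmod \<xi>" "holomorphic_disc \<Omega> f" "f 0 = x" "frechet_derivative f (at 0) \<xi> = v"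
      by blast
    have v: "v = \<xi> *s disc_deriv f 0"
      using frechet_derivative_at[OF holomorphic_disc_has_derivative[OF f(2), of 0]] f(4)
      by (simp add: fun_eq_iff)
    have "((\<lambda>z. g (f z)) has_field_derivative D (disc_deriv f 0)) (at 0)"
      using holomorphic_fun_on_compose_disc[OF g(1) f(2), of 0 D] D Dlin f(3) by simp
    then have "cmod (D (disc_deriv f 0)) \<le> 1 - (cmod (g (f 0)))\<^sup>2"
      using holomorphic_disc_mem[OF f(2)] g(2)
      by (intro Schwarz_Pick_at_0[OF holomorphic_fun_on_compose_disc_holomorphic[OF g(1) f(2)]]) auto
    then have "cmod \<xi> * cmod (D (disc_deriv f 0)) \<le> cmod \<xi> * (1 - (cmod (g x))\<^sup>2)"
      unfolding f(3) by (intro mult_left_mono) auto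
    then show "cmod (D v) / (1 - (cmod (g x))\<^sup>2) \<le> r"
      using pos by (simp add: v Dlin norm_mult f(1) divide_le_eq)
  qed
  then show ?thesis using pos by (simp add: divide_le_eq)
qed

text \<open>Balls of some radius \<open>e\<close> around the points of \<open>K\<close> stay inside \<open>\<Omega>\<close>. For points closer than \<open>e\<close> apply
  the Schwarz lemma on the affine disc of radius \<open>e\<close> around \<open>x\<close> through \<open>y\<close>; for other points use
  \<open>|g x - g y| \<le> 2\<close>.\<close>

lemma bounded_holomorphic_lipschitz_on_compact:
  assumes "open \<Omega>" and g: "holomorphic_fun_on \<Omega> g" "\<And>y. y \<in> \<Omega> \<Longrightarrow> cmod (g y) < 1"
    and K: "compact K" "K \<subseteq> \<Omega>"
  obtains C where "\<And>x y. x \<in> K \<Longrightarrow> y \<in> K \<Longrightarrow> cmod (g x - g y) \<le> C * norm (x - y)"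
proof -
  obtain e where e: "e > 0" "(\<Union>x\<in>K. ball x e) \<subseteq> \<Omega>"
    using compact_subset_open_imp_ball_epsilon_subset[OF K(1) \<open>open \<Omega>\<close> K(2)] by blast
  have "cmod (g x - g y) \<le> 2 / e * norm (x - y)" if xy: "x \<in> K" "y \<in> K" for x y
  proof (cases "norm (x - y) < e \<and> x \<noteq> y")
    case False
    have "cmod (g x - g y) \<le> cmod (g x) + cmod (g y)" by (rule norm_triangle_ineq4)
    also have "\<dots> \<le> 2" using g(2)[of x] g(2)[of y] xy K(2) by force
    finally have "cmod (g x - g y) \<le> 2" .
    moreover have "2 \<le> 2 / e * norm (x - y)" if "norm (x - y) \<ge> e"
      using that e(1) by (simp add: field_simps)
    ultimately show ?thesis using False by fastforce
  next
    case True
    define r where "r = norm (x - y)"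
    define v where "v = of_real (e / r) *s (y - x)"
    have r: "0 < r" "r < e" using True by (auto simp: r_def)
    have v: "norm v \<le> e"
    proof -
      have "norm v = e / r * norm (y - x)"
        unfolding v_def norm_vector_scalar_mult norm_of_real using r e(1) by simp
      also have "norm (y - x) = r" by (simp add: r_def norm_minus_commute)
      finally show ?thesis using r by simp
    qed
    have ball: "ball x e \<subseteq> \<Omega>" using e(2) xy(1) by blast
    note f = affine_disc(1)[OF ball v e(1)]
    define h where "h z = (g (x + z *s v) - g x) / 2" for z
    have lt: "cmod (g (x + z *s v)) < 1" if "cmod z < 1" for z
      using holomorphic_disc_mem[OF f that] g(2) by blast
    have "cmod (h z) < 1" if "cmod z < 1" for z
      using norm_triangle_ineq4[of "g (x + z *s v)" "g x"] lt[OF that] lt[of 0]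
      by (simp add: h_def norm_divide)
    moreover have "h holomorphic_on ball 0 1"
      unfolding h_def by (intro holomorphic_intros holomorphic_fun_on_compose_disc_holomorphic[OF g(1) f]) auto
    moreover have "h 0 = 0" by (simp add: h_def)
    moreover have "cmod (of_real (r / e)) < 1" using r e(1) by (simp add: norm_divide)
    ultimately have "cmod (h (of_real (r / e))) \<le> cmod (of_real (r / e))"
      by (intro Schwarz_Lemma(1)) auto
    moreover have "x + of_real (r / e) *s v = y"
      using r e(1) by (simp add: v_def vec_eq_iff)
    ultimately have "cmod (g y - g x) / 2 \<le> r / e"
      using r e(1) by (simp add: h_def norm_divide)
    then show ?thesis using e(1) by (simp add: r_def field_simps norm_minus_commute)
  qed
  then show thesis using that by blast
qed

lemma artanh_lipschitz:
  assumes "\<bar>s\<bar> \<le> \<rho>" "\<bar>t\<bar> \<le> \<rho>" "\<rho> < (1::real)"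
  shows "\<bar>artanh s - artanh t\<bar> \<le> 1 / (1 - \<rho>\<^sup>2) * \<bar>s - t\<bar>"
proof -
  have "norm (artanh s - artanh t) \<le> 1 / (1 - \<rho>\<^sup>2) * norm (s - t)"
  proof (rule field_differentiable_bound[of "{-\<rho>..\<rho>}" artanh "\<lambda>x. 1 / (1 - x\<^sup>2)"])
    fix z assume z: "z \<in> {-\<rho>..\<rho>}"
    then have "\<bar>z\<bar> \<le> \<rho>" by auto
    then have z2: "z\<^sup>2 \<le> \<rho>\<^sup>2" by (metis abs_ge_zero power2_abs power_mono)
    have "0 \<le> \<rho>" using assms by linarith
    then have "\<rho>\<^sup>2 < 1" using assms(3) by (simp add: abs_square_less_1)
    then show "norm (1 / (1 - z\<^sup>2)) \<le> 1 / (1 - \<rho>\<^sup>2)"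
      using z2 by (simp add: frac_le)
    show "(artanh has_field_derivative 1 / (1 - z\<^sup>2)) (at z within {-\<rho>..\<rho>})"
      using \<open>\<bar>z\<bar> \<le> \<rho>\<close> assms(3) by (intro artanh_real_has_field_derivative) auto
  qed (use assms in auto)
  then show ?thesis by simp
qed

text \<open>Along \<open>\<sigma>\<close> the function \<open>u = artanh (Re g)\<close> moves with speed at most \<open>|(g \<circ> \<sigma>)'| / (1 - |g \<circ> \<sigma>|\<^sup>2)\<close>, because
  \<open>|Re g| \<le> |g|\<close>, and this is at most the Kobayashi speed of \<open>\<sigma>\<close>.\<close>

lemma kobayashi_length_ge:
  assumes "open \<Omega>" and g: "holomorphic_fun_on \<Omega> g" "\<And>y. y \<in> \<Omega> \<Longrightarrow> cmod (g y) < 1"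
    and "a \<le> b" and ac: "absolutely_continuous_curve a b \<sigma>" and \<sigma>: "\<sigma> \<in> {a..b} \<rightarrow> \<Omega>"
  shows "ennreal \<bar>artanh (Re (g (\<sigma> b))) - artanh (Re (g (\<sigma> a)))\<bar> \<le> kobayashi_length \<Omega> a b \<sigma>"
proof -
  define K where "K = \<sigma> ` {a..b}"
  have K: "compact K" "K \<subseteq> \<Omega>" "K \<noteq> {}"
    using absolutely_continuous_curve_continuous[OF ac] \<sigma> \<open>a \<le> b\<close>
    by (auto simp: K_def intro!: compact_continuous_image)
  obtain C where C: "\<And>x y. x \<in> K \<Longrightarrow> y \<in> K \<Longrightarrow> cmod (g x - g y) \<le> C * norm (x - y)"
    using bounded_holomorphic_lipschitz_on_compact[OF \<open>open \<Omega>\<close> g K(1,2)] by blast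
  have "continuous_on K (\<lambda>x. cmod (g x))"
    using holomorphic_fun_on_imp_continuous_on[OF g(1)] K(2)
    by (intro continuous_on_norm) (rule continuous_on_subset)
  then obtain x0 where x0: "x0 \<in> K" "\<And>x. x \<in> K \<Longrightarrow> cmod (g x) \<le> cmod (g x0)"
    using continuous_attains_sup[OF K(1,3)] by blast
  define \<rho> where "\<rho> = cmod (g x0)"
  have "\<rho> < 1" using x0(1) K(2) g(2) by (auto simp: \<rho>_def)
  have Re_le: "\<bar>Re (g x)\<bar> \<le> \<rho>" if "x \<in> K" for x
    using x0(2)[OF that] abs_Re_le_cmod[of "g x"] by (simp add: \<rho>_def)
  define u where "u t = artanh (Re (g (\<sigma> t)))" for t
  have ac_u: "absolutely_continuous_curve a b u"
  proof (rule absolutely_continuous_curve_dominated[OF ac])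
    fix s t assume "s \<in> {a..b}" "t \<in> {a..b}"
    then have st: "\<sigma> s \<in> K" "\<sigma> t \<in> K" by (auto simp: K_def)
    have "norm (u s - u t) \<le> 1 / (1 - \<rho>\<^sup>2) * \<bar>Re (g (\<sigma> s)) - Re (g (\<sigma> t))\<bar>"
      unfolding u_def real_norm_def using st Re_le \<open>\<rho> < 1\<close> by (intro artanh_lipschitz) auto
    also have "\<dots> \<le> 1 / (1 - \<rho>\<^sup>2) * (C * norm (\<sigma> s - \<sigma> t))"
    proof (rule mult_left_mono)
      show "\<bar>Re (g (\<sigma> s)) - Re (g (\<sigma> t))\<bar> \<le> C * norm (\<sigma> s - \<sigma> t)"
        using C[OF st] abs_Re_le_cmod[of "g (\<sigma> s) - g (\<sigma> t)"] by simp
      show "0 \<le> 1 / (1 - \<rho>\<^sup>2)"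
        using \<open>\<rho> < 1\<close> by (simp add: \<rho>_def abs_square_le_1)
    qed
    finally show "norm (u s - u t) \<le> (1 / (1 - \<rho>\<^sup>2) * C) * norm (\<sigma> s - \<sigma> t)" by simp
  qed
  obtain N where N: "negligible N" "\<And>x. x \<in> {a..b} - N \<Longrightarrow> \<sigma> differentiable (at x within {a..b})"
    using absolutely_continuous_curve_differentiable_ae[OF ac] by blast
  have "\<exists>d. (u has_vector_derivative d) (at t within {a..b}) \<and>
      \<bar>d\<bar> \<le> kobayashi_metric \<Omega> (\<sigma> t) (vector_derivative \<sigma> (at t within {a..b}))" if t: "t \<in> {a..b} - N" for t
  proof -
    define v where "v = vector_derivative \<sigma> (at t within {a..b})"
    have v: "(\<sigma> has_vector_derivative v) (at t within {a..b})"
      unfolding v_def using N(2)[OF t] vector_derivative_works by blast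
    have \<sigma>t: "\<sigma> t \<in> \<Omega>" using \<sigma> t by auto
    obtain D where D: "(g has_derivative D) (at (\<sigma> t))" "\<And>c v. D (c *s v) = c * D v"
      using holomorphic_fun_onE[OF g(1) \<sigma>t] by blast
    have "((\<lambda>t. g (\<sigma> t)) has_vector_derivative D v) (at t within {a..b})"
      unfolding has_vector_derivative_def
      using has_derivative_compose[OF v[unfolded has_vector_derivative_def] D(1)]
        linear_scale[OF has_derivative_linear[OF D(1)]] by simp
    then have "((\<lambda>t. Re (g (\<sigma> t))) has_vector_derivative Re (D v)) (at t within {a..b})"
      by (rule bounded_linear.has_vector_derivative[OF bounded_linear_Re])
    then have reder: "((\<lambda>t. Re (g (\<sigma> t))) has_field_derivative Re (D v)) (at t within {a..b})"
      by (simp add: has_real_derivative_iff_has_vector_derivative)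
    have R1: "\<bar>Re (g (\<sigma> t))\<bar> < 1"
      using g(2)[OF \<sigma>t] abs_Re_le_cmod[of "g (\<sigma> t)"] by linarith
    have "(u has_field_derivative (1 / (1 - (Re (g (\<sigma> t)))\<^sup>2) * Re (D v))) (at t within {a..b})"
      unfolding u_def using DERIV_chain2[OF artanh_real_has_field_derivative[OF R1] reder] .
    then have uder: "(u has_vector_derivative (1 / (1 - (Re (g (\<sigma> t)))\<^sup>2) * Re (D v))) (at t within {a..b})"
      by (simp add: has_real_derivative_iff_has_vector_derivative)
    have pos: "1 - (cmod (g (\<sigma> t)))\<^sup>2 > 0"
      using g(2)[OF \<sigma>t] by (simp add: abs_square_less_1)
    have le: "1 - (cmod (g (\<sigma> t)))\<^sup>2 \<le> 1 - (Re (g (\<sigma> t)))\<^sup>2"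
      by (simp add: cmod_power2)
    have "\<bar>1 / (1 - (Re (g (\<sigma> t)))\<^sup>2) * Re (D v)\<bar> = \<bar>Re (D v)\<bar> / (1 - (Re (g (\<sigma> t)))\<^sup>2)"
      using pos le by (simp add: abs_mult)
    also have "\<dots> \<le> cmod (D v) / (1 - (cmod (g (\<sigma> t)))\<^sup>2)"
      using pos le abs_Re_le_cmod by (intro frac_le) auto
    also have "\<dots> \<le> kobayashi_metric \<Omega> (\<sigma> t) v"
      using kobayashi_metric_ge[OF \<open>open \<Omega>\<close> \<sigma>t g D(1), of v] pos by (simp add: divide_le_eq)
    finally show ?thesis using uder unfolding v_def by blast
  qed
  then obtain u' where u': "\<And>t. t \<in> {a..b} - N \<Longrightarrow> (u has_vector_derivative u' t) (at t within {a..b})"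
    "\<And>t. t \<in> {a..b} - N \<Longrightarrow> \<bar>u' t\<bar> \<le> kobayashi_metric \<Omega> (\<sigma> t) (vector_derivative \<sigma> (at t within {a..b}))"
    by metis
  show ?thesis
    using absolutely_continuous_diff_le_nn_integral[OF ac_u \<open>a \<le> b\<close> N(1) u'] unfolding kobayashi_length_def u_def
    by simp
qed

section \<open>Extremal discs and geodesics\<close>

text \<open>The infimum of the lengths as an extended number: here the absence of curves of finite length gives
  \<open>\<infinity>\<close>, not \<open>0\<close>.\<close>

definition kobayashi_edistance :: "(complex ^ 'n) set \<Rightarrow> complex ^ 'n \<Rightarrow> complex ^ 'n \<Rightarrow> ennreal" where
  "kobayashi_edistance \<Omega> x y = Inf {kobayashi_length \<Omega> a b \<sigma> | a b \<sigma>.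
       a \<le> b \<and> absolutely_continuous_curve a b \<sigma> \<and> \<sigma> \<in> {a..b} \<rightarrow> \<Omega> \<and> \<sigma> a = x \<and> \<sigma> b = y}"

lemma kobayashi_distance_eq: "kobayashi_distance \<Omega> x y = enn2real (kobayashi_edistance \<Omega> x y)"
  by (simp add: kobayashi_distance_def kobayashi_edistance_def)

text \<open>A metric space in the sense of \<^locale>\<open>Metric_space\<close> has a distance that is symmetric on the whole type,
  so its values at points outside the domain matter: no curve ends there, and the infimum is infinite.\<close>

lemma kobayashi_distance_outside:
  assumes "x \<notin> \<Omega>"
  shows "kobayashi_distance \<Omega> x y = 0" "kobayashi_distance \<Omega> y x = 0"
proof -
  have "kobayashi_edistance \<Omega> x y = Inf {}" "kobayashi_edistance \<Omega> y x = Inf {}"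
    unfolding kobayashi_edistance_def using assms by (auto intro!: arg_cong[of _ _ Inf])
  then show "kobayashi_distance \<Omega> x y = 0" "kobayashi_distance \<Omega> y x = 0"
    by (simp_all add: kobayashi_distance_eq)
qed

lemma kobayashi_edistance_ge:
  assumes "open \<Omega>" and g: "holomorphic_fun_on \<Omega> g" "\<And>y. y \<in> \<Omega> \<Longrightarrow> cmod (g y) < 1"
  shows "ennreal \<bar>artanh (Re (g y)) - artanh (Re (g x))\<bar> \<le> kobayashi_edistance \<Omega> x y"
  unfolding kobayashi_edistance_def
proof (rule Inf_greatest)
  fix l assume "l \<in> {kobayashi_length \<Omega> a b \<sigma> | a b \<sigma>.
       a \<le> b \<and> absolutely_continuous_curve a b \<sigma> \<and> \<sigma> \<in> {a..b} \<rightarrow> \<Omega> \<and> \<sigma> a = x \<and> \<sigma> b = y}"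
  then obtain a b \<sigma> where s: "l = kobayashi_length \<Omega> a b \<sigma>" "a \<le> b" "absolutely_continuous_curve a b \<sigma>"
    "\<sigma> \<in> {a..b} \<rightarrow> \<Omega>" "\<sigma> a = x" "\<sigma> b = y" by blast
  show "ennreal \<bar>artanh (Re (g y)) - artanh (Re (g x))\<bar> \<le> l"
    using kobayashi_length_ge[OF assms s(2,3,4)] s by simp
qed

lemma absolutely_continuous_curve_id: "absolutely_continuous_curve a b (\<lambda>t. t)"
  unfolding absolutely_continuous_curve_def
proof (intro allI impI)
  fix \<epsilon> :: real assume "\<epsilon> > 0"
  show "\<exists>\<delta>>0. \<forall>D. D division_of \<Union>D \<and> \<Union>D \<subseteq> {a..b} \<and> (\<Sum>k\<in>D. Sup k - Inf k) < \<delta> \<longrightarrow>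
        (\<Sum>k\<in>D. norm (Sup k - Inf k)) < \<epsilon>"
  proof (intro exI[of _ \<epsilon>] conjI allI impI \<open>\<epsilon> > 0\<close>)
    fix D assume D: "D division_of \<Union>D \<and> \<Union>D \<subseteq> {a..b} \<and> (\<Sum>k\<in>D. Sup k - Inf k) < \<epsilon>"
    have "norm (Sup k - Inf k) = Sup k - Inf k" if "k \<in> D" for k
    proof -
      obtain u v where "k = cbox u v" "k \<noteq> {}"
        using D \<open>k \<in> D\<close> by (metis division_ofD(3,4))
      then show ?thesis by auto
    qed
    then show "(\<Sum>k\<in>D. norm (Sup k - Inf k)) < \<epsilon>" using D by simp
  qed
qed

text \<open>The real diameter of the disc, parametrised by hyperbolic arc length.\<close>

definition disc_curve :: "(complex \<Rightarrow> complex ^ 'n) \<Rightarrow> real \<Rightarrow> complex ^ 'n" where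
  "disc_curve f \<tau> = f (of_real (tanh \<tau>))"

lemma disc_curve_mem: "holomorphic_disc \<Omega> f \<Longrightarrow> disc_curve f \<tau> \<in> \<Omega>"
  unfolding disc_curve_def using tanh_real_bounds[of \<tau>] by (intro holomorphic_disc_mem) auto

lemma disc_curve_has_vector_derivative:
  assumes "holomorphic_disc \<Omega> f"
  shows "(disc_curve f has_vector_derivative (of_real (1 - (tanh \<tau>)\<^sup>2) *s disc_deriv f (of_real (tanh \<tau>)))) (at \<tau>)"
proof -
  have "((\<lambda>\<tau>. complex_of_real (tanh \<tau>)) has_vector_derivative of_real (1 - (tanh \<tau>)\<^sup>2)) (at \<tau>)"
    by (intro has_vector_derivative_of_real) (auto intro!: derivative_eq_intros simp flip: has_real_derivative_iff_has_vector_derivative)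
  moreover have "cmod (of_real (tanh \<tau>)) < 1" using tanh_real_bounds[of \<tau>] by auto
  ultimately have "((\<lambda>\<tau>. f (of_real (tanh \<tau>))) has_derivative
      (\<lambda>h. (h *\<^sub>R of_real (1 - (tanh \<tau>)\<^sup>2)) *s disc_deriv f (of_real (tanh \<tau>)))) (at \<tau>)"
    unfolding has_vector_derivative_def
    using has_derivative_compose[OF _ holomorphic_disc_has_derivative[OF assms]] by blast
  moreover have "(\<lambda>h. (h *\<^sub>R complex_of_real (1 - (tanh \<tau>)\<^sup>2)) *s disc_deriv f (of_real (tanh \<tau>)))
     = (\<lambda>h. h *\<^sub>R (of_real (1 - (tanh \<tau>)\<^sup>2) *s disc_deriv f (of_real (tanh \<tau>))))"
    by (simp add: fun_eq_iff vec_eq_iff del: of_real_diff of_real_power)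
  ultimately show ?thesis
    by (simp add: has_vector_derivative_def disc_curve_def[abs_def])
qed

lemma disc_curve_absolutely_continuous:
  assumes "holomorphic_disc \<Omega> f"
  shows "absolutely_continuous_curve s t (disc_curve f)"
proof -
  define d where "d \<tau> = complex_of_real (1 - (tanh \<tau>)\<^sup>2) *s disc_deriv f (of_real (tanh \<tau>))" for \<tau>
  have "continuous_on UNIV d"
  proof -
    have "continuous_on UNIV (\<lambda>\<tau>. deriv (\<lambda>z. f z $ i) (of_real (tanh \<tau>)))" for i
    proof (rule continuous_on_compose2[of "ball 0 1" "deriv (\<lambda>z. f z $ i)"])
      have "(\<lambda>z. f z $ i) holomorphic_on ball 0 1" using assms by (simp add: holomorphic_disc_def)
      then show "continuous_on (ball 0 1) (deriv (\<lambda>z. f z $ i))"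
        by (intro holomorphic_on_imp_continuous_on holomorphic_deriv) auto
      show "continuous_on UNIV (\<lambda>\<tau>. complex_of_real (tanh \<tau>))"
        by (intro continuous_intros) auto
      show "range (\<lambda>\<tau>. complex_of_real (tanh \<tau>)) \<subseteq> ball 0 1"
        using tanh_real_bounds by (auto simp: abs_less_iff minus_less_iff)
    qed
    then show ?thesis
      unfolding d_def disc_deriv_def vector_scalar_mult_def
      by (intro continuous_on_vec_lambda) (auto intro!: continuous_intros)
  qed
  then have "continuous_on {s..t} d" by (rule continuous_on_subset) auto
  then have "bounded (d ` {s..t})"
    by (intro compact_imp_bounded compact_continuous_image) auto
  then obtain C where C: "\<And>\<tau>. \<tau> \<in> {s..t} \<Longrightarrow> norm (d \<tau>) \<le> C"
    unfolding bounded_iff by blast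
  show ?thesis
  proof (rule absolutely_continuous_curve_dominated[OF absolutely_continuous_curve_id])
    fix x y assume xy: "x \<in> {s..t}" "y \<in> {s..t}"
    show "norm (disc_curve f x - disc_curve f y) \<le> C * norm (x - y)"
    proof (rule differentiable_bound[of "{s..t}" _ "\<lambda>\<tau> h. h *\<^sub>R d \<tau>"])
      fix \<tau> assume \<tau>: "\<tau> \<in> {s..t}"
      show "(disc_curve f has_derivative (\<lambda>h. h *\<^sub>R d \<tau>)) (at \<tau> within {s..t})"
        using disc_curve_has_vector_derivative[OF assms, of \<tau>]
        unfolding has_vector_derivative_def d_def by (rule has_derivative_at_withinI)
      show "onorm (\<lambda>h. h *\<^sub>R d \<tau>) \<le> C"
      proof (rule onorm_le)
        fix h :: real
        show "norm (h *\<^sub>R d \<tau>) \<le> C * norm h"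
          using mult_right_mono[OF C[OF \<tau>], of "\<bar>h\<bar>"] by (simp add: mult.commute)
      qed
    qed (use xy in auto)
  qed
qed

text \<open>Precompose \<open>f\<close> with the automorphism of the disc that moves \<open>0\<close> to \<open>tanh \<tau>\<close>; its derivative at \<open>0\<close> is
  \<open>1 - (tanh \<tau>)\<^sup>2\<close>.\<close>

lemma kobayashi_metric_disc_curve:
  assumes "holomorphic_disc \<Omega> f"
  shows "kobayashi_metric \<Omega> (disc_curve f \<tau>) (of_real (1 - (tanh \<tau>)\<^sup>2) *s disc_deriv f (of_real (tanh \<tau>))) \<le> 1"
proof -
  define r where "r = complex_of_real (tanh \<tau>)"
  have r: "cmod (- r) < 1" "cmod r < 1" using tanh_real_bounds[of \<tau>] by (auto simp: r_def)
  define m where "m = Moebius_function 0 (- r)"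
  have m0: "m 0 = r" by (simp add: m_def Moebius_function_of_zero)
  have disc: "holomorphic_disc \<Omega> (\<lambda>z. f (m z))"
    unfolding m_def
    by (intro holomorphic_disc_compose[OF assms] Moebius_function_holomorphic Moebius_function_norm_lt_1 r)
  have m': "(m has_field_derivative (1 - r\<^sup>2)) (at 0)"
    unfolding m_def Moebius_function_simple
    by (auto intro!: derivative_eq_intros simp: r_def power2_eq_square)
  have "((\<lambda>z. f (m z) $ i) has_field_derivative (disc_deriv f r $ i * (1 - r\<^sup>2))) (at 0)" for i
  proof (rule DERIV_chain2[OF _ m'])
    have "(\<lambda>z. f z $ i) holomorphic_on ball 0 1" using assms by (simp add: holomorphic_disc_def)
    then show "((\<lambda>z. f z $ i) has_field_derivative disc_deriv f r $ i) (at (m 0))"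
      using r(2) by (simp add: disc_deriv_def m0 holomorphic_derivI)
  qed
  then have "deriv (\<lambda>z. f (m z) $ i) 0 = disc_deriv f r $ i * (1 - r\<^sup>2)" for i
    by (rule DERIV_imp_deriv)
  then have "disc_deriv (\<lambda>z. f (m z)) 0 = (1 - r\<^sup>2) *s disc_deriv f r"
    by (simp add: disc_deriv_def[of "\<lambda>z. f (m z)"] vec_eq_iff algebra_simps)
  then show ?thesis
    using kobayashi_metric_le[OF disc, of 1] by (simp add: m0 disc_curve_def r_def)
qed

lemma kobayashi_edistance_disc_le_ordered:
  assumes f: "holomorphic_disc \<Omega> f" and "s \<le> t"
  shows "kobayashi_edistance \<Omega> (disc_curve f s) (disc_curve f t) \<le> ennreal (t - s)"
proof -
  have "kobayashi_edistance \<Omega> (disc_curve f s) (disc_curve f t) \<le> kobayashi_length \<Omega> s t (disc_curve f)"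
    unfolding kobayashi_edistance_def
  proof (rule Inf_lower)
    have "disc_curve f \<in> {s..t} \<rightarrow> \<Omega>"
      using disc_curve_mem[OF f] by auto
    then show "kobayashi_length \<Omega> s t (disc_curve f) \<in> {kobayashi_length \<Omega> a b \<sigma> | a b \<sigma>.
       a \<le> b \<and> absolutely_continuous_curve a b \<sigma> \<and> \<sigma> \<in> {a..b} \<rightarrow> \<Omega> \<and> \<sigma> a = disc_curve f s \<and> \<sigma> b = disc_curve f t}"
      using \<open>s \<le> t\<close> disc_curve_absolutely_continuous[OF f] by blast
  qed
  also have "\<dots> \<le> ennreal (t - s)"
  proof (cases "s < t")
    case True
    have "kobayashi_length \<Omega> s t (disc_curve f) \<le> (\<integral>\<^sup>+ \<tau>. 1 \<partial>lebesgue_on {s..t})"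
      unfolding kobayashi_length_def
    proof (rule nn_integral_mono)
      fix \<tau> assume "\<tau> \<in> space (lebesgue_on {s..t})"
      then have \<tau>: "s \<le> \<tau>" "\<tau> \<le> t" by auto
      have "vector_derivative (disc_curve f) (at \<tau> within {s..t})
          = of_real (1 - (tanh \<tau>)\<^sup>2) *s disc_deriv f (of_real (tanh \<tau>))"
        by (rule vector_derivative_at_within_ivl[OF disc_curve_has_vector_derivative[OF f] \<tau> True])
      then show "ennreal (kobayashi_metric \<Omega> (disc_curve f \<tau>) (vector_derivative (disc_curve f) (at \<tau> within {s..t}))) \<le> 1"
        using kobayashi_metric_disc_curve[OF f, of \<tau>] ennreal_leI by fastforce
    qed
    also have "\<dots> = ennreal (t - s)"
      using True by (simp add: emeasure_restrict_space)
    finally show ?thesis .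
  next
    case False
    \<comment> \<open>Within a one-point interval the derivative is a default value, but that interval is null.\<close>
    then have "s = t" using \<open>s \<le> t\<close> by simp
    have "AE \<tau> in lebesgue_on {s..t}. \<tau> \<noteq> s"
      by (rule AE_I[of _ _ "{s}"]) (auto simp: emeasure_restrict_space \<open>s = t\<close>)
    then have "AE \<tau> in lebesgue_on {s..t}. ennreal (kobayashi_metric \<Omega> (disc_curve f \<tau>) (vector_derivative (disc_curve f) (at \<tau> within {s..t}))) \<le> 0"
      by (rule AE_mp) (auto simp: \<open>s = t\<close>)
    then have "kobayashi_length \<Omega> s t (disc_curve f) \<le> (\<integral>\<^sup>+ \<tau>. 0 \<partial>lebesgue_on {s..t})"
      unfolding kobayashi_length_def by (rule nn_integral_mono_AE)
    then show ?thesis by simp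
  qed
  finally show ?thesis .
qed

lemma kobayashi_edistance_disc_le:
  assumes f: "holomorphic_disc \<Omega> f"
  shows "kobayashi_edistance \<Omega> (disc_curve f s) (disc_curve f t) \<le> ennreal \<bar>s - t\<bar>"
proof (cases "s \<le> t")
  case True
  then have "\<bar>s - t\<bar> = t - s" by simp
  then show ?thesis using kobayashi_edistance_disc_le_ordered[OF f True] by simp
next
  case False
  have "holomorphic_disc \<Omega> (\<lambda>z. f (- z))"
    by (intro holomorphic_disc_compose[OF f]) (auto intro!: holomorphic_intros)
  then have "kobayashi_edistance \<Omega> (disc_curve (\<lambda>z. f (- z)) (- s)) (disc_curve (\<lambda>z. f (- z)) (- t)) \<le> ennreal (s - t)"
    using kobayashi_edistance_disc_le_ordered[of \<Omega> "\<lambda>z. f (- z)" "- s" "- t"] False by simp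
  then show ?thesis using False by (simp add: disc_curve_def)
qed

text \<open>The disc \<open>f\<close> bounds the distance of \<open>x\<close> and \<open>y\<close> from above and the function \<open>g\<close> bounds it from below,
  both by \<open>l\<close>.\<close>

definition extremal_disc :: "(complex ^ 'n) set \<Rightarrow> complex ^ 'n \<Rightarrow> complex ^ 'n \<Rightarrow> real \<Rightarrow> (complex \<Rightarrow> complex ^ 'n) \<Rightarrow> (complex ^ 'n \<Rightarrow> complex) \<Rightarrow> bool" where
  "extremal_disc \<Omega> x y l f g \<longleftrightarrow>
     holomorphic_disc \<Omega> f \<and> holomorphic_fun_on \<Omega> g \<and> (\<forall>z\<in>\<Omega>. cmod (g z) < 1) \<and> l \<ge> 0 \<and>
     disc_curve f 0 = x \<and> disc_curve f l = y \<and> g x = 0 \<and> g y = of_real (tanh l)"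

lemma kobayashi_distance_extremal_disc:
  assumes "open \<Omega>" and e: "extremal_disc \<Omega> x y l f g"
  shows "kobayashi_distance \<Omega> x y = l" "kobayashi_distance \<Omega> y x = l"
    "kobayashi_edistance \<Omega> x y < \<infinity>"
proof -
  note e = e[unfolded extremal_disc_def]
  have up: "kobayashi_edistance \<Omega> x y \<le> ennreal l" "kobayashi_edistance \<Omega> y x \<le> ennreal l"
    using kobayashi_edistance_disc_le[of \<Omega> f 0 l] kobayashi_edistance_disc_le[of \<Omega> f l 0] e by auto
  have lo: "ennreal l \<le> kobayashi_edistance \<Omega> x y" "ennreal l \<le> kobayashi_edistance \<Omega> y x"
    using kobayashi_edistance_ge[OF \<open>open \<Omega>\<close>, of g y x] kobayashi_edistance_ge[OF \<open>open \<Omega>\<close>, of g x y] e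
    by (auto simp: artanh_tanh_real)
  have eq: "kobayashi_edistance \<Omega> x y = ennreal l" "kobayashi_edistance \<Omega> y x = ennreal l"
    using up lo by auto
  show "kobayashi_distance \<Omega> x y = l" "kobayashi_distance \<Omega> y x = l" "kobayashi_edistance \<Omega> x y < \<infinity>"
    using e by (simp_all add: kobayashi_distance_eq eq)
qed

text \<open>For every holomorphic \<open>g\<close> into the disc, \<open>artanh (Re g)\<close> is 1-Lipschitz for the distance; taking \<open>g\<close>
  extremal for \<open>x\<close> and \<open>z\<close> gives the triangle inequality. On the curve of an extremal disc, each of three
  consecutive parts is at most as long as its parameter interval while the total is \<open>l\<close>, so all three
  are equalities.\<close>

theorem kobayashi_distance_geodesic_metric_space:
  assumes "open \<Omega>" and ex: "\<And>x y. x \<in> \<Omega> \<Longrightarrow> y \<in> \<Omega> \<Longrightarrow> \<exists>l f g. extremal_disc \<Omega> x y l f g"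
  shows "geodesic_metric_space \<Omega> (kobayashi_distance \<Omega>)"
proof -
  let ?d = "kobayashi_distance \<Omega>"
  have finite: "kobayashi_edistance \<Omega> x y < \<infinity>" if "x \<in> \<Omega>" "y \<in> \<Omega>" for x y
    using ex[OF that] kobayashi_distance_extremal_disc(3)[OF \<open>open \<Omega>\<close>] by blast
  have ge: "\<bar>artanh (Re (g y)) - artanh (Re (g x))\<bar> \<le> ?d x y"
    if "x \<in> \<Omega>" "y \<in> \<Omega>" "holomorphic_fun_on \<Omega> g" "\<forall>z\<in>\<Omega>. cmod (g z) < 1" for g x y
  proof -
    have "ennreal \<bar>artanh (Re (g y)) - artanh (Re (g x))\<bar> \<le> ennreal (?d x y)"
      using kobayashi_edistance_ge[OF \<open>open \<Omega>\<close> that(3), of y x] that(4) finite[OF that(1,2)]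
      by (simp add: kobayashi_distance_eq)
    then show ?thesis by (subst (asm) ennreal_le_iff) (simp_all add: kobayashi_distance_eq)
  qed
  have tri: "?d x z \<le> ?d x y + ?d y z" if xyz: "x \<in> \<Omega>" "y \<in> \<Omega>" "z \<in> \<Omega>" for x y z
  proof -
    obtain l f g where e: "extremal_disc \<Omega> x z l f g" using ex xyz by blast
    note e' = e[unfolded extremal_disc_def]
    have "?d x z = artanh (Re (g z)) - artanh (Re (g x))"
      using kobayashi_distance_extremal_disc(1)[OF \<open>open \<Omega>\<close> e] e' by (simp add: artanh_tanh_real)
    also have "\<dots> \<le> ?d x y + ?d y z"
      using ge[OF xyz(1,2), of g] ge[OF xyz(2,3), of g] e' by force
    finally show ?thesis .
  qed
  have sym: "?d x y = ?d y x" if "x \<in> \<Omega>" "y \<in> \<Omega>" for x y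
    using ex[OF that] kobayashi_distance_extremal_disc(1,2)[OF \<open>open \<Omega>\<close>] by metis
  have zero: "?d x y = 0 \<longleftrightarrow> x = y" if xy: "x \<in> \<Omega>" "y \<in> \<Omega>" for x y
  proof
    obtain l f g where e: "extremal_disc \<Omega> x y l f g" using ex xy by blast
    note e' = e[unfolded extremal_disc_def] and d = kobayashi_distance_extremal_disc(1)[OF \<open>open \<Omega>\<close> e]
    show "x = y" if "?d x y = 0" using that e' d by auto
    show "?d x y = 0" if "x = y"
    proof -
      have "complex_of_real (tanh l) = 0" using that e' by metis
      then show ?thesis using d by simp
    qed
  qed
  have metric: "Metric_space \<Omega> ?d"
  proof
    show "0 \<le> ?d x y" for x y by (simp add: kobayashi_distance_eq)
    show "?d x y = ?d y x" for x y
      using sym[of x y] kobayashi_distance_outside[of x \<Omega>] kobayashi_distance_outside[of y \<Omega>] by metis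
  qed (use tri zero in auto)
  have "\<exists>S. geodesic_segment \<Omega> ?d x y S" if xy: "x \<in> \<Omega>" "y \<in> \<Omega>" for x y
  proof -
    obtain l f g where e: "extremal_disc \<Omega> x y l f g" using ex xy by blast
    note e' = e[unfolded extremal_disc_def]
    let ?c = "disc_curve f"
    have c: "?c t \<in> \<Omega>" for t
      using e' disc_curve_mem by blast
    have le: "?d (?c s) (?c t) \<le> \<bar>s - t\<bar>" for s t
    proof -
      have "ennreal (?d (?c s) (?c t)) \<le> ennreal \<bar>s - t\<bar>"
        using kobayashi_edistance_disc_le[of \<Omega> f s t] e' finite[OF c c, of s t] by (simp add: kobayashi_distance_eq)
      then show ?thesis by simp
    qed
    have eq: "?d (?c s) (?c t) = t - s" if st: "0 \<le> s" "s \<le> t" "t \<le> l" for s t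
    proof -
      have "l = ?d (?c 0) (?c l)"
        using kobayashi_distance_extremal_disc(1)[OF \<open>open \<Omega>\<close> e] e' by simp
      also have "\<dots> \<le> ?d (?c 0) (?c s) + ?d (?c s) (?c t) + ?d (?c t) (?c l)"
        using tri[OF c[of 0] c[of s] c[of l]] tri[OF c[of s] c[of t] c[of l]] by linarith
      finally have "t - s \<le> ?d (?c s) (?c t)" using le[of 0 s] le[of t l] st by linarith
      then show ?thesis using le[of s t] st by linarith
    qed
    have "?d (?c s) (?c t) = \<bar>s - t\<bar>" if "s \<in> {0..l}" "t \<in> {0..l}" for s t
    proof (cases "s \<le> t")
      case True
      then show ?thesis using eq[of s t] that by auto
    next
      case False
      then show ?thesis using eq[of t s] that sym[OF c c, of s t] by auto
    qed
    then have "geodesic \<Omega> ?d {0..l} ?c"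
      unfolding geodesic_def using c by (auto simp: is_interval_cc)
    then have "geodesic_segment \<Omega> ?d x y (?c ` {0..l})"
      unfolding geodesic_segment_def using e' by blast
    then show ?thesis by blast
  qed
  then show ?thesis unfolding geodesic_metric_space_def using metric by blast
qed

section \<open>The four-point condition\<close>

definition four_point :: "'a set \<Rightarrow> ('a \<Rightarrow> 'a \<Rightarrow> real) \<Rightarrow> real \<Rightarrow> bool" where
  "four_point X d c \<longleftrightarrow> (\<forall>x\<in>X. \<forall>y\<in>X. \<forall>z\<in>X. \<forall>w\<in>X.
     d x y + d z w \<le> max (d x z + d y w) (d x w + d y z) + c)"

lemma geodesic_segment_mem:
  assumes "geodesic_segment X d x y S" "p \<in> S"
  shows "p \<in> X" "d x p + d p y = d x y" "0 \<le> d x p" "0 \<le> d p y"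
proof -
  obtain a b \<sigma> where s: "a \<le> b" "geodesic X d {a..b} \<sigma>" "\<sigma> a = x" "\<sigma> b = y" "S = \<sigma> ` {a..b}"
    using assms(1) unfolding geodesic_segment_def by blast
  obtain t where t: "t \<in> {a..b}" "p = \<sigma> t" using assms(2) s(5) by blast
  have ds: "d (\<sigma> u) (\<sigma> v) = \<bar>u - v\<bar>" if "u \<in> {a..b}" "v \<in> {a..b}" for u v
    using s(2) that unfolding geodesic_def by blast
  show "p \<in> X" using s(2) t unfolding geodesic_def by blast
  show "d x p + d p y = d x y" "0 \<le> d x p" "0 \<le> d p y"
    using ds[of a t] ds[of t b] ds[of a b] s(1,3,4) t by auto
qed

lemma geodesic_segment_point_at:
  assumes "geodesic_segment X d x y S" "0 \<le> r" "r \<le> d x y"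
  obtains q where "q \<in> S" "d x q = r"
proof -
  obtain a b \<sigma> where s: "a \<le> b" "geodesic X d {a..b} \<sigma>" "\<sigma> a = x" "\<sigma> b = y" "S = \<sigma> ` {a..b}"
    using assms(1) unfolding geodesic_segment_def by blast
  have ds: "d (\<sigma> u) (\<sigma> v) = \<bar>u - v\<bar>" if "u \<in> {a..b}" "v \<in> {a..b}" for u v
    using s(2) that unfolding geodesic_def by blast
  have "a + r \<in> {a..b}" using ds[of a b] s(1,3,4) assms(2,3) by auto
  then show thesis
    using that[of "\<sigma> (a + r)"] ds[of a "a + r"] s(1,3,5) assms(2) by auto
qed

lemma geodesic_segment_reverse:
  assumes "geodesic_segment X d x y S"
  shows "geodesic_segment X d y x S"
proof -
  obtain a b \<sigma> where s: "a \<le> b" "geodesic X d {a..b} \<sigma>" "\<sigma> a = x" "\<sigma> b = y" "S = \<sigma> ` {a..b}"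
    using assms(1) unfolding geodesic_segment_def by blast
  have "geodesic X d {a..b} (\<lambda>t. \<sigma> (a + b - t))"
    unfolding geodesic_def
  proof (intro conjI ballI)
    show "is_interval {a..b}" by (rule is_interval_cc)
    show "(\<lambda>t. \<sigma> (a + b - t)) \<in> {a..b} \<rightarrow> X"
      using s(2) unfolding geodesic_def by (auto simp: Pi_iff)
    fix u v assume "u \<in> {a..b}" "v \<in> {a..b}"
    then have "a + b - u \<in> {a..b}" "a + b - v \<in> {a..b}" by auto
    then have "d (\<sigma> (a + b - u)) (\<sigma> (a + b - v)) = \<bar>(a + b - u) - (a + b - v)\<bar>"
      using s(2) unfolding geodesic_def by blast
    then show "d (\<sigma> (a + b - u)) (\<sigma> (a + b - v)) = \<bar>u - v\<bar>" by simp
  qed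
  moreover have "S = (\<lambda>t. \<sigma> (a + b - t)) ` {a..b}"
  proof -
    have "(\<lambda>t. a + b - t) ` {a..b} = {a..b}"
      by (auto simp: image_iff intro!: bexI[of _ "a + b - x" for x])
    then have "S = \<sigma> ` (\<lambda>t. a + b - t) ` {a..b}" using s(5) by metis
    also have "\<dots> = (\<lambda>t. \<sigma> (a + b - t)) ` {a..b}" by (rule image_image)
    finally show ?thesis .
  qed
  ultimately show ?thesis
    unfolding geodesic_segment_def using s by (intro exI[of _ a] exI[of _ b] exI[of _ "\<lambda>t. \<sigma> (a + b - t)"]) auto
qed

text \<open>The four-point condition for \<open>x, y, z, p\<close> shows that \<open>p\<close> is nearly between the endpoints of one of the
  other two sides; on that side, the point at distance \<open>d x p\<close> (or \<open>d y p\<close>) from the common endpoint is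
  close to \<open>p\<close> by the four-point condition once more, and if the side is too short its far end is.\<close>

lemma four_point_side_near_others:
  assumes M: "Metric_space X d" and fp: "four_point X d c" and "0 \<le> c"
    and xyz: "x \<in> X" "y \<in> X" "z \<in> X"
    and A: "geodesic_segment X d x y A" and B: "geodesic_segment X d y z B"
    and C: "geodesic_segment X d z x C" and p: "p \<in> A"
  shows "\<exists>q\<in>B \<union> C. d p q \<le> 2 * c"
proof -
  interpret Metric_space X d by (rule M)
  have close: "\<exists>q\<in>S. d p q \<le> 2 * c"
    if uv: "u \<in> X" "v \<in> X" and S: "geodesic_segment X d u v S"
      and pX: "p \<in> X" and le: "d u p + d p v \<le> d u v + c" for u v S
  proof (cases "d u p \<le> d u v")
    case True
    obtain q where q: "q \<in> S" "d u q = d u p"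
      using geodesic_segment_point_at[OF S nonneg True] by blast
    have qX: "q \<in> X" and quv: "d u q + d q v = d u v"
      using geodesic_segment_mem[OF S q(1)] by auto
    have "d p q + d u v \<le> max (d p u + d q v) (d p v + d q u) + c"
      using fp pX qX uv unfolding four_point_def by blast
    then have "d p q \<le> 2 * c"
      using q(2) quv le \<open>0 \<le> c\<close> commute[of p u] commute[of q u] by (auto simp: max_def split: if_splits)
    then show ?thesis using q(1) by blast
  next
    case False
    have "v \<in> S" using S unfolding geodesic_segment_def by auto
    moreover have "d p v \<le> 2 * c" using le False \<open>0 \<le> c\<close> by linarith
    ultimately show ?thesis by blast
  qed
  have pX: "p \<in> X" and pxy: "d x p + d p y = d x y"
    using geodesic_segment_mem[OF A p] by auto
  have "d x y + d z p \<le> max (d x z + d y p) (d x p + d y z) + c"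
    using fp xyz pX unfolding four_point_def by blast
  then consider "d x p + d p z \<le> d x z + c" | "d y p + d p z \<le> d y z + c"
    using pxy commute[of y p] commute[of z p] by (auto simp: max_def split: if_splits)
  then show ?thesis
  proof cases
    case 1
    then show ?thesis
      using close[OF xyz(1,3) geodesic_segment_reverse[OF C] pX] by blast
  next
    case 2
    then show ?thesis using close[OF xyz(2,3) B pX] by blast
  qed
qed

theorem four_point_Gromov_hyperbolic:
  assumes "proper_metric_space X d" "geodesic_metric_space X d" "four_point X d c" "0 \<le> c"
  shows "Gromov_hyperbolic X d"
proof -
  have M: "Metric_space X d" using assms(1) unfolding proper_metric_space_def by blast
  have "thin_triangle d (2 * c) A B C" if tri: "geodesic_triangle X d A B C" for A B C
  proof -
    obtain x y z where xyz: "x \<in> X" "y \<in> X" "z \<in> X"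
      and S: "geodesic_segment X d x y A" "geodesic_segment X d y z B" "geodesic_segment X d z x C"
      using tri unfolding geodesic_triangle_def by blast
    note side = four_point_side_near_others[OF M assms(3,4)]
    show ?thesis
      unfolding thin_triangle_def
      using side[OF xyz S] side[OF xyz(2,3,1) S(2,3,1)] side[OF xyz(3,1,2) S(3,1,2)] by blast
  qed
  then show ?thesis
    unfolding Gromov_hyperbolic_def delta_hyperbolic_def
    using assms(1,2,4) by (intro exI[of _ "2 * c"]) auto
qed

section \<open>Complex hyperbolic space in Lorentzian coordinates\<close>

text \<open>The Hermitian form of signature \<open>(1, n)\<close>, with \<^const>\<open>None\<close> as the time coordinate. The complex lines
  spanned by timelike vectors are the points of complex hyperbolic space.\<close>

definition lorentz :: "complex ^ ('n::finite option) \<Rightarrow> complex ^ ('n::finite option) \<Rightarrow> complex" where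
  "lorentz X Y = X $ None * cnj (Y $ None) - (\<Sum>i\<in>UNIV. X $ Some i * cnj (Y $ Some i))"

definition space_part :: "complex ^ ('n::finite option) \<Rightarrow> complex ^ 'n" where
  "space_part X = (\<chi> i. X $ Some i)"

definition lorentz_norm2 :: "complex ^ ('n::finite option) \<Rightarrow> real" where
  "lorentz_norm2 X = (cmod (X $ None))\<^sup>2 - (norm (space_part X))\<^sup>2"

definition timelike :: "complex ^ ('n::finite option) \<Rightarrow> bool" where
  "timelike X \<longleftrightarrow> norm (space_part X) < cmod (X $ None)"

lemma timelike_iff: "timelike X \<longleftrightarrow> 0 < lorentz_norm2 X"
  unfolding timelike_def lorentz_norm2_def
  by (metis diff_gt_0_iff_gt norm_ge_zero power2_less_imp_less power_strict_mono zero_less_numeral)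

lemma timelike_ne: "timelike X \<Longrightarrow> X $ None \<noteq> 0"
  unfolding timelike_def using norm_ge_zero[of "space_part X"] by auto

lemma norm_space_part: "(norm (space_part X))\<^sup>2 = (\<Sum>i\<in>UNIV. (cmod (X $ Some i))\<^sup>2)"
  by (simp add: norm_vec_def L2_set_def space_part_def sum_nonneg)

lemma lorentz_self: "lorentz X X = of_real (lorentz_norm2 X)"
  by (simp add: lorentz_def lorentz_norm2_def norm_space_part complex_norm_square[symmetric] of_real_sum)

lemma lorentz_add_left: "lorentz (X + Y) Z = lorentz X Z + lorentz Y Z"
  by (simp add: lorentz_def algebra_simps sum.distrib)

lemma lorentz_diff_left: "lorentz (X - Y) Z = lorentz X Z - lorentz Y Z"
  by (simp add: lorentz_def algebra_simps sum_subtractf)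

lemma lorentz_scale_left: "lorentz (c *s X) Z = c * lorentz X Z"
  by (simp add: lorentz_def algebra_simps sum_distrib_left)

lemma lorentz_cnj: "cnj (lorentz X Y) = lorentz Y X"
  by (simp add: lorentz_def mult.commute)

lemma lorentz_add_right: "lorentz Z (X + Y) = lorentz Z X + lorentz Z Y"
  by (metis complex_cnj_add lorentz_add_left lorentz_cnj)

lemma lorentz_diff_right: "lorentz Z (X - Y) = lorentz Z X - lorentz Z Y"
  by (metis complex_cnj_diff lorentz_cnj lorentz_diff_left)

lemma lorentz_scale_right: "lorentz Z (c *s X) = cnj c * lorentz Z X"
  by (metis complex_cnj_mult lorentz_cnj lorentz_scale_left)

lemmas lorentz_simps = lorentz_add_left lorentz_diff_left lorentz_scale_left
  lorentz_add_right lorentz_diff_right lorentz_scale_right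

lemma lorentz_norm2_scale: "lorentz_norm2 (c *s X) = (cmod c)\<^sup>2 * lorentz_norm2 X"
proof -
  have "complex_of_real (lorentz_norm2 (c *s X)) = of_real ((cmod c)\<^sup>2 * lorentz_norm2 X)"
    unfolding lorentz_self[symmetric] lorentz_simps of_real_mult complex_norm_square by simp
  then show ?thesis by (simp only: of_real_eq_iff)
qed

lemma lorentz_commute_cmod: "cmod (lorentz X Y) = cmod (lorentz Y X)"
  by (metis complex_mod_cnj lorentz_cnj)

lemma space_part_Cauchy_Schwarz:
  "cmod (\<Sum>i\<in>UNIV. X $ Some i * cnj (Y $ Some i)) \<le> norm (space_part X) * norm (space_part Y)"
proof -
  have "cmod (\<Sum>i\<in>UNIV. X $ Some i * cnj (Y $ Some i)) \<le> (\<Sum>i\<in>UNIV. \<bar>cmod (X $ Some i)\<bar> * \<bar>cmod (Y $ Some i)\<bar>)"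
    by (rule order_trans[OF norm_sum]) (simp add: norm_mult)
  also have "\<dots> \<le> L2_set (\<lambda>i. cmod (X $ Some i)) UNIV * L2_set (\<lambda>i. cmod (Y $ Some i)) UNIV"
    by (rule L2_set_mult_ineq)
  finally show ?thesis by (simp add: norm_vec_def space_part_def)
qed

text \<open>The form is negative definite on the orthogonal complement of a timelike vector, by the
  Cauchy-Schwarz inequality for the space coordinates.\<close>

lemma lorentz_orthogonal_timelike:
  assumes X: "timelike X" and orth: "lorentz E X = 0"
  shows "lorentz_norm2 E \<le> 0" "lorentz_norm2 E = 0 \<Longrightarrow> E = 0"
proof -
  have "E $ None * cnj (X $ None) = (\<Sum>i\<in>UNIV. E $ Some i * cnj (X $ Some i))"
    using orth by (simp add: lorentz_def)
  then have "cmod (E $ None) * cmod (X $ None) = cmod (\<Sum>i\<in>UNIV. E $ Some i * cnj (X $ Some i))"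
    by (metis complex_mod_cnj norm_mult)
  then have le: "cmod (E $ None) * cmod (X $ None) \<le> norm (space_part E) * norm (space_part X)"
    using space_part_Cauchy_Schwarz by metis
  have Xp: "0 < cmod (X $ None)" using timelike_ne[OF X] by simp
  have "lorentz_norm2 E \<le> 0 \<and> (lorentz_norm2 E = 0 \<longrightarrow> E = 0)"
  proof (cases "space_part E = 0")
    case True
    then have "E $ None = 0" using le Xp by (auto simp: mult_le_0_iff)
    then have "E = 0" using True by (auto simp: vec_eq_iff space_part_def split: option.split)
       (metis not_Some_eq)
    then show ?thesis by (simp add: lorentz_norm2_def space_part_def vec_eq_iff zero_vec_def)
  next
    case False
    then have "norm (space_part E) * norm (space_part X) < norm (space_part E) * cmod (X $ None)"
      using X by (simp add: timelike_def)
    then have "cmod (E $ None) < norm (space_part E)"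
      using le Xp by (metis le_less_trans mult_less_cancel_right_pos)
    then have "(cmod (E $ None))\<^sup>2 < (norm (space_part E))\<^sup>2" by (intro power_strict_mono) auto
    then have "lorentz_norm2 E < 0" unfolding lorentz_norm2_def by linarith
    then show ?thesis by simp
  qed
  then show "lorentz_norm2 E \<le> 0" "lorentz_norm2 E = 0 \<Longrightarrow> E = 0" by auto
qed

lemma lorentz_norm2_diff:
  "lorentz_norm2 (X - Y) = lorentz_norm2 X + lorentz_norm2 Y - 2 * Re (lorentz X Y)"
proof -
  have "lorentz_norm2 (X - Y) = Re (lorentz (X - Y) (X - Y))" by (simp add: lorentz_self)
  also have "\<dots> = Re (lorentz X X) + Re (lorentz Y Y) - Re (lorentz X Y) - Re (cnj (lorentz X Y))"
    by (simp add: lorentz_simps lorentz_cnj)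
  finally show ?thesis by (simp add: lorentz_self)
qed

lemma lorentz_norm2_orthogonal_add:
  assumes "lorentz X Y = 0"
  shows "lorentz_norm2 (X + Y) = lorentz_norm2 X + lorentz_norm2 Y"
proof -
  have "lorentz_norm2 (X + Y) = Re (lorentz (X + Y) (X + Y))" by (simp add: lorentz_self)
  also have "\<dots> = Re (lorentz X X) + Re (lorentz Y Y)"
    using assms lorentz_cnj[of X Y] by (simp add: lorentz_simps)
  finally show ?thesis by (simp add: lorentz_self)
qed

text \<open>The hyperbolic cosine of the distance in complex hyperbolic space.\<close>

definition lorentz_cosh :: "complex ^ ('n::finite option) \<Rightarrow> complex ^ ('n option) \<Rightarrow> real" where
  "lorentz_cosh X Y = cmod (lorentz X Y) / sqrt (lorentz_norm2 X * lorentz_norm2 Y)"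

text \<open>Normalise \<open>X\<close> and \<open>Y\<close>, and choose the phase of \<open>Y\<close> so that their product is a number \<open>c \<ge> 0\<close>. The component
  of \<open>Y\<close> orthogonal to \<open>X\<close> has square norm \<open>1 - c\<^sup>2\<close>, which is negative because \<open>Y\<close> is no multiple of \<open>X\<close>.\<close>

lemma lorentz_plane_normal_form:
  assumes X: "timelike X" and Y: "timelike Y" and ne: "\<And>c. Y \<noteq> c *s X"
  obtains \<alpha> \<beta> E l where "\<alpha> \<noteq> 0" "\<beta> \<noteq> 0" "l > 0" "cosh l = lorentz_cosh X Y"
    "lorentz_norm2 (\<alpha> *s X) = 1" "lorentz_norm2 E = -1" "lorentz E (\<alpha> *s X) = 0"
    "\<beta> *s Y = of_real (cosh l) *s (\<alpha> *s X) + of_real (sinh l) *s E"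
proof -
  have qX: "lorentz_norm2 X > 0" and qY: "lorentz_norm2 Y > 0"
    using X Y by (auto simp: timelike_iff)
  define \<alpha> where "\<alpha> = complex_of_real (1 / sqrt (lorentz_norm2 X))"
  have \<alpha>: "\<alpha> \<noteq> 0" "(cmod \<alpha>)\<^sup>2 * lorentz_norm2 X = 1"
    using qX by (auto simp: \<alpha>_def norm_divide power_divide)
  define w where "w = lorentz Y X"
  \<comment> \<open>The phase that makes the product of \<open>Y\<close> with \<open>X\<close> nonnegative.\<close>
  define \<theta> where "\<theta> = (if w = 0 then 1 else cnj w / of_real (cmod w))"
  have \<theta>: "cmod \<theta> = 1" "\<theta> * w = of_real (cmod w)"
  proof -
    show "cmod \<theta> = 1" by (simp add: \<theta>_def norm_divide)
    show "\<theta> * w = of_real (cmod w)"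
    proof (cases "w = 0")
      case False
      then have "\<theta> * w = (w * cnj w) / of_real (cmod w)" by (simp add: \<theta>_def)
      also have "\<dots> = of_real ((cmod w)\<^sup>2) / of_real (cmod w)" by (simp only: complex_norm_square)
      also have "\<dots> = of_real (cmod w)" using False by (simp add: power2_eq_square)
      finally show ?thesis .
    qed simp
  qed
  define \<beta> where "\<beta> = \<theta> * of_real (1 / sqrt (lorentz_norm2 Y))"
  have \<beta>: "\<beta> \<noteq> 0" "(cmod \<beta>)\<^sup>2 * lorentz_norm2 Y = 1"
    using qY \<theta>(1) by (auto simp: \<beta>_def norm_mult norm_divide power_divide)
  define X' where "X' = \<alpha> *s X"
  define Y' where "Y' = \<beta> *s Y"
  have q': "lorentz_norm2 X' = 1" "lorentz_norm2 Y' = 1"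
    using \<alpha>(2) \<beta>(2) by (simp_all add: X'_def Y'_def lorentz_norm2_scale)
  define c where "c = lorentz_cosh X Y"
  have YX: "lorentz Y' X' = of_real c"
  proof -
    have "lorentz Y' X' = (\<theta> * w) * of_real (1 / sqrt (lorentz_norm2 Y) * (1 / sqrt (lorentz_norm2 X)))"
      by (simp add: X'_def Y'_def lorentz_simps \<alpha>_def \<beta>_def w_def)
    also have "\<dots> = of_real (cmod w * (1 / sqrt (lorentz_norm2 Y) * (1 / sqrt (lorentz_norm2 X))))"
      unfolding \<theta>(2) by simp
    also have "cmod w * (1 / sqrt (lorentz_norm2 Y) * (1 / sqrt (lorentz_norm2 X))) = c"
      by (simp add: c_def lorentz_cosh_def w_def real_sqrt_mult lorentz_commute_cmod[of Y X])
    finally show ?thesis .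
  qed
  have "c \<ge> 0" using qX qY by (simp add: c_def lorentz_cosh_def)
  define F where "F = Y' - of_real c *s X'"
  have XX: "lorentz X' X' = 1" using q'(1) by (simp add: lorentz_self)
  have FX: "lorentz F X' = 0" by (simp add: F_def lorentz_simps YX XX)
  have tX': "timelike X'" using q'(1) by (simp add: timelike_iff)
  have qF: "lorentz_norm2 F = 1 - c\<^sup>2"
    unfolding F_def lorentz_norm2_diff
    by (simp add: q' lorentz_norm2_scale lorentz_simps YX power2_eq_square)
  have "F \<noteq> 0"
  proof
    assume "F = 0"
    then have "\<beta> *s Y = of_real c *s (\<alpha> *s X)" by (simp add: F_def X'_def Y'_def)
    then have "(1 / \<beta>) *s (\<beta> *s Y) = (1 / \<beta>) *s (of_real c *s (\<alpha> *s X))" by simp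
    then have "Y = (1 / \<beta> * of_real c * \<alpha>) *s X"
      using \<beta>(1) by (simp add: vector_smult_assoc)
    then show False using ne by blast
  qed
  then have "1 - c\<^sup>2 < 0"
    using lorentz_orthogonal_timelike[OF tX' FX] qF by force
  then have c1: "c > 1" using \<open>c \<ge> 0\<close> by (metis diff_less_0_iff_less not_le one_power2 power_mono)
  define l where "l = arcosh c"
  have l: "l > 0" "cosh l = c" "sinh l = sqrt (c\<^sup>2 - 1)"
    using c1 by (simp_all add: l_def sinh_arcosh_real)
  define E where "E = of_real (1 / sqrt (c\<^sup>2 - 1)) *s F"
  have s: "sqrt (c\<^sup>2 - 1) > 0" "(sqrt (c\<^sup>2 - 1))\<^sup>2 = c\<^sup>2 - 1" using \<open>1 - c\<^sup>2 < 0\<close> by auto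
  show thesis
  proof
    show "\<alpha> \<noteq> 0" "\<beta> \<noteq> 0" "l > 0" using \<alpha> \<beta> l by auto
    show "cosh l = lorentz_cosh X Y" using l by (simp add: c_def)
    show "lorentz_norm2 (\<alpha> *s X) = 1" using q' by (simp add: X'_def)
    show "lorentz_norm2 E = -1"
      using s by (simp add: E_def lorentz_norm2_scale qF norm_divide power_divide field_simps)
    show "lorentz E (\<alpha> *s X) = 0"
      using FX unfolding X'_def E_def lorentz_scale_left by simp
    show "\<beta> *s Y = of_real (cosh l) *s (\<alpha> *s X) + of_real (sinh l) *s E"
      using s(1) l by (simp add: E_def vector_smult_assoc F_def X'_def Y'_def)
  qed
qed

lemma timelike_plane_disc:
  assumes "lorentz_norm2 X = 1" "lorentz_norm2 E = -1" "lorentz E X = 0" "cmod z < 1"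
  shows "timelike (X + z *s E)"
proof -
  have "lorentz X (z *s E) = 0"
    using assms(3) lorentz_cnj[of E X] by (simp add: lorentz_simps)
  then have "lorentz_norm2 (X + z *s E) = 1 - (cmod z)\<^sup>2"
    using assms by (simp add: lorentz_norm2_orthogonal_add lorentz_norm2_scale)
  then show ?thesis using assms(4) by (simp add: timelike_iff abs_square_less_1)
qed

text \<open>Split \<open>P\<close> along \<open>X\<close>, \<open>E\<close> and a remainder; the remainder is orthogonal to \<open>X\<close> and so contributes a
  nonpositive square norm. Thus the quotient of the two coordinates maps timelike vectors to the disc.\<close>

lemma timelike_projection_bound:
  assumes "lorentz_norm2 X = 1" "lorentz_norm2 E = -1" "lorentz E X = 0" and P: "timelike P"
  shows "cmod (lorentz P E) < cmod (lorentz P X)"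
proof -
  define a where "a = lorentz P X"
  define b where "b = - lorentz P E"
  define S where "S = a *s X + b *s E"
  define R where "R = P - S"
  have XX: "lorentz X X = 1" and EE: "lorentz E E = -1"
    using assms(1,2) by (simp_all add: lorentz_self)
  have XE: "lorentz X E = 0" using assms(3) lorentz_cnj[of E X] by simp
  have RX: "lorentz R X = 0" and RE: "lorentz R E = 0"
    by (simp_all add: R_def S_def lorentz_simps XX EE XE assms(3) a_def b_def)
  have "lorentz S R = 0"
    using RX RE lorentz_cnj[of R X] lorentz_cnj[of R E] by (simp add: S_def lorentz_simps)
  then have "lorentz_norm2 P = lorentz_norm2 S + lorentz_norm2 R"
    using lorentz_norm2_orthogonal_add[of S R] by (simp add: R_def)
  also have "lorentz_norm2 S = (cmod a)\<^sup>2 - (cmod b)\<^sup>2"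
    using lorentz_norm2_orthogonal_add[of "a *s X" "b *s E"] assms XE
    by (simp add: S_def lorentz_simps lorentz_norm2_scale)
  also have "lorentz_norm2 R \<le> 0"
    using lorentz_orthogonal_timelike(1)[OF _ RX] assms(1) by (simp add: timelike_iff)
  finally have "(cmod b)\<^sup>2 < (cmod a)\<^sup>2" using P by (simp add: timelike_iff)
  then show ?thesis by (simp add: a_def b_def power2_less_imp_less)
qed

text \<open>For unit time coordinates and space parts \<open>x, y, z\<close> in the closed unit ball, combine
  \<open>|x - y|\<^sup>2 \<le> 2 |1 - \<langle>x, y\<rangle>|\<close> with the identity
  \<open>1 - \<langle>x, z\<rangle> = (1 - \<langle>y, z\<rangle>) - \<langle>x - y, z - y\<rangle> - \<langle>x - y, y\<rangle>\<close>.\<close>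

lemma lorentz_quasi_triangle_normalized:
  fixes X Y Z :: "complex ^ ('n::finite option)"
  assumes X: "norm (space_part X) \<le> 1" "X $ None = 1" and Y: "norm (space_part Y) \<le> 1" "Y $ None = 1"
    and Z: "norm (space_part Z) \<le> 1" "Z $ None = 1"
  shows "cmod (lorentz X Z) \<le> 4 * cmod (lorentz X Y) + 4 * cmod (lorentz Y Z)"
proof -
  let ?ip = "\<lambda>X Y. \<Sum>i\<in>UNIV. X $ Some i * cnj (Y $ Some i)"
  define a where "a = cmod (lorentz X Y)"
  define b where "b = cmod (lorentz Y Z)"
  have dist: "(norm (space_part (P - Q)))\<^sup>2 \<le> 2 * cmod (lorentz P Q)"
    if "norm (space_part P) \<le> 1" "P $ None = 1" "norm (space_part Q) \<le> 1" "Q $ None = 1" for P Q :: "complex ^ ('n option)"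
  proof -
    have "(norm (space_part (P - Q)))\<^sup>2 = - lorentz_norm2 (P - Q)"
      using that by (simp add: lorentz_norm2_def)
    also have "\<dots> = 2 * Re (lorentz P Q) - lorentz_norm2 P - lorentz_norm2 Q"
      by (simp add: lorentz_norm2_diff)
    also have "\<dots> \<le> 2 * Re (lorentz P Q)"
      using that power_le_one[OF norm_ge_zero that(1), of 2] power_le_one[OF norm_ge_zero that(3), of 2]
      by (simp add: lorentz_norm2_def)
    finally show ?thesis using complex_Re_le_cmod[of "lorentz P Q"] by linarith
  qed
  have split: "lorentz X Z = lorentz Y Z - ?ip (X - Y) (Z - Y) - ?ip (X - Y) Y"
    using X Y Z by (simp add: lorentz_def algebra_simps sum_subtractf sum.distrib)
  have t1: "cmod (?ip (X - Y) (Z - Y)) \<le> a + b"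
  proof -
    have "cmod (?ip (X - Y) (Z - Y)) \<le> norm (space_part (X - Y)) * norm (space_part (Z - Y))"
      by (rule space_part_Cauchy_Schwarz)
    also have "\<dots> \<le> ((norm (space_part (X - Y)))\<^sup>2 + (norm (space_part (Z - Y)))\<^sup>2) / 2"
      using sum_squares_bound[of "norm (space_part (X - Y))" "norm (space_part (Z - Y))"] by simp
    also have "\<dots> \<le> a + b"
      using dist[OF X Y] dist[OF Z Y] by (simp add: a_def b_def lorentz_commute_cmod[of Z Y])
    finally show ?thesis .
  qed
  have t2: "cmod (?ip (X - Y) Y) \<le> 3 * a"
  proof -
    have "?ip (X - Y) Y = lorentz Y Y - lorentz X Y"
      using X Y by (simp add: lorentz_def algebra_simps sum_subtractf)
    then have "cmod (?ip (X - Y) Y) \<le> cmod (lorentz Y Y) + a"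
      by (simp add: a_def norm_triangle_ineq4)
    moreover have "cmod (lorentz Y Y) \<le> 2 * a"
    proof -
      let ?y = "norm (space_part Y)"
      have "cmod (lorentz Y Y) = 1 - ?y\<^sup>2"
        using Y power_le_one[OF norm_ge_zero Y(1), of 2]
        unfolding lorentz_self norm_of_real by (simp add: lorentz_norm2_def)
      also have "\<dots> = (1 + ?y) * (1 - ?y)" by (simp add: power2_eq_square algebra_simps)
      also have "\<dots> \<le> 2 * (1 - ?y)" using Y(1) by (intro mult_right_mono) auto
      also have "1 - ?y \<le> a"
      proof -
        have "cmod (?ip X Y) \<le> 1 * ?y"
          using space_part_Cauchy_Schwarz[of X Y] mult_right_mono[OF X(1), of ?y] by auto
        moreover have "lorentz X Y = 1 - ?ip X Y" using X Y by (simp add: lorentz_def)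
        ultimately show ?thesis
          using norm_triangle_ineq2[of 1 "?ip X Y"] by (simp add: a_def)
      qed
      finally show ?thesis by simp
    qed
    ultimately show ?thesis by simp
  qed
  have "cmod (lorentz X Z) \<le> cmod (lorentz Y Z) + cmod (?ip (X - Y) (Z - Y)) + cmod (?ip (X - Y) Y)"
    unfolding split by (intro order_trans[OF norm_triangle_ineq4] add_mono norm_triangle_ineq4 order_refl)
  then have "cmod (lorentz X Z) \<le> b + (a + b) + 3 * a" using t1 t2 by (simp add: b_def)
  moreover have "a \<ge> 0" "b \<ge> 0" by (simp_all add: a_def b_def)
  ultimately have "cmod (lorentz X Z) \<le> 4 * a + 4 * b" by linarith
  then show ?thesis by (simp only: a_def b_def)
qed

text \<open>The inequality is homogeneous, so unit time coordinates may be assumed. If, say, \<open>\<rho> X Z\<close> is smallest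
  among the four mixed terms, the quasi-triangle inequality gives \<open>\<rho> X Y \<le> 8 \<rho> Y Z\<close> and
  \<open>\<rho> Z W \<le> 8 \<rho> X W\<close>.\<close>

lemma lorentz_quasi_Ptolemy:
  fixes X Y Z W :: "complex ^ ('n::finite option)"
  assumes "timelike X" "timelike Y" "timelike Z" "timelike W"
  shows "cmod (lorentz X Y) * cmod (lorentz Z W) \<le>
    64 * max (cmod (lorentz X Z) * cmod (lorentz Y W)) (cmod (lorentz X W) * cmod (lorentz Y Z))"
proof -
  define n where "n P = (1 / P $ None) *s P" for P :: "complex ^ ('n option)"
  define \<rho> where "\<rho> P Q = cmod (lorentz (n P) (n Q))" for P Q :: "complex ^ ('n option)"
  have nP: "norm (space_part (n P)) \<le> 1" "n P $ None = 1" if "timelike P" for P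
  proof -
    have "space_part (n P) = (1 / P $ None) *s space_part P"
      by (simp add: n_def space_part_def vec_eq_iff)
    then have "norm (space_part (n P)) = norm (space_part P) / cmod (P $ None)"
      by (simp add: norm_vector_scalar_mult norm_divide)
    then show "norm (space_part (n P)) \<le> 1"
      using that by (simp add: timelike_def divide_le_eq)
    show "n P $ None = 1" using timelike_ne[OF that] by (simp add: n_def)
  qed
  have tri: "\<rho> P R \<le> 4 * \<rho> P Q + 4 * \<rho> Q R" if "timelike P" "timelike Q" "timelike R" for P Q R
    unfolding \<rho>_def by (intro lorentz_quasi_triangle_normalized nP that)
  have sym: "\<rho> P Q = \<rho> Q P" for P Q
    unfolding \<rho>_def by (rule lorentz_commute_cmod)
  have nn: "\<rho> P Q \<ge> 0" for P Q by (simp add: \<rho>_def)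
  have pair: "\<rho> P Q * \<rho> R S \<le> 64 * (\<rho> P S * \<rho> Q R)"
    if "timelike P" "timelike Q" "timelike R" "timelike S" "\<rho> P R \<le> \<rho> Q R" "\<rho> P R \<le> \<rho> P S" for P Q R S
  proof -
    have "\<rho> P Q \<le> 8 * \<rho> Q R" using tri[of P R Q] that sym[of R Q] by simp
    moreover have "\<rho> R S \<le> 8 * \<rho> P S" using tri[of R P S] that sym[of R P] by simp
    ultimately have "\<rho> P Q * \<rho> R S \<le> (8 * \<rho> Q R) * (8 * \<rho> P S)"
      using nn by (intro mult_mono) auto
    then show ?thesis by (simp add: ac_simps)
  qed
  have main: "\<rho> X Y * \<rho> Z W \<le> 64 * max (\<rho> X Z * \<rho> Y W) (\<rho> X W * \<rho> Y Z)"
  proof -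
    consider "\<rho> X Z \<le> \<rho> Y Z" "\<rho> X Z \<le> \<rho> X W" | "\<rho> Y W \<le> \<rho> X W" "\<rho> Y W \<le> \<rho> Y Z"
      | "\<rho> X W \<le> \<rho> Y W" "\<rho> X W \<le> \<rho> X Z" | "\<rho> Y Z \<le> \<rho> X Z" "\<rho> Y Z \<le> \<rho> Y W"
      by linarith
    then show ?thesis
    proof cases
      case 1
      then show ?thesis using pair[of X Y Z W] assms by simp
    next
      case 2
      then show ?thesis using pair[of Y X W Z] assms sym[of Y X] sym[of W Z] by (simp add: mult.commute)
    next
      case 3
      then show ?thesis using pair[of X Y W Z] assms sym[of W Z] by (simp add: mult.commute)
    next
      case 4
      then show ?thesis using pair[of Y X Z W] assms sym[of Y X] by (simp add: mult.commute)
    qed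
  qed
  have L: "cmod (lorentz P Q) = cmod (P $ None) * cmod (Q $ None) * \<rho> P Q" if "timelike P" "timelike Q" for P Q
    using timelike_ne[OF that(1)] timelike_ne[OF that(2)]
    by (simp add: \<rho>_def n_def lorentz_simps norm_mult norm_divide)
  define k where "k = cmod (X $ None) * cmod (Y $ None) * cmod (Z $ None) * cmod (W $ None)"
  have "k \<ge> 0" by (simp add: k_def)
  have "cmod (lorentz X Y) * cmod (lorentz Z W) = k * (\<rho> X Y * \<rho> Z W)"
    by (simp add: L assms k_def)
  also have "\<dots> \<le> k * (64 * max (\<rho> X Z * \<rho> Y W) (\<rho> X W * \<rho> Y Z))"
    using main \<open>k \<ge> 0\<close> by (rule mult_left_mono)
  also have "\<dots> = 64 * max (k * (\<rho> X Z * \<rho> Y W)) (k * (\<rho> X W * \<rho> Y Z))"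
    using \<open>k \<ge> 0\<close> by (simp add: max_mult_distrib_left)
  also have "k * (\<rho> X Z * \<rho> Y W) = cmod (lorentz X Z) * cmod (lorentz Y W)"
    by (simp add: L assms k_def)
  also have "k * (\<rho> X W * \<rho> Y Z) = cmod (lorentz X W) * cmod (lorentz Y Z)"
    by (simp add: L assms k_def)
  finally show ?thesis .
qed

text \<open>On nonnegative numbers \<open>cosh\<close> and \<open>exp\<close> agree up to the factor \<open>2\<close>, and the norms of the four vectors
  cancel in products over pairs; the constant is \<open>256 = 4 \<cdot> 64\<close>.\<close>

lemma four_point_of_lorentz_cosh:
  assumes L: "\<And>x. x \<in> S \<Longrightarrow> timelike (L x)"
    and d: "\<And>x y. x \<in> S \<Longrightarrow> y \<in> S \<Longrightarrow> 0 \<le> d x y \<and> cosh (d x y) = lorentz_cosh (L x) (L y)"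
    and xyzw: "x \<in> S" "y \<in> S" "z \<in> S" "w \<in> S"
  shows "d x y + d z w \<le> max (d x z + d y w) (d x w + d y z) + ln 256"
proof -
  define q where "q x = sqrt (lorentz_norm2 (L x))" for x
  have q: "q x > 0" if "x \<in> S" for x using L[OF that] by (simp add: q_def timelike_iff)
  have cosh_eq: "cosh (d u v) = cmod (lorentz (L u) (L v)) / (q u * q v)" if "u \<in> S" "v \<in> S" for u v
    using d[OF that] by (simp add: lorentz_cosh_def q_def real_sqrt_mult)
  have up: "exp (d u v) \<le> 2 * cosh (d u v)" for u v
    using exp_ge_zero[of "- d u v"] by (simp add: cosh_def del: exp_ge_zero)
  have low: "cosh (d u v) \<le> exp (d u v)" if "u \<in> S" "v \<in> S" for u v
  proof -
    have "exp (- d u v) \<le> exp (d u v)" using d[OF that] by simp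
    then show ?thesis by (simp add: cosh_def)
  qed
  define k where "k = q x * q y * q z * q w"
  have k: "k > 0" using q xyzw by (simp add: k_def)
  have prod: "cosh (d u v) * cosh (d s t) = cmod (lorentz (L u) (L v)) * cmod (lorentz (L s) (L t)) / k"
    if "u \<in> S" "v \<in> S" "s \<in> S" "t \<in> S" "q u * q v * (q s * q t) = k" for u v s t
    using that by (simp add: cosh_eq)
  have "exp (d x y + d z w) \<le> 4 * (cosh (d x y) * cosh (d z w))"
    unfolding exp_add using mult_mono[OF up up, of x y z w] by simp
  also have "\<dots> \<le> 4 * (64 * max (cosh (d x z) * cosh (d y w)) (cosh (d x w) * cosh (d y z)))"
  proof -
    have "cosh (d x y) * cosh (d z w) = cmod (lorentz (L x) (L y)) * cmod (lorentz (L z) (L w)) / k"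
      by (rule prod) (use xyzw in \<open>auto simp: k_def\<close>)
    also have "\<dots> \<le> 64 * max (cmod (lorentz (L x) (L z)) * cmod (lorentz (L y) (L w)))
        (cmod (lorentz (L x) (L w)) * cmod (lorentz (L y) (L z))) / k"
      using k by (intro divide_right_mono lorentz_quasi_Ptolemy L xyzw) auto
    also have "\<dots> = 64 * max (cmod (lorentz (L x) (L z)) * cmod (lorentz (L y) (L w)) / k)
        (cmod (lorentz (L x) (L w)) * cmod (lorentz (L y) (L z)) / k)"
      using k by (simp add: max_divide_distrib_right times_divide_eq_right[symmetric] del: times_divide_eq_right)
    also have "cmod (lorentz (L x) (L z)) * cmod (lorentz (L y) (L w)) / k = cosh (d x z) * cosh (d y w)"
      by (rule prod[symmetric]) (use xyzw in \<open>auto simp: k_def\<close>)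
    also have "cmod (lorentz (L x) (L w)) * cmod (lorentz (L y) (L z)) / k = cosh (d x w) * cosh (d y z)"
      by (rule prod[symmetric]) (use xyzw in \<open>auto simp: k_def\<close>)
    finally show ?thesis by simp
  qed
  also have "\<dots> \<le> 256 * max (exp (d x z + d y w)) (exp (d x w + d y z))"
    unfolding exp_add
    using mult_mono[OF low low, of x z y w] mult_mono[OF low low, of x w y z] xyzw by (auto simp: max_def)
  also have "\<dots> = exp (max (d x z + d y w) (d x w + d y z) + ln 256)"
    unfolding exp_add[of _ "ln 256"] by (simp add: max_def)
  finally show ?thesis by simp
qed

lemma lorentz_cosh_scale_left: "c \<noteq> 0 \<Longrightarrow> lorentz_cosh (c *s X) Y = lorentz_cosh X Y"
  by (simp add: lorentz_cosh_def lorentz_simps lorentz_norm2_scale norm_mult real_sqrt_mult)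

lemma lorentz_cosh_commute: "lorentz_cosh X Y = lorentz_cosh Y X"
  by (simp add: lorentz_cosh_def lorentz_commute_cmod mult.commute)

lemma lorentz_cosh_scale_right: "c \<noteq> 0 \<Longrightarrow> lorentz_cosh X (c *s Y) = lorentz_cosh X Y"
  using lorentz_cosh_scale_left lorentz_cosh_commute by metis

lemma lorentz_cosh_self: "timelike X \<Longrightarrow> lorentz_cosh X X = 1"
  by (simp add: lorentz_cosh_def lorentz_self timelike_iff)

lemma continuous_on_lorentz_norm2:
  "continuous_on UNIV (lorentz_norm2 :: complex ^ ('n::finite option) \<Rightarrow> real)"
proof -
  have "(lorentz_norm2 :: complex ^ ('n option) \<Rightarrow> real) = (\<lambda>X. (cmod (X $ None))\<^sup>2 - (\<Sum>i\<in>UNIV. (cmod (X $ Some i))\<^sup>2))"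
    by (simp add: fun_eq_iff lorentz_norm2_def norm_space_part)
  moreover have "continuous_on UNIV (\<lambda>X :: complex ^ ('n option). (cmod (X $ None))\<^sup>2 - (\<Sum>i\<in>UNIV. (cmod (X $ Some i))\<^sup>2))"
    by (intro continuous_intros)
  ultimately show ?thesis by metis
qed

lemma continuous_on_lorentz: "continuous_on UNIV (lorentz X)"
  unfolding lorentz_def by (intro continuous_intros)

text \<open>If the distance from \<open>x\<close> to \<open>y n\<close> is bounded, then the vectors of the points \<open>y n\<close>, scaled to time
  coordinate \<open>1\<close>, have square norms bounded away from \<open>0\<close>, because their products with the vector of \<open>x\<close>
  are. A limit of these vectors is thus timelike and represents a limit of a subsequence of \<open>y\<close>.\<close>

lemma complex_hyperbolic_model_proper:
  fixes L :: "'a \<Rightarrow> complex ^ ('n::finite option)"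
  assumes M: "Metric_space S d"
    and L: "\<And>x. x \<in> S \<Longrightarrow> timelike (L x)"
    and surj: "\<And>X. timelike X \<Longrightarrow> \<exists>x\<in>S. \<exists>c. c \<noteq> 0 \<and> L x = c *s X"
    and d: "\<And>x y. x \<in> S \<Longrightarrow> y \<in> S \<Longrightarrow> cosh (d x y) = lorentz_cosh (L x) (L y)"
  shows "proper_metric_space S d"
proof -
  interpret Metric_space S d by (rule M)
  have "compactin mtopology (mcball x r)" if x: "x \<in> S" for x r
    unfolding compactin_sequentially
  proof (intro conjI allI impI)
    show "mcball x r \<subseteq> S" by (auto simp: mcball_def)
    fix y :: "nat \<Rightarrow> 'a" assume y: "range y \<subseteq> mcball x r"
    have yS: "y n \<in> S" and yd: "d x (y n) \<le> r" for n using y by (auto simp: mcball_def)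
    define Y where "Y n = (1 / L (y n) $ None) *s L (y n)" for n
    have c0: "1 / L (y n) $ None \<noteq> 0" for n using timelike_ne[OF L[OF yS]] by simp
    have YN: "Y n $ None = 1" for n using timelike_ne[OF L[OF yS]] by (simp add: Y_def)
    have Yt: "timelike (Y n)" for n
      using L[OF yS] c0 by (simp add: timelike_iff Y_def lorentz_norm2_scale)
    have Ysp: "norm (space_part (Y n)) < 1" for n
      using Yt[of n] YN[of n] by (simp add: timelike_def)
    define X where "X = L x"
    have X: "timelike X" unfolding X_def by (rule L[OF x])
    define \<epsilon> where "\<epsilon> = cmod (X $ None) - norm (space_part X)"
    have \<epsilon>: "\<epsilon> > 0" using X by (simp add: \<epsilon>_def timelike_def)
    have XY: "\<epsilon> \<le> cmod (lorentz X (Y n))" for n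
    proof -
      let ?ip = "\<Sum>i\<in>UNIV. X $ Some i * cnj (Y n $ Some i)"
      have "cmod ?ip \<le> norm (space_part X) * norm (space_part (Y n))"
        by (rule space_part_Cauchy_Schwarz)
      also have "\<dots> \<le> norm (space_part X) * 1"
        using Ysp[of n] by (intro mult_left_mono) auto
      finally have "cmod ?ip \<le> norm (space_part X)" by simp
      moreover have "lorentz X (Y n) = X $ None - ?ip" by (simp add: lorentz_def YN)
      ultimately show ?thesis using norm_triangle_ineq2[of "X $ None" ?ip] by (simp add: \<epsilon>_def)
    qed
    \<comment> \<open>Solves \<open>\<epsilon> \<le> |\<langle>X, Y n\<rangle>| \<le> cosh r * sqrt (\<langle>X, X\<rangle> \<langle>Y n, Y n\<rangle>)\<close> for \<open>\<langle>Y n, Y n\<rangle>\<close>.\<close>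
    define m where "m = (\<epsilon> / cosh r)\<^sup>2 / lorentz_norm2 X"
    have qX: "lorentz_norm2 X > 0" using X by (simp add: timelike_iff)
    have "m > 0" using \<epsilon> qX by (simp add: m_def)
    have qY: "m \<le> lorentz_norm2 (Y n)" for n
    proof -
      have qYn: "lorentz_norm2 (Y n) > 0" using Yt by (simp add: timelike_iff)
      have "lorentz_cosh X (Y n) = cosh (d x (y n))"
        using d[OF x yS] c0 by (simp add: X_def Y_def lorentz_cosh_scale_right)
      also have "\<dots> \<le> cosh r" using yd[of n] by (simp add: cosh_real_nonneg_le_iff order_trans[OF nonneg yd])
      finally have "cmod (lorentz X (Y n)) \<le> cosh r * sqrt (lorentz_norm2 X * lorentz_norm2 (Y n))"
        using qX qYn by (simp add: lorentz_cosh_def divide_le_eq)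
      then have "\<epsilon> / cosh r \<le> sqrt (lorentz_norm2 X * lorentz_norm2 (Y n))"
        using XY[of n] by (simp add: divide_le_eq mult.commute)
      then have "(\<epsilon> / cosh r)\<^sup>2 \<le> (sqrt (lorentz_norm2 X * lorentz_norm2 (Y n)))\<^sup>2"
        using \<epsilon> by (intro power_mono) auto
      then show ?thesis using qX qYn by (simp add: m_def divide_le_eq mult.commute)
    qed
    have "bounded (range Y)"
    proof -
      have "norm (Y n $ i) \<le> 1" for n i
      proof (cases i)
        case None
        then show ?thesis by (simp add: YN)
      next
        case (Some j)
        have "norm (Y n $ i) = norm (space_part (Y n) $ j)" by (simp add: Some space_part_def)
        also have "\<dots> \<le> norm (space_part (Y n))" by (rule Finite_Cartesian_Product.norm_nth_le)
        finally show ?thesis using Ysp[of n] by simp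
      qed
      moreover have "norm (Y n) \<le> (\<Sum>i\<in>UNIV. norm (Y n $ i))" for n
        unfolding norm_vec_def by (rule L2_set_le_sum) simp
      ultimately have "norm (Y n) \<le> (\<Sum>i\<in>(UNIV::'n option set). 1)" for n
        by (meson order_trans sum_mono)
      then show ?thesis unfolding bounded_iff by blast
    qed
    then obtain Z s where s: "strict_mono (s :: nat \<Rightarrow> nat)" "(Y \<circ> s) \<longlonglongrightarrow> Z"
      using bounded_imp_convergent_subsequence by blast
    have conv: "(\<lambda>n. f (Y (s n))) \<longlonglongrightarrow> f Z" if "continuous_on UNIV f"
      for f :: "complex ^ ('n option) \<Rightarrow> 'b::topological_space"
      using continuous_on_tendsto_compose[OF that s(2)] by (simp add: o_def)
    have "m \<le> lorentz_norm2 Z"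
      by (rule LIMSEQ_le_const[OF conv[OF continuous_on_lorentz_norm2]]) (use qY in auto)
    then have Zt: "timelike Z" using \<open>m > 0\<close> by (simp add: timelike_iff)
    obtain p c where p: "p \<in> S" "c \<noteq> 0" "L p = c *s Z" using surj[OF Zt] by blast
    have cosh_p: "cosh (d p (y (s n))) = lorentz_cosh Z (Y (s n))" for n
      using d[OF p(1) yS] p c0 by (simp add: Y_def lorentz_cosh_scale_right lorentz_cosh_scale_left)
    have "(\<lambda>n. lorentz_cosh Z (Y (s n))) \<longlonglongrightarrow> lorentz_cosh Z Z"
      unfolding lorentz_cosh_def using Zt
      by (intro tendsto_intros conv[OF continuous_on_lorentz_norm2] conv[OF continuous_on_lorentz])
         (auto simp: timelike_iff)
    then have "(\<lambda>n. cosh (d p (y (s n)))) \<longlonglongrightarrow> 1"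
      by (simp add: cosh_p lorentz_cosh_self[OF Zt])
    then have "(\<lambda>n. arcosh (cosh (d p (y (s n))))) \<longlonglongrightarrow> arcosh 1"
      by (rule tendsto_arcosh_strong) (auto simp: cosh_real_ge_1)
    then have lim: "(\<lambda>n. d (y (s n)) p) \<longlonglongrightarrow> 0"
      by (simp add: arcosh_cosh_real commute)
    have "d x p \<le> r"
    proof (rule LIMSEQ_le[OF tendsto_const])
      show "(\<lambda>n. r + d (y (s n)) p) \<longlonglongrightarrow> r"
        using tendsto_add[OF tendsto_const lim] by simp
      show "\<exists>N. \<forall>n\<ge>N. d x p \<le> r + d (y (s n)) p"
        using triangle[OF x yS p(1)] yd by (meson add_right_mono order_trans)
    qed
    then have "p \<in> mcball x r" using x p(1) by simp
    moreover have "limitin mtopology (y \<circ> s) p sequentially"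
      unfolding limitin_metric_dist_null using p(1) yS lim by (simp add: o_def)
    ultimately show "\<exists>l r'. l \<in> mcball x r \<and> strict_mono r' \<and> limitin mtopology (y \<circ> r') l sequentially"
      using s(1) by blast
  qed
  then show ?thesis unfolding proper_metric_space_def using M by blast
qed

section \<open>The light cone as a model of complex hyperbolic space\<close>

text \<open>The cone \<open>Re y\<^sub>k > |(Im y\<^sub>k, y')|\<close>: the norm on the left is the distance of \<open>y\<close> from the real point
  \<open>Re y\<^sub>k\<close> of the \<open>k\<close>-axis. In this form convexity is visible.\<close>

definition light_cone :: "'n::finite \<Rightarrow> (complex ^ 'n) set" where
  "light_cone k = {y. norm (y - of_real (Re (y $ k)) *s axis k 1) < Re (y $ k)}"

text \<open>The map \<open>y \<mapsto> (y\<^sub>k\<^sup>2, y')\<close> to the domain \<open>Re z > |w|\<^sup>2\<close>, followed by linear homogeneous coordinates in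
  which \<open>Re z - |w|\<^sup>2\<close> is the Lorentzian square norm: \<open>Re z = |(1 + z) / 2|\<^sup>2 - |(1 - z) / 2|\<^sup>2\<close>.\<close>

definition cone_lift :: "'n::finite \<Rightarrow> complex ^ 'n \<Rightarrow> complex ^ ('n option)" where
  "cone_lift k y = (\<chi> i. case i of None \<Rightarrow> (1 + (y $ k)\<^sup>2) / 2
     | Some j \<Rightarrow> if j = k then (1 - (y $ k)\<^sup>2) / 2 else y $ j)"

definition cone_unlift :: "'n::finite \<Rightarrow> complex ^ ('n option) \<Rightarrow> complex ^ 'n" where
  "cone_unlift k X = (\<chi> j. if j = k then csqrt ((X $ None - X $ Some k) / (X $ None + X $ Some k))
     else X $ Some j / (X $ None + X $ Some k))"

lemma lorentz_norm2_cone_lift: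
  "lorentz_norm2 (cone_lift k y) = Re ((y $ k)\<^sup>2) - (\<Sum>j\<in>UNIV - {k}. (cmod (y $ j))\<^sup>2)"
proof -
  have "(norm (space_part (cone_lift k y)))\<^sup>2 = (cmod ((1 - (y $ k)\<^sup>2) / 2))\<^sup>2 + (\<Sum>j\<in>UNIV - {k}. (cmod (y $ j))\<^sup>2)"
    unfolding norm_space_part by (subst sum.remove[of _ k]) (auto simp: cone_lift_def intro!: sum.cong)
  moreover have "(cmod ((1 + w) / 2))\<^sup>2 - (cmod ((1 - w) / 2))\<^sup>2 = Re w" for w
  proof -
    have "(cmod (1 + w))\<^sup>2 - (cmod (1 - w))\<^sup>2 = 4 * Re w"
      unfolding cmod_power2 by (simp add: power2_eq_square algebra_simps)
    then show ?thesis by (simp add: norm_divide power_divide field_simps)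
  qed
  ultimately show ?thesis by (simp add: lorentz_norm2_def cone_lift_def)
qed

lemma light_cone_iff:
  "y \<in> light_cone k \<longleftrightarrow> 0 < Re (y $ k) \<and> timelike (cone_lift k y)"
proof -
  let ?v = "y - of_real (Re (y $ k)) *s axis k 1"
  have "(norm ?v)\<^sup>2 = (\<Sum>j\<in>UNIV. (cmod (?v $ j))\<^sup>2)"
    by (simp add: norm_vec_def L2_set_def sum_nonneg)
  also have "\<dots> = (Im (y $ k))\<^sup>2 + (\<Sum>j\<in>UNIV - {k}. (cmod (y $ j))\<^sup>2)"
    by (subst sum.remove[of _ k]) (auto simp: axis_def cmod_power2 intro!: sum.cong)
  finally have eq: "(Re (y $ k))\<^sup>2 - (norm ?v)\<^sup>2 = lorentz_norm2 (cone_lift k y)"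
    by (simp add: lorentz_norm2_cone_lift Re_power2)
  have "norm ?v < Re (y $ k) \<longleftrightarrow> 0 < Re (y $ k) \<and> (norm ?v)\<^sup>2 < (Re (y $ k))\<^sup>2"
    using norm_ge_zero[of ?v] power_strict_mono[of "norm ?v" "Re (y $ k)" 2]
      power2_less_imp_less[of "norm ?v" "Re (y $ k)"] by (auto simp del: norm_ge_zero)
  then show ?thesis unfolding light_cone_def timelike_iff eq[symmetric] by auto
qed

lemma timelike_cone_lift: "y \<in> light_cone k \<Longrightarrow> timelike (cone_lift k y)"
  by (simp add: light_cone_iff)

lemma timelike_denominator:
  assumes "timelike X"
  shows "X $ None + X $ Some k \<noteq> 0"
proof
  assume "X $ None + X $ Some k = 0"
  then have "cmod (X $ None) = norm (space_part X $ k)"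
    by (simp add: space_part_def add_eq_0_iff)
  also have "\<dots> \<le> norm (space_part X)" by (rule Finite_Cartesian_Product.norm_nth_le)
  finally show False using assms by (simp add: timelike_def)
qed

lemma cone_lift_unlift:
  assumes "timelike X"
  shows "cone_lift k (cone_unlift k X) = (1 / (X $ None + X $ Some k)) *s X"
proof -
  define D where "D = X $ None + X $ Some k"
  have D: "D \<noteq> 0" unfolding D_def by (rule timelike_denominator[OF assms])
  have "1 + (X $ None - X $ Some k) / D = 2 * X $ None / D" "1 - (X $ None - X $ Some k) / D = 2 * X $ Some k / D"
    using D by (simp_all add: add_divide_eq_iff diff_divide_eq_iff divide_add_eq_iff divide_diff_eq_iff D_def)
  then show ?thesis
    by (auto simp: vec_eq_iff cone_lift_def cone_unlift_def D_def[symmetric] split: option.split)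
qed

lemma cone_unlift_in_light_cone:
  assumes X: "timelike X"
  shows "cone_unlift k X \<in> light_cone k" "0 < Re ((X $ None - X $ Some k) / (X $ None + X $ Some k))"
proof -
  let ?q = "(X $ None - X $ Some k) / (X $ None + X $ Some k)"
  have t: "timelike (cone_lift k (cone_unlift k X))"
    using X timelike_denominator[OF X, of k]
    by (simp add: cone_lift_unlift timelike_iff lorentz_norm2_scale)
  then have "0 < Re ((csqrt ?q)\<^sup>2) - (\<Sum>j\<in>UNIV - {k}. (cmod (cone_unlift k X $ j))\<^sup>2)"
    using lorentz_norm2_cone_lift[of k "cone_unlift k X"] by (simp add: timelike_iff cone_unlift_def)
  moreover have "0 \<le> (\<Sum>j\<in>UNIV - {k}. (cmod (cone_unlift k X $ j))\<^sup>2)" by (intro sum_nonneg) auto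
  ultimately show q: "0 < Re ?q" by simp
  have "0 \<le> Re (csqrt ?q)" by (rule Re_csqrt)
  moreover have "Re (csqrt ?q) \<noteq> 0"
  proof
    assume "Re (csqrt ?q) = 0"
    then have "Re ((csqrt ?q)\<^sup>2) \<le> 0" by (simp add: power2_eq_square del: power2_csqrt)
    then show False using q by simp
  qed
  ultimately show "cone_unlift k X \<in> light_cone k"
    using t by (simp add: light_cone_iff cone_unlift_def)
qed

lemma cone_unlift_scale: "c \<noteq> 0 \<Longrightarrow> cone_unlift k (c *s X) = cone_unlift k X"
  by (simp add: cone_unlift_def vec_eq_iff flip: distrib_left right_diff_distrib)

lemma cone_unlift_lift:
  assumes "y \<in> light_cone k"
  shows "cone_unlift k (cone_lift k y) = y"
proof -
  have "csqrt ((y $ k)\<^sup>2) = y $ k"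
    using assms by (intro csqrt_square) (simp add: light_cone_iff)
  moreover have "cone_lift k y $ None + cone_lift k y $ Some k = 1"
    "cone_lift k y $ None - cone_lift k y $ Some k = (y $ k)\<^sup>2"
    by (simp_all add: cone_lift_def field_simps)
  ultimately show ?thesis
    by (simp add: cone_unlift_def vec_eq_iff) (simp add: cone_lift_def)
qed

section \<open>The projective image of the light cone\<close>

text \<open>The projective transformation that moves the hyperplane at infinity to \<open>{x. x\<^sub>k = 1}\<close>.\<close>

definition projective_map :: "'n::finite \<Rightarrow> complex ^ 'n \<Rightarrow> complex ^ 'n" where
  "projective_map k y = (1 / (1 + y $ k)) *s y"

definition projective_inverse :: "'n::finite \<Rightarrow> complex ^ 'n \<Rightarrow> complex ^ 'n" where
  "projective_inverse k x = (1 / (1 - x $ k)) *s x"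

lemma projective_inverse_map:
  assumes "1 + y $ k \<noteq> 0"
  shows "projective_inverse k (projective_map k y) = y" "projective_map k y $ k \<noteq> 1"
proof -
  have "1 - projective_map k y $ k = 1 / (1 + y $ k)"
    using assms by (simp add: projective_map_def field_simps)
  then show "projective_inverse k (projective_map k y) = y" "projective_map k y $ k \<noteq> 1"
    using assms by (auto simp: projective_inverse_def projective_map_def vec_eq_iff)
qed

lemma projective_map_inverse:
  assumes "x $ k \<noteq> 1"
  shows "projective_map k (projective_inverse k x) = x"
proof -
  have "1 + projective_inverse k x $ k = 1 / (1 - x $ k)"
    using assms by (simp add: projective_inverse_def field_simps)
  then show ?thesis using assms by (simp add: projective_inverse_def projective_map_def vec_eq_iff)
qed

definition projective_cone :: "'n::finite \<Rightarrow> (complex ^ 'n) set" where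
  "projective_cone k = {x. x $ k \<noteq> 1 \<and> projective_inverse k x \<in> light_cone k}"

lemma light_cone_den:
  fixes y :: "complex ^ 'n::finite"
  shows "y \<in> light_cone k \<Longrightarrow> 1 + y $ k \<noteq> 0"
  by (auto simp: light_cone_iff complex_eq_iff)

lemma projective_map_mem: "y \<in> light_cone k \<Longrightarrow> projective_map k y \<in> projective_cone k"
  using light_cone_den projective_inverse_map by (fastforce simp: projective_cone_def)

lemma open_light_cone: "open (light_cone k)"
  unfolding light_cone_def vector_scalar_mult_def by (intro open_Collect_less continuous_intros)

lemma convex_light_cone: "convex (light_cone k)"
  unfolding convex_def
proof (intro ballI allI impI)
  fix y z :: "complex ^ 'a" and u v :: real
  assume y: "y \<in> light_cone k" and z: "z \<in> light_cone k" and uv: "0 \<le> u" "0 \<le> v" "u + v = 1"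
  define h where "h w = w - of_real (Re (w $ k)) *s axis k 1" for w :: "complex ^ 'a"
  have h: "norm (h y) < Re (y $ k)" "norm (h z) < Re (z $ k)"
    using y z by (auto simp: light_cone_def h_def)
  have "h (u *\<^sub>R y + v *\<^sub>R z) = u *\<^sub>R h y + v *\<^sub>R h z"
    by (simp add: h_def vec_eq_iff scaleR_conv_of_real[where 'a=complex] algebra_simps)
  then have "norm (h (u *\<^sub>R y + v *\<^sub>R z)) \<le> u * norm (h y) + v * norm (h z)"
    using norm_triangle_ineq[of "u *\<^sub>R h y" "v *\<^sub>R h z"] uv by simp
  also have "\<dots> < u * Re (y $ k) + v * Re (z $ k)"
  proof (cases "u = 0")
    case True
    then show ?thesis using h uv by simp
  next
    case False
    then have "u * norm (h y) < u * Re (y $ k)" using h(1) uv by simp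
    moreover have "v * norm (h z) \<le> v * Re (z $ k)" using h(2) uv by (intro mult_left_mono) auto
    ultimately show ?thesis by linarith
  qed
  finally show "u *\<^sub>R y + v *\<^sub>R z \<in> light_cone k"
    by (simp add: light_cone_def h_def)
qed

lemma projective_cone_obtain:
  assumes "x \<in> projective_cone k"
  obtains y where "y \<in> light_cone k" "x = projective_map k y"
  using assms projective_map_inverse[of x k] that unfolding projective_cone_def by force

lemma continuous_on_projective_map: "S \<subseteq> light_cone k \<Longrightarrow> continuous_on S (projective_map k)"
  unfolding projective_map_def vector_scalar_mult_def using light_cone_den by (intro continuous_intros) auto

lemma continuous_on_projective_inverse: "S \<subseteq> {x. x $ k \<noteq> 1} \<Longrightarrow> continuous_on S (projective_inverse k)"
  unfolding projective_inverse_def vector_scalar_mult_def by (intro continuous_intros) auto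

lemma open_projective_cone: "open (projective_cone k)"
proof -
  have "open {x :: complex ^ 'a. x $ k \<noteq> 1}"
    by (intro open_Collect_neq continuous_intros)
  then have "open ({x. x $ k \<noteq> 1} \<inter> projective_inverse k -` light_cone k)"
    by (intro continuous_open_preimage continuous_on_projective_inverse open_light_cone order_refl)
  moreover have "projective_cone k = {x. x $ k \<noteq> 1} \<inter> projective_inverse k -` light_cone k"
    by (auto simp: projective_cone_def)
  ultimately show ?thesis by simp
qed

lemma bounded_projective_cone: "bounded (projective_cone k)"
  unfolding bounded_iff
proof (intro exI[of _ 2] ballI)
  fix x assume "x \<in> projective_cone k"
  then obtain y where y: "y \<in> light_cone k" and x: "x = projective_map k y" by (rule projective_cone_obtain)
  let ?r = "Re (y $ k)"
  have "norm y \<le> norm (y - of_real ?r *s axis k 1) + norm (complex_of_real ?r *s axis k 1)"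
    using norm_triangle_sub[of y "of_real ?r *s axis k 1"] by (simp only: add.commute)
  also have "\<dots> \<le> 2 * ?r"
    using y light_cone_iff[of y k] by (simp add: light_cone_def norm_vector_scalar_mult)
  also have "\<dots> \<le> 2 * cmod (1 + y $ k)"
    using complex_Re_le_cmod[of "1 + y $ k"] by simp
  finally show "norm x \<le> 2"
    using light_cone_den[OF y] by (simp add: x projective_map_def norm_vector_scalar_mult norm_divide divide_le_eq)
qed

text \<open>For \<open>y\<close> in the cone, \<open>y / (1 + y\<^sub>k)\<close> lies on the line through \<open>p\<close> with direction \<open>v\<close> exactly if
  \<open>y - (1 + y\<^sub>k) p\<close> is a multiple of \<open>v\<close>. This condition is affine in \<open>y\<close>, so the preimage of a line
  section is convex.\<close>

lemma C_convex_projective_cone: "C_convex (projective_cone k)"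
  unfolding C_convex_def
proof (intro allI impI disjI2)
  fix L :: "(complex ^ 'a) set" assume "complex_line L"
  then obtain p v where L: "L = range (\<lambda>t. p + t *s v)" unfolding complex_line_def by blast
  define A where "A = {y \<in> light_cone k. \<exists>t. y = (1 + y $ k) *s p + t *s v}"
  have "convex A"
    unfolding convex_def
  proof (intro ballI allI impI)
    fix y z :: "complex ^ 'a" and u w :: real
    assume "y \<in> A" "z \<in> A" and uw: "0 \<le> u" "0 \<le> w" "u + w = 1"
    then obtain s t where s: "y = (1 + y $ k) *s p + s *s v" and t: "z = (1 + z $ k) *s p + t *s v"
      and yz: "y \<in> light_cone k" "z \<in> light_cone k"
      unfolding A_def by blast
    have w: "of_real w = 1 - complex_of_real u" using uw by (metis add_diff_cancel_left' of_real_1 of_real_diff)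
    have "(u *\<^sub>R y + w *\<^sub>R z) $ i = ((1 + (u *\<^sub>R y + w *\<^sub>R z) $ k) *s p + (of_real u * s + of_real w * t) *s v) $ i" for i
    proof -
      have "(u *\<^sub>R y + w *\<^sub>R z) $ i = of_real u * ((1 + y $ k) * p $ i + s * v $ i) + of_real w * ((1 + z $ k) * p $ i + t * v $ i)"
        using arg_cong[OF s, of "\<lambda>x. x $ i"] arg_cong[OF t, of "\<lambda>x. x $ i"] by (simp add: scaleR_conv_of_real[where 'a=complex] algebra_simps)
      also have "\<dots> = ((1 + (u *\<^sub>R y + w *\<^sub>R z) $ k) *s p + (of_real u * s + of_real w * t) *s v) $ i"
        by (simp add: scaleR_conv_of_real[where 'a=complex] w algebra_simps)
      finally show ?thesis .
    qed
    then have "u *\<^sub>R y + w *\<^sub>R z = (1 + (u *\<^sub>R y + w *\<^sub>R z) $ k) *s p + (of_real u * s + of_real w * t) *s v"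
      unfolding vec_eq_iff by blast
    moreover have "u *\<^sub>R y + w *\<^sub>R z \<in> light_cone k"
      using convex_light_cone yz uw unfolding convex_def by blast
    ultimately show "u *\<^sub>R y + w *\<^sub>R z \<in> A" unfolding A_def by blast
  qed
  have "homeomorphism A (projective_cone k \<inter> L) (projective_map k) (projective_inverse k)"
    unfolding homeomorphism_def
  proof (intro conjI ballI)
    have AC: "A \<subseteq> light_cone k" by (auto simp: A_def)
    show "projective_inverse k (projective_map k y) = y" if "y \<in> A" for y
      using that AC light_cone_den projective_inverse_map by blast
    show "projective_map k (projective_inverse k x) = x" if "x \<in> projective_cone k \<inter> L" for x
      using that projective_map_inverse by (auto simp: projective_cone_def)
    show "continuous_on A (projective_map k)" by (rule continuous_on_projective_map[OF AC])
    show "continuous_on (projective_cone k \<inter> L) (projective_inverse k)"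
      by (rule continuous_on_projective_inverse) (auto simp: projective_cone_def)
    have sub1: "projective_map k ` A \<subseteq> projective_cone k \<inter> L"
    proof
      fix x assume "x \<in> projective_map k ` A"
      then obtain y t where y: "y \<in> light_cone k" "y = (1 + y $ k) *s p + t *s v" "x = projective_map k y"
        unfolding A_def by blast
      have "x = (1 / (1 + y $ k)) *s ((1 + y $ k) *s p + t *s v)"
        using y(2,3) by (simp add: projective_map_def)
      also have "\<dots> = p + (t / (1 + y $ k)) *s v"
      proof -
        have "(1 / c) *s (c *s p + t *s v) = p + (t / c) *s v" if "c \<noteq> 0" for c
          using that by (simp add: vec_eq_iff field_simps)
        then show ?thesis using light_cone_den[OF y(1)] by blast
      qed
      finally show "x \<in> projective_cone k \<inter> L"
        using projective_map_mem[OF y(1)] y(3) by (auto simp: L)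
    qed
    have sub2: "projective_inverse k ` (projective_cone k \<inter> L) \<subseteq> A"
    proof
      fix y assume "y \<in> projective_inverse k ` (projective_cone k \<inter> L)"
      then obtain x t where x: "x \<in> projective_cone k" "x = p + t *s v" "y = projective_inverse k x"
        unfolding L by blast
      have y: "y \<in> light_cone k" "x = projective_map k y"
        using x projective_map_inverse[of x k] by (auto simp: projective_cone_def)
      have "y = (1 + y $ k) *s x"
        using light_cone_den[OF y(1)] by (simp add: y(2) projective_map_def vector_smult_assoc)
      also have "\<dots> = (1 + y $ k) *s p + ((1 + y $ k) * t) *s v"
        by (simp add: x(2) vec_eq_iff algebra_simps)
      finally show "y \<in> A" using y(1) unfolding A_def by blast
    qed
    show "projective_map k ` A = projective_cone k \<inter> L"
    proof
      show "projective_cone k \<inter> L \<subseteq> projective_map k ` A"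
      proof
        fix x assume x: "x \<in> projective_cone k \<inter> L"
        then have "x = projective_map k (projective_inverse k x)" using projective_map_inverse[of x k] by (auto simp: projective_cone_def)
        then show "x \<in> projective_map k ` A" using sub2 x by blast
      qed
    qed (rule sub1)
    show "projective_inverse k ` (projective_cone k \<inter> L) = A"
    proof
      show "A \<subseteq> projective_inverse k ` (projective_cone k \<inter> L)"
      proof
        fix y assume y: "y \<in> A"
        then have "y = projective_inverse k (projective_map k y)"
          using AC light_cone_den projective_inverse_map by (metis subsetD)
        then show "y \<in> projective_inverse k ` (projective_cone k \<inter> L)" using sub1 y by blast
      qed
    qed (rule sub2)
  qed
  then have "A homeomorphic (projective_cone k \<inter> L)" unfolding homeomorphic_def by blast
  then show "contractible (projective_cone k \<inter> L)"
    using convex_imp_contractible[OF \<open>convex A\<close>] homeomorphic_contractible_eq by blast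
qed

text \<open>The ray of the cone through \<open>x\<close> is mapped to a segment that ends at \<open>x\<close>.\<close>

lemma frontier_projective_cone:
  fixes x :: "complex ^ 'n::finite"
  assumes "x $ k = 1" "norm (x - axis k 1) < 1"
  shows "x \<in> frontier (projective_cone k)"
proof -
  define z where "z m = (real m / real (Suc m)) *\<^sub>R x" for m
  have "z m \<in> projective_cone k" if "m > 0" for m
  proof -
    define y where "y = real m *\<^sub>R x"
    have "y - of_real (Re (y $ k)) *s axis k 1 = real m *\<^sub>R (x - axis k 1)"
      by (simp add: y_def assms(1) vec_eq_iff scaleR_conv_of_real[where 'a=complex] algebra_simps)
    then have "norm (y - of_real (Re (y $ k)) *s axis k 1) < real m"
      using assms(2) that by simp
    then have "y \<in> light_cone k" by (simp add: light_cone_def y_def assms(1))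
    moreover have "projective_map k y = z m"
      by (simp add: projective_map_def y_def z_def assms(1) vec_eq_iff scaleR_conv_of_real[where 'a=complex])
    ultimately show ?thesis using projective_map_mem by metis
  qed
  then have "z (Suc m) \<in> projective_cone k" for m by simp
  moreover have "(\<lambda>m. z (Suc m)) \<longlonglongrightarrow> x"
  proof -
    have "z \<longlonglongrightarrow> 1 *\<^sub>R x"
      unfolding z_def by (intro tendsto_intros LIMSEQ_n_over_Suc_n)
    then show ?thesis using LIMSEQ_Suc by simp
  qed
  ultimately have "x \<in> closure (projective_cone k)"
    unfolding closure_sequential by (intro exI[of _ "\<lambda>m. z (Suc m)"]) auto
  moreover have "x \<notin> projective_cone k" using assms(1) by (simp add: projective_cone_def)
  ultimately show ?thesis
    by (simp add: frontier_def interior_open open_projective_cone)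
qed

lemma frontier_projective_cone_affine_ball:
  "\<exists>B. complex_affine_ball (CARD('n) - 1) B \<and> B \<subseteq> frontier (projective_cone (k :: 'n::finite))"
proof -
  define m where "m = CARD('n) - 1"
  have "card (UNIV - {k}) = m" by (simp add: m_def card_Diff_singleton)
  then obtain h where h: "bij_betw h {..<m} (UNIV - {k})"
    using ex_bij_betw_nat_finite[of "UNIV - {k}"] by (auto simp: atLeast0LessThan)
  define v :: "nat \<Rightarrow> complex ^ 'n" where "v i = axis (h i) 1" for i
  have inj: "inj_on h {..<m}" using h by (simp add: bij_betw_def)
  have hk: "h i \<noteq> k" if "i < m" for i using h that by (auto simp: bij_betw_def)
  define s where "s w = (\<Sum>i<m. w i *s v i)" for w
  have s_h: "s w $ h j = w j" if "j < m" for w j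
  proof -
    have "s w $ h j = (\<Sum>i<m. if i = j then w i else 0)"
      unfolding s_def sum_component
      by (rule sum.cong) (use inj that in \<open>auto simp: v_def axis_def inj_on_def\<close>)
    then show ?thesis using that by simp
  qed
  have s_k: "s w $ k = 0" for w
    unfolding s_def sum_component by (rule sum.neutral) (use hk in \<open>auto simp: v_def axis_def\<close>)
  have norm_s: "(norm (s w))\<^sup>2 = (\<Sum>i<m. (cmod (w i))\<^sup>2)" for w
  proof -
    have "(norm (s w))\<^sup>2 = (\<Sum>j\<in>UNIV. (cmod (s w $ j))\<^sup>2)"
      by (simp add: norm_vec_def L2_set_def sum_nonneg)
    also have "\<dots> = (\<Sum>j\<in>UNIV - {k}. (cmod (s w $ j))\<^sup>2)"
      by (subst sum.remove[of _ k]) (auto simp: s_k)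
    also have "\<dots> = (\<Sum>i<m. (cmod (s w $ h i))\<^sup>2)"
      by (rule sum.reindex_bij_betw[OF h, symmetric])
    finally show ?thesis by (simp add: s_h)
  qed
  define B where "B = (\<lambda>w. axis k 1 + (\<Sum>i<m. w i *s v i)) ` complex_unit_ball m"
  have "complex_affine_ball m B"
    unfolding complex_affine_ball_def
  proof (intro exI conjI)
    show "inj_on (\<lambda>w. axis k 1 + (\<Sum>i<m. w i *s v i)) (complex_space m)"
    proof (rule inj_onI)
      fix w w' assume w: "w \<in> complex_space m" "w' \<in> complex_space m"
        and eq: "axis k 1 + (\<Sum>i<m. w i *s v i) = axis k 1 + (\<Sum>i<m. w' i *s v i)"
      have "s w = s w'" using eq by (simp add: s_def)
      show "w = w'"
      proof
        fix j show "w j = w' j"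
        proof (cases "j < m")
          case True
          then show ?thesis using s_h[of j w] s_h[of j w'] \<open>s w = s w'\<close> by simp
        next
          case False
          then show ?thesis using w by (simp add: complex_space_def)
        qed
      qed
    qed
  qed (rule B_def)
  moreover have "B \<subseteq> frontier (projective_cone k)"
  proof
    fix x assume "x \<in> B"
    then obtain w where w: "w \<in> complex_unit_ball m" "x = axis k 1 + s w"
      unfolding B_def s_def by blast
    have "(norm (s w))\<^sup>2 < 1" using w(1) by (simp add: norm_s complex_unit_ball_def)
    then have "norm (s w) < 1" by (simp add: abs_square_less_1)
    then show "x \<in> frontier (projective_cone k)"
      using w(2) s_k by (intro frontier_projective_cone) (auto simp: axis_def)
  qed
  ultimately show ?thesis unfolding m_def by blast
qed

section \<open>Extremal discs of the projective cone\<close>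

definition cone_coords :: "'n::finite \<Rightarrow> complex ^ 'n \<Rightarrow> complex ^ ('n option)" where
  "cone_coords k x = cone_lift k (projective_inverse k x)"

definition cone_point :: "'n::finite \<Rightarrow> complex ^ ('n option) \<Rightarrow> complex ^ 'n" where
  "cone_point k X = projective_map k (cone_unlift k X)"

lemma timelike_cone_coords: "x \<in> projective_cone k \<Longrightarrow> timelike (cone_coords k x)"
  by (simp add: cone_coords_def projective_cone_def timelike_cone_lift)

lemma cone_point_in_projective_cone: "timelike X \<Longrightarrow> cone_point k X \<in> projective_cone k"
  by (simp add: cone_point_def projective_map_mem cone_unlift_in_light_cone)

lemma cone_point_coords: "x \<in> projective_cone k \<Longrightarrow> cone_point k (cone_coords k x) = x"
  by (simp add: cone_point_def cone_coords_def projective_cone_def cone_unlift_lift projective_map_inverse)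

lemma cone_coords_point:
  assumes "timelike X"
  shows "\<exists>c. c \<noteq> 0 \<and> cone_coords k (cone_point k X) = c *s X"
proof -
  have "projective_inverse k (cone_point k X) = cone_unlift k X"
    unfolding cone_point_def using cone_unlift_in_light_cone(1)[OF assms] light_cone_den projective_inverse_map(1) by blast
  then have "cone_coords k (cone_point k X) = (1 / (X $ None + X $ Some k)) *s X"
    by (simp add: cone_coords_def cone_lift_unlift[OF assms])
  then show ?thesis using timelike_denominator[OF assms, of k] by (metis divide_eq_0_iff one_neq_zero)
qed

lemma cone_point_scale: "c \<noteq> 0 \<Longrightarrow> cone_point k (c *s X) = cone_point k X"
  by (simp add: cone_point_def cone_unlift_scale)

text \<open>The principal square root is holomorphic here because its argument has positive real part.\<close>

lemma holomorphic_disc_cone_point: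
  assumes t: "\<And>z. cmod z < 1 \<Longrightarrow> timelike (X + z *s E)"
  shows "holomorphic_disc (projective_cone k) (\<lambda>z. cone_point k (X + z *s E))"
  unfolding holomorphic_disc_def
proof (intro conjI allI)
  show "(\<lambda>z. cone_point k (X + z *s E)) \<in> ball 0 1 \<rightarrow> projective_cone k"
    using t by (auto intro!: cone_point_in_projective_cone)
  fix j
  define D where "D z = (X + z *s E) $ None + (X + z *s E) $ Some k" for z
  define r where "r z = csqrt (((X + z *s E) $ None - (X + z *s E) $ Some k) / D z)" for z
  have D0: "D z \<noteq> 0" if "z \<in> ball 0 1" for z
    using timelike_denominator[OF t] that by (simp add: D_def)
  have holD: "D holomorphic_on ball 0 1"
    unfolding D_def by (auto intro!: holomorphic_intros)
  have holr: "r holomorphic_on ball 0 1"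
    unfolding r_def
  proof (rule holomorphic_on_csqrt')
    show "(\<lambda>z. ((X + z *s E) $ None - (X + z *s E) $ Some k) / D z) holomorphic_on ball 0 1"
      using D0 holD by (auto intro!: holomorphic_intros)
    show "((X + z *s E) $ None - (X + z *s E) $ Some k) / D z \<notin> \<real>\<^sub>\<le>\<^sub>0" if "z \<in> ball 0 1" for z
      using cone_unlift_in_light_cone(2)[OF t, of z k] that
      by (auto simp: D_def complex_nonpos_Reals_iff)
  qed
  have r0: "1 + r z \<noteq> 0" if "z \<in> ball 0 1" for z
    using light_cone_den[OF cone_unlift_in_light_cone(1)[OF t, of z k]] that
    by (simp add: cone_unlift_def r_def D_def)
  have "(\<lambda>z. cone_point k (X + z *s E) $ j) = (\<lambda>z. 1 / (1 + r z) * (if j = k then r z else (X + z *s E) $ Some j / D z))"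
    by (simp add: fun_eq_iff cone_point_def projective_map_def cone_unlift_def r_def D_def)
  moreover have "(\<lambda>z. 1 / (1 + r z) * (if j = k then r z else (X + z *s E) $ Some j / D z)) holomorphic_on ball 0 1"
    using r0 D0 holr holD by (cases "j = k") (auto intro!: holomorphic_intros)
  ultimately show "(\<lambda>z. cone_point k (X + z *s E) $ j) holomorphic_on ball 0 1" by simp
qed

lemma holomorphic_fun_on_lorentz_cone_coords:
  "holomorphic_fun_on (projective_cone k) (\<lambda>x. lorentz (cone_coords k x) Z)"
proof -
  have u: "holomorphic_fun_on (projective_cone k) (\<lambda>x. projective_inverse k x $ j)" for j
  proof -
    have "holomorphic_fun_on (projective_cone k) (\<lambda>x. x $ j / (1 + (- 1) * x $ k))"
      by (intro holomorphic_fun_on_divide holomorphic_fun_on_add holomorphic_fun_on_mult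
          holomorphic_fun_on_const holomorphic_fun_on_component) (auto simp: projective_cone_def)
    then show ?thesis by (simp add: projective_inverse_def)
  qed
  have c: "holomorphic_fun_on (projective_cone k) (\<lambda>x. cone_coords k x $ i)" for i
  proof (cases i)
    case None
    have "holomorphic_fun_on (projective_cone k) (\<lambda>x. (1 + projective_inverse k x $ k * projective_inverse k x $ k) * (1 / 2))"
      by (intro holomorphic_fun_on_add holomorphic_fun_on_mult holomorphic_fun_on_const u)
    then show ?thesis by (simp add: cone_coords_def cone_lift_def None power2_eq_square)
  next
    case (Some j)
    have "holomorphic_fun_on (projective_cone k) (\<lambda>x. (1 + (- 1) * (projective_inverse k x $ k * projective_inverse k x $ k)) * (1 / 2))"
      by (intro holomorphic_fun_on_add holomorphic_fun_on_mult holomorphic_fun_on_const u)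
    then show ?thesis
      using u[of j] by (cases "j = k") (simp_all add: cone_coords_def cone_lift_def Some power2_eq_square)
  qed
  have "holomorphic_fun_on (projective_cone k)
      (\<lambda>x. cone_coords k x $ None * cnj (Z $ None) + (- 1) * (\<Sum>i\<in>UNIV. cone_coords k x $ Some i * cnj (Z $ Some i)))"
    by (intro holomorphic_fun_on_add holomorphic_fun_on_mult holomorphic_fun_on_const holomorphic_fun_on_sum c) auto
  then show ?thesis by (simp add: lorentz_def)
qed

text \<open>With \<open>X\<close> normalised and \<open>E\<close> the unit vector orthogonal to it in the plane of \<open>X\<close> and \<open>Y\<close>, the disc is
  \<open>z \<mapsto> X + z E\<close>, and \<open>g\<close> is the quotient of the \<open>E\<close>- and the \<open>X\<close>-coordinate.\<close>

lemma projective_cone_extremal_disc: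
  assumes x: "x \<in> projective_cone k" and y: "y \<in> projective_cone k"
  obtains l f g where "extremal_disc (projective_cone k) x y l f g"
    "cosh l = lorentz_cosh (cone_coords k x) (cone_coords k y)"
proof (cases "x = y")
  case True
  have "extremal_disc (projective_cone k) x y 0 (\<lambda>z. x) (\<lambda>z. 0)"
    using x True unfolding extremal_disc_def holomorphic_disc_def
    by (auto simp: disc_curve_def intro: holomorphic_fun_on_const)
  then show thesis
    using that True lorentz_cosh_self[OF timelike_cone_coords[OF x]] by fastforce
next
  case False
  define X where "X = cone_coords k x"
  define Y where "Y = cone_coords k y"
  have X: "timelike X" and Y: "timelike Y" using x y by (simp_all add: X_def Y_def timelike_cone_coords)
  have ne: "Y \<noteq> c *s X" for c
  proof
    assume eq: "Y = c *s X"
    then have "c \<noteq> 0" using timelike_ne[OF Y] by auto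
    then have "cone_point k Y = cone_point k X" using eq cone_point_scale by blast
    then show False using False x y by (simp add: X_def Y_def cone_point_coords)
  qed
  obtain \<alpha> \<beta> E l where nf: "\<alpha> \<noteq> 0" "\<beta> \<noteq> 0" "l > 0" "cosh l = lorentz_cosh X Y"
    "lorentz_norm2 (\<alpha> *s X) = 1" "lorentz_norm2 E = -1" "lorentz E (\<alpha> *s X) = 0"
    "\<beta> *s Y = of_real (cosh l) *s (\<alpha> *s X) + of_real (sinh l) *s E"
    by (rule lorentz_plane_normal_form[OF X Y ne]) (rule that)
  \<comment> \<open>The slice of the cone by the complex line through \<open>x\<close> and \<open>y\<close> in Lorentzian coordinates.\<close>
  define f where "f z = cone_point k (\<alpha> *s X + z *s E)" for z
  define g where "g p = - lorentz (cone_coords k p) E / lorentz (cone_coords k p) (\<alpha> *s X)" for p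
  have bound: "cmod (lorentz (cone_coords k p) E) < cmod (lorentz (cone_coords k p) (\<alpha> *s X))"
    if "p \<in> projective_cone k" for p
    by (rule timelike_projection_bound[OF nf(5-7) timelike_cone_coords[OF that]])
  have den: "lorentz (cone_coords k p) (\<alpha> *s X) \<noteq> 0" if "p \<in> projective_cone k" for p
    using bound[OF that] by (metis norm_ge_zero norm_zero not_less)
  have ch: "cosh l \<noteq> 0" using cosh_real_pos[of l] by linarith
  have XE: "lorentz (\<alpha> *s X) E = 0" using nf(7) lorentz_cnj[of E "\<alpha> *s X"] by simp
  have YE: "\<beta> * lorentz Y E = - of_real (sinh l)"
    using arg_cong[OF nf(8), of "\<lambda>V. lorentz V E"] XE nf(6)
    by (simp add: lorentz_add_left lorentz_scale_left lorentz_self)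
  have YX: "\<beta> * lorentz Y (\<alpha> *s X) = of_real (cosh l)"
    using arg_cong[OF nf(8), of "\<lambda>V. lorentz V (\<alpha> *s X)"] nf(5,7) lorentz_self[of "\<alpha> *s X"]
    by (simp add: lorentz_add_left lorentz_scale_left)
  have "extremal_disc (projective_cone k) x y l f g"
    unfolding extremal_disc_def
  proof (intro conjI ballI)
    show "holomorphic_disc (projective_cone k) f"
      unfolding f_def by (intro holomorphic_disc_cone_point timelike_plane_disc nf)
    have "holomorphic_fun_on (projective_cone k)
        (\<lambda>p. ((- 1) * lorentz (cone_coords k p) E) / lorentz (cone_coords k p) (\<alpha> *s X))"
      by (intro holomorphic_fun_on_divide holomorphic_fun_on_mult holomorphic_fun_on_const
          holomorphic_fun_on_lorentz_cone_coords den)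
    then show "holomorphic_fun_on (projective_cone k) g" by (simp add: g_def[abs_def])
    show "cmod (g p) < 1" if "p \<in> projective_cone k" for p
      using bound[OF that] den[OF that] by (simp add: g_def norm_divide)
    show "l \<ge> 0" using nf by simp
    show "disc_curve f 0 = x"
      using nf(1) x by (simp add: disc_curve_def f_def cone_point_scale X_def cone_point_coords)
    show "disc_curve f l = y"
    proof -
      have "\<alpha> *s X + of_real (tanh l) *s E = (1 / of_real (cosh l)) *s (\<beta> *s Y)"
        unfolding nf(8) using ch by (simp add: vec_eq_iff tanh_def field_simps)
      then have "disc_curve f l = cone_point k ((1 / of_real (cosh l)) *s (\<beta> *s Y))"
        by (simp add: disc_curve_def f_def)
      also have "\<dots> = cone_point k Y" using ch nf(2) by (simp add: cone_point_scale)
      finally show ?thesis using y by (simp add: Y_def cone_point_coords)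
    qed
    show "g x = 0"
      using XE nf(1) by (simp add: g_def X_def[symmetric] lorentz_scale_left)
    show "g y = of_real (tanh l)"
    proof -
      have "g y = - (\<beta> * lorentz Y E) / (\<beta> * lorentz Y (\<alpha> *s X))"
        using nf(2) by (simp add: g_def Y_def)
      then show ?thesis unfolding YE YX by (simp add: tanh_def)
    qed
  qed
  then show thesis using that nf(4) by (simp add: X_def Y_def)
qed

theorem projective_cone_Gromov_hyperbolic:
  "Gromov_hyperbolic (projective_cone k) (kobayashi_distance (projective_cone k))"
proof -
  let ?\<Omega> = "projective_cone k" and ?d = "kobayashi_distance (projective_cone k)"
  have geo: "geodesic_metric_space ?\<Omega> ?d"
    using kobayashi_distance_geodesic_metric_space[OF open_projective_cone] projective_cone_extremal_disc
    by metis
  then have M: "Metric_space ?\<Omega> ?d" unfolding geodesic_metric_space_def by blast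
  have d: "0 \<le> ?d x y \<and> cosh (?d x y) = lorentz_cosh (cone_coords k x) (cone_coords k y)"
    if xy: "x \<in> ?\<Omega>" "y \<in> ?\<Omega>" for x y
  proof -
    obtain l f g where e: "extremal_disc ?\<Omega> x y l f g" "cosh l = lorentz_cosh (cone_coords k x) (cone_coords k y)"
      using projective_cone_extremal_disc[OF xy] by blast
    then show ?thesis
      using kobayashi_distance_extremal_disc(1)[OF open_projective_cone e(1)]
      by (simp add: extremal_disc_def)
  qed
  have "proper_metric_space ?\<Omega> ?d"
  proof (rule complex_hyperbolic_model_proper[OF M, of "cone_coords k"])
    show "\<exists>x\<in>?\<Omega>. \<exists>c. c \<noteq> 0 \<and> cone_coords k x = c *s X" if "timelike X" for X
      using cone_coords_point[OF that] cone_point_in_projective_cone[OF that] by blast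
  qed (use timelike_cone_coords d in auto)
  moreover have "four_point ?\<Omega> ?d (ln 256)"
    unfolding four_point_def
    by (intro ballI four_point_of_lorentz_cosh[of ?\<Omega> "cone_coords k" ?d, OF timelike_cone_coords d])
  ultimately show ?thesis
    using four_point_Gromov_hyperbolic[OF _ geo] by simp
qed

theorem proposition1p9:
  assumes "CARD('n::finite) \<ge> 2"
  shows "\<exists>\<Omega> :: (complex ^ 'n) set.
           bounded \<Omega> \<and> open \<Omega> \<and> C_convex \<Omega> \<and>
           Gromov_hyperbolic \<Omega> (kobayashi_distance \<Omega>) \<and>
           (\<exists>B. complex_affine_ball (CARD('n) - 1) B \<and> B \<subseteq> frontier \<Omega>)"
proof (rule exI[of _ "projective_cone (undefined :: 'n)"], intro conjI)
  \<comment> \<open>Every coordinate can serve as the distinguished one.\<close>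
  let ?k = "undefined :: 'n"
  show "bounded (projective_cone ?k)" by (rule bounded_projective_cone)
  show "open (projective_cone ?k)" by (rule open_projective_cone)
  show "C_convex (projective_cone ?k)" by (rule C_convex_projective_cone)
  show "Gromov_hyperbolic (projective_cone ?k) (kobayashi_distance (projective_cone ?k))"
    by (rule projective_cone_Gromov_hyperbolic)
qed (rule frontier_projective_cone_affine_ball)

end
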